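(* Let $D_{9}$ be the Weyl algebra over $\mathbb{C}$ in the entries $t_{ij}$ ($1\le i,j\le 3$) of a $3\times 3$ matrix, with derivations $\partial_{ij}=\partial/\partial t_{ij}$. Let $J\subset D_9$ be the left ideal generated by $$d=1-\det\big((\partial_{ij})\big),\qquad g_{ij}=\delta_{ij}-\sum_{k=1}^3\partial_{ik}\partial_{jk}\ (1\le i\le j\le 3),\qquad P_{ij}=\sum_{k=1}^3\big(t_{ik}\partial_{jk}-t_{jk}\partial_{ik}\big)\ (1\le i<j\le 3).$$ Then the holonomic rank of $J$ is $\operatorname{rank}(J)=4$.
   Context: For a left ideal $L$ in a Weyl algebra $D_N=\mathbb{C}[x_1,\dots,x_N]\langle\partial_1,\dots,\partial_N\rangle$, let $R_N=\mathbb{C}(x_1,\dots,x_N)\langle\partial_1,\dots,\partial_N\rangle$ be the rational Weyl algebra. The holonomic rank of $L$ is $\operatorname{rank}(L)=\dim_{\mathbb{C}(x_1,\dots,x_N)}(R_N/R_NL)$. $\delta_{ij}$ is the Kronecker delta. *)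

theory Defs
  imports
    "HOL-Library.Poly_Mapping"
    "HOL-Library.Numeral_Type"
    "HOL-Library.Extended_Nat"
    "HOL-Computational_Algebra.Fraction_Field"
    "HOL-Combinatorics.Permutations"
    "HOL-Algebra.AbelCoset"
    "Jordan_Normal_Form.Missing_VectorSpace"
begin

hide_const (open) Poly_Mapping.range

text \<open>The variables are indexed by a finite type; its linear order plays no mathematical role, but
  the library needs it to make the polynomial ring an integral domain.\<close>

type_synonym 'v mpoly = "('v \<Rightarrow>\<^sub>0 nat) \<Rightarrow>\<^sub>0 complex"
type_synonym 'v ratfun = "(('v \<Rightarrow>\<^sub>0 nat) \<Rightarrow>\<^sub>0 complex) fract"

definition mpoly_diff :: "'v \<Rightarrow> 'v mpoly \<Rightarrow> 'v mpoly" where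
  "mpoly_diff v p = (\<Sum>m\<in>Poly_Mapping.keys p.
     Poly_Mapping.single (m - Poly_Mapping.single v 1)
       (of_nat (Poly_Mapping.lookup m v) * Poly_Mapping.lookup p m))"

lemma poly_mapping_add_induct [case_names single add]:
  assumes single: "\<And>k a. P (Poly_Mapping.single k a)"
    and add: "\<And>p q. P p \<Longrightarrow> P q \<Longrightarrow> P (p + q)"
  shows "P (p :: 'a \<Rightarrow>\<^sub>0 'b::comm_monoid_add)"
proof (induction p rule: update_induct)
  case const
  show ?case using single[of undefined 0] by simp
next
  case (update f a b)
  have "Poly_Mapping.update a b f = f + Poly_Mapping.single a b"
    using update(1)
    by (intro poly_mapping_eqI) (auto simp: lookup_update lookup_add lookup_single when_def in_keys_iff)
  then show ?case using update single add by simp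
qed

lemma mpoly_diff_single:
  "mpoly_diff v (Poly_Mapping.single m c) =
     Poly_Mapping.single (m - Poly_Mapping.single v 1) (of_nat (Poly_Mapping.lookup m v) * c)"
  by (cases "c = 0") (auto simp: mpoly_diff_def)

lemma mpoly_diff_add: "mpoly_diff v (p + q) = mpoly_diff v p + mpoly_diff v q"
  unfolding mpoly_diff_def
  by (rule setsum_keys_plus_distrib) (auto simp: algebra_simps single_add)

lemma mpoly_diff_mult: "mpoly_diff v (p * q) = mpoly_diff v p * q + p * mpoly_diff v q"
proof (induction p rule: poly_mapping_add_induct)
  case (single k a)
  show ?case
  proof (induction q rule: poly_mapping_add_induct)
    case (single l b)
    have 1: "Poly_Mapping.single (k - Poly_Mapping.single v 1 + l) (of_nat (Poly_Mapping.lookup k v) * (a * b))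
       = Poly_Mapping.single (k + l - Poly_Mapping.single v 1) (of_nat (Poly_Mapping.lookup k v) * (a * b))"
    proof (cases "Poly_Mapping.lookup k v = 0")
      case False
      then have "k - Poly_Mapping.single v 1 + l = k + l - Poly_Mapping.single v 1"
        by (intro poly_mapping_eqI) (auto simp: lookup_add lookup_minus lookup_single when_def)
      then show ?thesis by simp
    qed simp
    have 2: "Poly_Mapping.single (k + (l - Poly_Mapping.single v 1)) (of_nat (Poly_Mapping.lookup l v) * (a * b))
       = Poly_Mapping.single (k + l - Poly_Mapping.single v 1) (of_nat (Poly_Mapping.lookup l v) * (a * b))"
    proof (cases "Poly_Mapping.lookup l v = 0")
      case False
      then have "k + (l - Poly_Mapping.single v 1) = k + l - Poly_Mapping.single v 1"
        by (intro poly_mapping_eqI) (auto simp: lookup_add lookup_minus lookup_single when_def)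
      then show ?thesis by simp
    qed simp
    show ?case
      using 1 2
      by (simp add: mult_single mpoly_diff_single lookup_add algebra_simps single_add)
  next
    case (add p q)
    then show ?case by (simp add: mpoly_diff_add algebra_simps)
  qed
next
  case (add p q)
  then show ?case by (simp add: mpoly_diff_add algebra_simps)
qed

lemma mpoly_diff_commute: "mpoly_diff v (mpoly_diff w p) = mpoly_diff w (mpoly_diff v p)"
proof (induction p rule: poly_mapping_add_induct)
  case (single k a)
  have "k - Poly_Mapping.single v 1 - Poly_Mapping.single w 1
      = k - Poly_Mapping.single w 1 - Poly_Mapping.single v 1"
    by (intro poly_mapping_eqI) (auto simp: lookup_minus)
  then show ?case
    by (cases "v = w") (simp_all add: mpoly_diff_single lookup_minus lookup_single algebra_simps)
next
  case (add p q)
  then show ?case by (simp add: mpoly_diff_add)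
qed

lift_definition ratfun_diff :: "'v::{finite,linorder} \<Rightarrow> 'v ratfun \<Rightarrow> 'v ratfun"
  is "\<lambda>v (a, b). (mpoly_diff v a * b - a * mpoly_diff v b, b * b)"
proof (clarsimp simp: no_zero_divisors)
  fix v :: 'v and a b c d :: "'v mpoly"
  assume eq: "a * d = c * b"
  have "mpoly_diff v a * d + a * mpoly_diff v d = mpoly_diff v c * b + c * mpoly_diff v b"
    using arg_cong[OF eq, of "mpoly_diff v"] by (simp add: mpoly_diff_mult)
  moreover have "(mpoly_diff v a * b - a * mpoly_diff v b) * (d * d)
      - (mpoly_diff v c * d - c * mpoly_diff v d) * (b * b)
    = b * d * ((mpoly_diff v a * d + a * mpoly_diff v d) - (mpoly_diff v c * b + c * mpoly_diff v b))
      + (mpoly_diff v b * d + mpoly_diff v d * b) * (c * b - a * d)"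
    by (simp add: algebra_simps)
  ultimately show "(mpoly_diff v a * b - a * mpoly_diff v b) * (d * d)
      = (mpoly_diff v c * d - c * mpoly_diff v d) * (b * b)"
    using eq by simp
qed

lemma ratfun_diff_Fract:
  "b \<noteq> 0 \<Longrightarrow> ratfun_diff v (Fract a b) = Fract (mpoly_diff v a * b - a * mpoly_diff v b) (b * b)"
  by (simp add: Fract_def ratfun_diff.abs_eq)

lemma mpoly_diff_one [simp]: "mpoly_diff v 1 = 0"
  using mpoly_diff_single[of v 0 1] by simp

lemma mpoly_diff_zero [simp]: "mpoly_diff v 0 = 0"
  by (simp add: mpoly_diff_def)

lemma ratfun_diff_poly: "ratfun_diff v (Fract a 1) = Fract (mpoly_diff v a) 1"
  by (simp add: ratfun_diff_Fract)

lemma ratfun_diff_zero [simp]: "ratfun_diff v 0 = 0"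
  by (simp add: Zero_fract_def ratfun_diff_poly)

lemma ratfun_diff_one [simp]: "ratfun_diff v 1 = 0"
  by (simp add: One_fract_def Zero_fract_def ratfun_diff_poly)

lemma ratfun_diff_add: "ratfun_diff v (f + g) = ratfun_diff v f + ratfun_diff v g"
  by (cases f, cases g)
    (simp add: ratfun_diff_Fract eq_fract mpoly_diff_add mpoly_diff_mult algebra_simps)

lemma ratfun_diff_mult: "ratfun_diff v (f * g) = ratfun_diff v f * g + f * ratfun_diff v g"
  by (cases f, cases g)
    (simp add: ratfun_diff_Fract eq_fract mpoly_diff_add mpoly_diff_mult algebra_simps)

lemma ratfun_diff_commute: "ratfun_diff v (ratfun_diff w f) = ratfun_diff w (ratfun_diff v f)"
proof (cases f)
  case (Fract a b)
  let ?C = "\<lambda>f. ratfun_diff v (ratfun_diff w f) - ratfun_diff w (ratfun_diff v f)"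
  have "f * Fract b 1 = Fract a 1"
    using Fract by (simp add: eq_fract)
  then have "?C (f * Fract b 1) = 0"
    by (simp add: ratfun_diff_poly mpoly_diff_commute[of v w])
  moreover have "?C (f * Fract b 1) = ?C f * Fract b 1 + f * ?C (Fract b 1)"
    by (simp add: ratfun_diff_mult ratfun_diff_add algebra_simps)
  moreover have "?C (Fract b 1) = 0"
    by (simp add: ratfun_diff_poly mpoly_diff_commute[of v w])
  moreover have "Fract b 1 \<noteq> 0"
    using Fract by (simp add: Zero_fract_def eq_fract)
  ultimately show ?thesis by simp
qed

text \<open>An element of the rational Weyl algebra is stored in normal form: the finitely supported function \<open>\<alpha> \<mapsto> a\<^sub>\<alpha>\<close> stands for
  the sum of the \<open>a\<^sub>\<alpha> \<partial>\<^sup>\<alpha>\<close>. The commutative product that the type of finitely supported functions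
  carries in the library is that of the symbols; it serves below only for multiplying by
  a coefficient from the left and for shifting exponents.\<close>

definition monom_act :: "('v::{finite,linorder} \<Rightarrow> 'm \<Rightarrow> 'm) \<Rightarrow> ('v \<Rightarrow>\<^sub>0 nat) \<Rightarrow> 'm \<Rightarrow> 'm" where
  "monom_act D \<alpha> = fold (\<lambda>v. D v ^^ Poly_Mapping.lookup \<alpha> v) (sorted_list_of_set UNIV)"

text \<open>Left multiplication by \<open>\<partial>\<^sub>v\<close>: \<open>\<partial>\<^sub>v (a \<partial>\<^sup>\<alpha>) = (\<partial>a/\<partial>x\<^sub>v) \<partial>\<^sup>\<alpha> + a \<partial>\<^sub>v \<partial>\<^sup>\<alpha>\<close>.\<close>

definition nf_diff :: "'v::{finite,linorder} \<Rightarrow> (('v \<Rightarrow>\<^sub>0 nat) \<Rightarrow>\<^sub>0 'v ratfun) \<Rightarrow> (('v \<Rightarrow>\<^sub>0 nat) \<Rightarrow>\<^sub>0 'v ratfun)" where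
  "nf_diff v q = Poly_Mapping.map (ratfun_diff v) q + Poly_Mapping.single (Poly_Mapping.single v 1) 1 * q"

definition nf_times ::
  "(('v::{finite,linorder} \<Rightarrow>\<^sub>0 nat) \<Rightarrow>\<^sub>0 'v ratfun) \<Rightarrow> (('v \<Rightarrow>\<^sub>0 nat) \<Rightarrow>\<^sub>0 'v ratfun) \<Rightarrow> (('v \<Rightarrow>\<^sub>0 nat) \<Rightarrow>\<^sub>0 'v ratfun)" where
  "nf_times p q = (\<Sum>\<alpha>\<in>Poly_Mapping.keys p.
     Poly_Mapping.single 0 (Poly_Mapping.lookup p \<alpha>) * monom_act nf_diff \<alpha> q)"

lemma exponent_induct [case_names zero add]:
  fixes \<alpha> :: "'v::finite \<Rightarrow>\<^sub>0 nat"
  assumes zero: "P 0" and add: "\<And>\<alpha> v. P \<alpha> \<Longrightarrow> P (\<alpha> + Poly_Mapping.single v 1)"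
  shows "P \<alpha>"
proof (induction "\<Sum>v\<in>UNIV. Poly_Mapping.lookup \<alpha> v" arbitrary: \<alpha>)
  case 0
  then have "\<alpha> = 0" by (intro poly_mapping_eqI) simp
  then show ?case using zero by simp
next
  case (Suc n)
  then obtain v where v: "Poly_Mapping.lookup \<alpha> v \<noteq> 0"
    by (metis nat.distinct(1) sum.neutral)
  define \<beta> where "\<beta> = \<alpha> - Poly_Mapping.single v 1"
  have \<alpha>: "\<alpha> = \<beta> + Poly_Mapping.single v 1"
    unfolding \<beta>_def using v
    by (intro poly_mapping_eqI) (auto simp: lookup_add lookup_minus lookup_single when_def)
  have "Suc n = (\<Sum>w\<in>UNIV. Poly_Mapping.lookup \<beta> w) + 1"
    using Suc(2) unfolding \<alpha> by (simp add: lookup_add sum.distrib lookup_single when_def)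
  then show ?case using Suc(1)[of \<beta>] add \<alpha> by simp
qed

lemma monom_act_zero [simp]: "monom_act D 0 = id"
proof -
  have "fold (\<lambda>v. D v ^^ Poly_Mapping.lookup 0 v) xs = id" for xs
    by (induction xs) auto
  then show ?thesis by (simp add: monom_act_def)
qed

lemma monom_act_add:
  fixes v :: "'v::{finite,linorder}"
  assumes comm: "\<And>v w m. D v (D w m) = D w (D v m)"
  shows "monom_act D (\<alpha> + Poly_Mapping.single v 1) m = D v (monom_act D \<alpha> m)"
proof -
  have pow: "(D w ^^ n) (D v m) = D v ((D w ^^ n) m)" for w n m
    by (induction n) (auto simp: comm)
  have fold: "fold (\<lambda>v. D v ^^ Poly_Mapping.lookup \<alpha> v) xs (D v m)
      = D v (fold (\<lambda>v. D v ^^ Poly_Mapping.lookup \<alpha> v) xs m)" for \<alpha> xs m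
    by (induction xs arbitrary: m) (auto simp: pow)
  have "distinct xs \<Longrightarrow> fold (\<lambda>w. D w ^^ Poly_Mapping.lookup (\<alpha> + Poly_Mapping.single v 1) w) xs m
      = (if v \<in> set xs then D v (fold (\<lambda>w. D w ^^ Poly_Mapping.lookup \<alpha> w) xs m)
         else fold (\<lambda>w. D w ^^ Poly_Mapping.lookup \<alpha> w) xs m)" for xs m
    by (induction xs arbitrary: m) (auto simp: lookup_add lookup_single when_def fold)
  from this[of "sorted_list_of_set UNIV"] show ?thesis
    by (simp add: monom_act_def)
qed

lemma lookup_map_ratfun_diff:
  "Poly_Mapping.lookup (Poly_Mapping.map (ratfun_diff v) p) k = ratfun_diff v (Poly_Mapping.lookup p k)"
  by (simp add: map.rep_eq when_def)

lemma map_ratfun_diff_add: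
  "Poly_Mapping.map (ratfun_diff v) (p + q) = Poly_Mapping.map (ratfun_diff v) p + Poly_Mapping.map (ratfun_diff v) q"
  by (intro poly_mapping_eqI) (simp add: lookup_map_ratfun_diff lookup_add ratfun_diff_add)

lemma nf_diff_add: "nf_diff v (p + q) = nf_diff v p + nf_diff v q"
  by (simp add: nf_diff_def map_ratfun_diff_add algebra_simps)

lemma nf_diff_zero [simp]: "nf_diff v 0 = 0"
  using nf_diff_add[of v 0 0] by (metis add.right_neutral add_cancel_right_right)

lemma nf_diff_single:
  "nf_diff v (Poly_Mapping.single \<alpha> a)
     = Poly_Mapping.single \<alpha> (ratfun_diff v a) + Poly_Mapping.single (\<alpha> + Poly_Mapping.single v 1) a"
  by (simp add: nf_diff_def mult_single add.commute)

lemma nf_diff_commute: "nf_diff v (nf_diff w p) = nf_diff w (nf_diff v p)"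
  by (induction p rule: poly_mapping_add_induct)
    (simp_all add: nf_diff_single nf_diff_add ratfun_diff_commute[of v w] algebra_simps)

lemma nf_diff_smult:
  "nf_diff v (Poly_Mapping.single 0 a * p)
     = Poly_Mapping.single 0 (ratfun_diff v a) * p + Poly_Mapping.single 0 a * nf_diff v p"
  by (induction p rule: poly_mapping_add_induct)
    (simp_all add: mult_single nf_diff_single nf_diff_add ratfun_diff_mult single_add algebra_simps)

lemmas monom_act_nf_add = monom_act_add[of nf_diff, OF nf_diff_commute]

lemma monom_act_nf_plus: "monom_act nf_diff \<alpha> (p + q) = monom_act nf_diff \<alpha> p + monom_act nf_diff \<alpha> q"
  by (induction \<alpha> rule: exponent_induct) (simp_all add: monom_act_nf_add nf_diff_add del: One_nat_def)

lemma monom_act_nf_one: "monom_act nf_diff \<alpha> 1 = Poly_Mapping.single \<alpha> 1"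
  by (induction \<alpha> rule: exponent_induct) (simp_all add: monom_act_nf_add nf_diff_single del: One_nat_def)

lemma nf_times_single: "nf_times (Poly_Mapping.single \<alpha> a) q = Poly_Mapping.single 0 a * monom_act nf_diff \<alpha> q"
  by (cases "a = 0") (simp_all add: nf_times_def)

lemma nf_times_add_left: "nf_times (p + q) r = nf_times p r + nf_times q r"
  unfolding nf_times_def
  by (rule setsum_keys_plus_distrib) (auto simp: algebra_simps single_add)

lemma nf_times_add_right: "nf_times p (q + r) = nf_times p q + nf_times p r"
  by (simp add: nf_times_def monom_act_nf_plus algebra_simps sum.distrib)

lemma nf_times_zero: "nf_times 0 q = 0" "nf_times p 0 = 0"
  using nf_times_add_left[of 0 0 q] nf_times_add_right[of p 0 0]
  by (metis add.right_neutral add_cancel_right_right)+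

lemma nf_times_one: "nf_times 1 q = q" "nf_times p 1 = p"
proof -
  show "nf_times 1 q = q"
    using nf_times_single[of 0 1 q] by simp
  show "nf_times p 1 = p"
    by (induction p rule: poly_mapping_add_induct)
      (simp_all add: nf_times_single monom_act_nf_one mult_single nf_times_add_left)
qed

lemma nf_times_smult: "nf_times (Poly_Mapping.single 0 a * q) r = Poly_Mapping.single 0 a * nf_times q r"
proof (induction q rule: poly_mapping_add_induct)
  case (single k b)
  have "Poly_Mapping.single 0 (a * b) = Poly_Mapping.single 0 a * (Poly_Mapping.single 0 b :: ('a \<Rightarrow>\<^sub>0 nat) \<Rightarrow>\<^sub>0 'a ratfun)"
    by (simp add: mult_single)
  then show ?case by (simp add: mult_single nf_times_single mult.assoc)
next
  case (add p q)
  then show ?case by (simp add: nf_times_add_left algebra_simps)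
qed

lemma nf_times_nf_diff: "nf_times (nf_diff v q) r = nf_diff v (nf_times q r)"
  by (induction q rule: poly_mapping_add_induct)
    (simp_all add: nf_diff_single nf_diff_smult nf_diff_add nf_times_single nf_times_add_left
      monom_act_nf_add del: One_nat_def)

lemma nf_times_assoc: "nf_times (nf_times p q) r = nf_times p (nf_times q r)"
proof (induction p rule: poly_mapping_add_induct)
  case (single \<alpha> a)
  have "nf_times (monom_act nf_diff \<alpha> q) r = monom_act nf_diff \<alpha> (nf_times q r)"
    by (induction \<alpha> rule: exponent_induct)
      (simp_all add: monom_act_nf_add nf_times_nf_diff del: One_nat_def)
  then show ?case by (simp add: nf_times_single nf_times_smult)
next
  case (add p q)
  then show ?case by (simp add: nf_times_add_left)
qed

typedef (overloaded) 'v rweyl = "UNIV :: (('v::{finite,linorder} \<Rightarrow>\<^sub>0 nat) \<Rightarrow>\<^sub>0 'v ratfun) set"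
  morphisms normal_form Abs_rweyl ..

setup_lifting type_definition_rweyl

instantiation rweyl :: ("{finite,linorder}") ring_1
begin

lift_definition zero_rweyl :: "'a rweyl" is 0 .
lift_definition one_rweyl :: "'a rweyl" is 1 .
lift_definition plus_rweyl :: "'a rweyl \<Rightarrow> 'a rweyl \<Rightarrow> 'a rweyl" is "(+)" .
lift_definition minus_rweyl :: "'a rweyl \<Rightarrow> 'a rweyl \<Rightarrow> 'a rweyl" is "(-)" .
lift_definition uminus_rweyl :: "'a rweyl \<Rightarrow> 'a rweyl" is uminus .
lift_definition times_rweyl :: "'a rweyl \<Rightarrow> 'a rweyl \<Rightarrow> 'a rweyl" is nf_times .

instance
  by standard
    (transfer, simp add: nf_times_assoc nf_times_one nf_times_add_left nf_times_add_right algebra_simps)+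

end

definition rweyl_coeff :: "'v::{finite,linorder} ratfun \<Rightarrow> 'v rweyl" where
  "rweyl_coeff a = Abs_rweyl (Poly_Mapping.single 0 a)"

definition rweyl_diff :: "'v::{finite,linorder} \<Rightarrow> 'v rweyl" where
  "rweyl_diff v = Abs_rweyl (Poly_Mapping.single (Poly_Mapping.single v 1) 1)"

definition rweyl_var :: "'v::{finite,linorder} \<Rightarrow> 'v rweyl" where
  "rweyl_var v = rweyl_coeff (Fract (Poly_Mapping.single (Poly_Mapping.single v 1) 1) 1)"

lemmas normal_form_simps =
  normal_form_inject[symmetric] Abs_rweyl_inverse[OF UNIV_I] rweyl_coeff_def rweyl_diff_def
  zero_rweyl.rep_eq one_rweyl.rep_eq plus_rweyl.rep_eq minus_rweyl.rep_eq uminus_rweyl.rep_eq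
  times_rweyl.rep_eq

lemma rweyl_coeff_hom:
  "rweyl_coeff 0 = 0" "rweyl_coeff 1 = 1"
  "rweyl_coeff (a + b) = rweyl_coeff a + rweyl_coeff b"
  "rweyl_coeff (a * b) = rweyl_coeff a * rweyl_coeff b"
  by (simp_all add: normal_form_simps single_add nf_times_single mult_single)

lemma monom_act_nf_diff_single:
  "monom_act nf_diff (Poly_Mapping.single v 1) q = nf_diff v q"
  using monom_act_nf_add[of 0 v q] by simp

lemma rweyl_diff_coeff:
  "rweyl_diff v * rweyl_coeff a = rweyl_coeff a * rweyl_diff v + rweyl_coeff (ratfun_diff v a)"
  by (simp add: normal_form_simps nf_times_single monom_act_nf_diff_single nf_diff_single mult_single add.commute
      del: One_nat_def)

lemma rweyl_diff_commute: "rweyl_diff v * rweyl_diff w = rweyl_diff w * rweyl_diff v"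
  by (simp add: normal_form_simps nf_times_single monom_act_nf_diff_single nf_diff_single add.commute
      del: One_nat_def)

lemma rweyl_diff_var:
  "rweyl_diff v * rweyl_var w = rweyl_var w * rweyl_diff v + (if v = w then 1 else 0)"
proof -
  have "ratfun_diff v (Fract (Poly_Mapping.single (Poly_Mapping.single w 1) 1) 1) = (if v = w then 1 else 0)"
    by (auto simp: ratfun_diff_poly mpoly_diff_single lookup_single One_fract_def Zero_fract_def)
  then show ?thesis
    by (simp add: rweyl_var_def rweyl_diff_coeff rweyl_coeff_hom)
qed

definition weyl_algebra :: "'v::{finite,linorder} rweyl set" where
  "weyl_algebra = {p. \<forall>\<alpha>. \<exists>f. Poly_Mapping.lookup (normal_form p) \<alpha> = Fract f 1}"

definition left_ideal :: "'a::ring_1 set \<Rightarrow> 'a set \<Rightarrow> bool" where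
  "left_ideal S I \<longleftrightarrow> I \<subseteq> S \<and> 0 \<in> I \<and> (\<forall>a\<in>I. \<forall>b\<in>I. a + b \<in> I) \<and> (\<forall>s\<in>S. \<forall>a\<in>I. s * a \<in> I)"

text \<open>The left \<open>S\<close>-ideal generated by \<open>G \<subseteq> S\<close>; if \<open>G\<close> is not contained in \<open>S\<close>, then this is
  all of \<open>UNIV\<close>.\<close>

abbreviation left_ideal_gen :: "'a::ring_1 set \<Rightarrow> 'a set \<Rightarrow> 'a set" where
  "left_ideal_gen S G \<equiv> left_ideal S hull G"

definition field_record :: "'a::field ring" where
  "field_record = \<lparr>carrier = UNIV, monoid.mult = (*), one = 1, ring.zero = 0, add = (+)\<rparr>"

definition rweyl_module :: "('v::{finite,linorder} ratfun, 'v rweyl) module" where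
  "rweyl_module = \<lparr>carrier = UNIV, monoid.mult = (*), one = 1, ring.zero = 0, add = (+),
     smult = (\<lambda>c p. rweyl_coeff c * p)\<rparr>"

text \<open>The fields \<^term>\<open>mult\<close> and \<^term>\<open>one\<close> of a module record are irrelevant for its module
  structure.\<close>

definition quotient_module :: "('k, 'm) module \<Rightarrow> 'm set \<Rightarrow> ('k, 'm set) module" where
  "quotient_module M N = \<lparr>carrier = a_rcosets\<^bsub>M\<^esub> N, monoid.mult = undefined, one = undefined,
     ring.zero = N, add = set_add M, smult = (\<lambda>c X. \<Union>x\<in>X. N +>\<^bsub>M\<^esub> (c \<odot>\<^bsub>M\<^esub> x))\<rparr>"

lemma quotient_module_vectorspace:
  assumes "vectorspace K M" "Module.submodule N K M"
  shows "vectorspace K (quotient_module M N)"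
proof -
  interpret vectorspace K M by fact
  interpret N: Module.submodule N K M by fact
  interpret N: abelian_subgroup N M
    by (intro abelian_subgroupI3 additive_subgroup.intro N.subgroup_axioms M.abelian_group_axioms)
  let ?Q = "quotient_module M N"
  have car: "\<exists>x\<in>carrier M. X = N +>\<^bsub>M\<^esub> x" if "X \<in> carrier ?Q" for X
    using that by (auto simp: quotient_module_def A_RCOSETS_def')
  have coset: "N +>\<^bsub>M\<^esub> x \<in> carrier ?Q" if "x \<in> carrier M" for x
    using that by (auto simp: quotient_module_def A_RCOSETS_def')
  have add: "(N +>\<^bsub>M\<^esub> x) \<oplus>\<^bsub>?Q\<^esub> (N +>\<^bsub>M\<^esub> y) = N +>\<^bsub>M\<^esub> (x \<oplus>\<^bsub>M\<^esub> y)"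
    if "x \<in> carrier M" "y \<in> carrier M" for x y
    using N.a_rcos_sum[OF that] by (simp add: quotient_module_def)
  have zero: "\<zero>\<^bsub>?Q\<^esub> = N +>\<^bsub>M\<^esub> \<zero>\<^bsub>M\<^esub>"
    using M.a_coset_add_zero[OF N.a_subset] by (simp add: quotient_module_def)
  have ab: "abelian_group ?Q"
  proof (rule abelian_groupI)
    show "\<zero>\<^bsub>?Q\<^esub> \<in> carrier ?Q" by (simp add: zero coset)
    fix X assume "X \<in> carrier ?Q"
    then obtain x where x: "x \<in> carrier M" "X = N +>\<^bsub>M\<^esub> x" using car by blast
    show "\<zero>\<^bsub>?Q\<^esub> \<oplus>\<^bsub>?Q\<^esub> X = X" using x by (simp add: zero add)
    show "\<exists>Y\<in>carrier ?Q. Y \<oplus>\<^bsub>?Q\<^esub> X = \<zero>\<^bsub>?Q\<^esub>"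
      using x by (intro bexI[of _ "N +>\<^bsub>M\<^esub> (\<ominus>\<^bsub>M\<^esub> x)"]) (simp_all add: zero add coset M.l_neg)
    fix Y assume "Y \<in> carrier ?Q"
    then obtain y where y: "y \<in> carrier M" "Y = N +>\<^bsub>M\<^esub> y" using car by blast
    show "X \<oplus>\<^bsub>?Q\<^esub> Y \<in> carrier ?Q" using x y by (simp add: add coset)
    show "X \<oplus>\<^bsub>?Q\<^esub> Y = Y \<oplus>\<^bsub>?Q\<^esub> X" using x y by (simp add: add M.a_comm)
    fix Z assume "Z \<in> carrier ?Q"
    then obtain z where z: "z \<in> carrier M" "Z = N +>\<^bsub>M\<^esub> z" using car by blast
    show "(X \<oplus>\<^bsub>?Q\<^esub> Y) \<oplus>\<^bsub>?Q\<^esub> Z = X \<oplus>\<^bsub>?Q\<^esub> (Y \<oplus>\<^bsub>?Q\<^esub> Z)"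
      using x y z by (simp add: add M.a_assoc)
  qed
  have smult: "c \<odot>\<^bsub>?Q\<^esub> (N +>\<^bsub>M\<^esub> x) = N +>\<^bsub>M\<^esub> (c \<odot>\<^bsub>M\<^esub> x)"
    if c: "c \<in> carrier K" and x: "x \<in> carrier M" for c x
  proof -
    have eq: "N +>\<^bsub>M\<^esub> (c \<odot>\<^bsub>M\<^esub> y) = N +>\<^bsub>M\<^esub> (c \<odot>\<^bsub>M\<^esub> x)" if y: "y \<in> N +>\<^bsub>M\<^esub> x" for y
    proof -
      obtain n where n: "n \<in> N" "y = n \<oplus>\<^bsub>M\<^esub> x"
        using y by (auto simp: a_r_coset_def')
      have nM: "n \<in> carrier M" using n(1) N.subset by auto
      have "c \<odot>\<^bsub>M\<^esub> y = (c \<odot>\<^bsub>M\<^esub> n) \<oplus>\<^bsub>M\<^esub> (c \<odot>\<^bsub>M\<^esub> x)"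
        unfolding n(2) by (rule smult_r_distr[OF c nM x])
      also have "\<dots> \<in> N +>\<^bsub>M\<^esub> (c \<odot>\<^bsub>M\<^esub> x)"
        by (rule M.a_rcosI[OF N.smult_closed[OF c n(1)] N.a_subset smult_closed[OF c x]])
      finally show ?thesis
        by (rule N.a_repr_independence'[OF _ smult_closed[OF c x], symmetric])
    qed
    have "c \<odot>\<^bsub>?Q\<^esub> (N +>\<^bsub>M\<^esub> x) = (\<Union>y\<in>N +>\<^bsub>M\<^esub> x. N +>\<^bsub>M\<^esub> (c \<odot>\<^bsub>M\<^esub> y))"
      by (simp add: quotient_module_def)
    also have "\<dots> = (\<Union>y\<in>N +>\<^bsub>M\<^esub> x. N +>\<^bsub>M\<^esub> (c \<odot>\<^bsub>M\<^esub> x))"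
      by (rule SUP_cong[OF refl eq])
    also have "\<dots> = N +>\<^bsub>M\<^esub> (c \<odot>\<^bsub>M\<^esub> x)"
      using N.a_rcos_self[OF x] by blast
    finally show ?thesis .
  qed
  have "module K ?Q"
  proof (rule moduleI)
    show "cring K" by (rule R.is_cring)
    show "abelian_group ?Q" by (rule ab)
    fix a X assume aX: "a \<in> carrier K" "X \<in> carrier ?Q"
    obtain x where x: "x \<in> carrier M" "X = N +>\<^bsub>M\<^esub> x" using car[OF aX(2)] by auto
    show "a \<odot>\<^bsub>?Q\<^esub> X \<in> carrier ?Q" using aX x smult coset by simp
    {
      fix b assume b: "b \<in> carrier K"
      show "(a \<oplus>\<^bsub>K\<^esub> b) \<odot>\<^bsub>?Q\<^esub> X = (a \<odot>\<^bsub>?Q\<^esub> X) \<oplus>\<^bsub>?Q\<^esub> (b \<odot>\<^bsub>?Q\<^esub> X)"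
        using aX x b by (simp add: smult add smult_l_distr)
      show "(a \<otimes>\<^bsub>K\<^esub> b) \<odot>\<^bsub>?Q\<^esub> X = a \<odot>\<^bsub>?Q\<^esub> (b \<odot>\<^bsub>?Q\<^esub> X)"
        using aX x b by (simp add: smult smult_assoc1)
    }
    fix Y assume Y: "Y \<in> carrier ?Q"
    obtain y where y: "y \<in> carrier M" "Y = N +>\<^bsub>M\<^esub> y" using car[OF Y] by auto
    show "a \<odot>\<^bsub>?Q\<^esub> (X \<oplus>\<^bsub>?Q\<^esub> Y) = (a \<odot>\<^bsub>?Q\<^esub> X) \<oplus>\<^bsub>?Q\<^esub> (a \<odot>\<^bsub>?Q\<^esub> Y)"
      using aX x y by (simp add: smult add smult_r_distr)
  next
    fix X assume X: "X \<in> carrier ?Q"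
    obtain x where x: "x \<in> carrier M" "X = N +>\<^bsub>M\<^esub> x" using car[OF X] by auto
    show "\<one>\<^bsub>K\<^esub> \<odot>\<^bsub>?Q\<^esub> X = X" using x by (simp add: smult)
  qed
  then show ?thesis by (intro vectorspace.intro field_axioms)
qed

lemma field_field_record: "Ring.field (field_record :: 'a::field ring)"
proof -
  let ?K = "field_record :: 'a ring"
  have neg: "\<exists>y\<in>carrier ?K. y \<oplus>\<^bsub>?K\<^esub> x = \<zero>\<^bsub>?K\<^esub>" for x
    by (rule bexI[of _ "- x"]) (simp_all add: field_record_def)
  have "cring ?K"
    by (intro cringI abelian_groupI comm_monoidI neg) (simp_all add: field_record_def algebra_simps)
  moreover have "Units ?K = carrier ?K - {\<zero>\<^bsub>?K\<^esub>}"
  proof -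
    have "x \<in> Units ?K \<longleftrightarrow> x \<noteq> 0" for x
    proof
      assume "x \<in> Units ?K"
      then show "x \<noteq> 0" by (auto simp: Units_def field_record_def)
    next
      assume "x \<noteq> 0"
      then have "x * inverse x = 1" "inverse x * x = 1" by simp_all
      then show "x \<in> Units ?K" unfolding Units_def field_record_def by auto
    qed
    then show ?thesis by (auto simp: field_record_def)
  qed
  ultimately show ?thesis by (rule cring.cring_fieldI)
qed

lemma rweyl_vectorspace: "vectorspace field_record rweyl_module"
proof -
  interpret K: Ring.field "field_record :: 'a ratfun ring" by (rule field_field_record)
  have neg: "\<exists>y\<in>carrier rweyl_module. y \<oplus>\<^bsub>rweyl_module\<^esub> x = \<zero>\<^bsub>rweyl_module\<^esub>" for x :: "'a rweyl"
    by (rule bexI[of _ "- x"]) (simp_all add: rweyl_module_def)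
  have "module (field_record :: 'a ratfun ring) rweyl_module"
    by (intro moduleI K.is_cring abelian_groupI neg)
      (simp_all add: rweyl_module_def field_record_def rweyl_coeff_hom algebra_simps)
  then show ?thesis by (intro vectorspace.intro K.field_axioms)
qed

lemma left_ideal_submodule:
  assumes "left_ideal UNIV I"
  shows "Module.submodule I field_record rweyl_module"
proof -
  interpret vectorspace field_record rweyl_module by (rule rweyl_vectorspace)
  have neg: "- a \<in> I" if "a \<in> I" for a
    using assms that unfolding left_ideal_def by (metis UNIV_I mult_minus1)
  show ?thesis
  proof (rule submoduleI)
    fix a assume a: "a \<in> I"
    have "\<ominus>\<^bsub>rweyl_module\<^esub> a = - a"
      by (rule minus_equality) (simp_all add: rweyl_module_def)
    then show "\<ominus>\<^bsub>rweyl_module\<^esub> a \<in> I" using neg[OF a] by simp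
  qed (use assms in \<open>auto simp: left_ideal_def rweyl_module_def\<close>)
qed

lemma left_ideal_Inter:
  assumes "\<I> \<noteq> {}" "\<And>I. I \<in> \<I> \<Longrightarrow> left_ideal S I"
  shows "left_ideal S (\<Inter>\<I>)"
  unfolding left_ideal_def
proof (intro conjI ballI InterI)
  show "\<Inter>\<I> \<subseteq> S"
    using assms unfolding left_ideal_def by (metis Inter_lower ex_in_conv subset_trans)
next
  fix I assume "I \<in> \<I>"
  then show "0 \<in> I" using assms(2) unfolding left_ideal_def by simp
next
  fix a b I assume "a \<in> \<Inter>\<I>" "b \<in> \<Inter>\<I>" "I \<in> \<I>"
  then have "a \<in> I" "b \<in> I" "left_ideal S I" using assms(2) by simp_all
  then show "a + b \<in> I" unfolding left_ideal_def by simp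
next
  fix s a I assume "s \<in> S" "a \<in> \<Inter>\<I>" "I \<in> \<I>"
  then have "s \<in> S" "a \<in> I" "left_ideal S I" using assms(2) by simp_all
  then show "s * a \<in> I" unfolding left_ideal_def by simp
qed

lemma left_ideal_gen_left_ideal:
  assumes "left_ideal S S" "G \<subseteq> S"
  shows "left_ideal S (left_ideal_gen S G)"
  unfolding hull_def by (rule left_ideal_Inter) (use assms in auto)

lemma left_ideal_UNIV: "left_ideal UNIV UNIV"
  by (simp add: left_ideal_def)

definition holonomic_quotient ::
  "'v::{finite,linorder} rweyl set \<Rightarrow> ('v ratfun, 'v rweyl set) module" where
  "holonomic_quotient L = quotient_module rweyl_module (left_ideal_gen UNIV L)"

definition holonomic_rank :: "'v::{finite,linorder} rweyl set \<Rightarrow> enat" where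
  "holonomic_rank L =
     (if vectorspace.fin_dim field_record (holonomic_quotient L)
      then enat (vectorspace.dim field_record (holonomic_quotient L)) else \<infinity>)"

lemma holonomic_quotient_vectorspace: "vectorspace field_record (holonomic_quotient L)"
  unfolding holonomic_quotient_def
  by (intro quotient_module_vectorspace rweyl_vectorspace left_ideal_submodule
      left_ideal_gen_left_ideal left_ideal_UNIV subset_UNIV)

definition poly_coeffs :: "(('v::{finite,linorder} \<Rightarrow>\<^sub>0 nat) \<Rightarrow>\<^sub>0 'v ratfun) set" where
  "poly_coeffs = {p. \<forall>\<alpha>. Poly_Mapping.lookup p \<alpha> \<in> range (\<lambda>f. Fract f 1)}"

lemma weyl_algebra_iff: "p \<in> weyl_algebra \<longleftrightarrow> normal_form p \<in> poly_coeffs"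
  by (auto simp: weyl_algebra_def poly_coeffs_def)

lemma poly_coeffs_zero: "0 \<in> poly_coeffs"
  by (auto simp: poly_coeffs_def Zero_fract_def)

lemma poly_coeffs_single: "Poly_Mapping.single \<alpha> (Fract f 1) \<in> poly_coeffs"
  by (auto simp: poly_coeffs_def lookup_single when_def Zero_fract_def)

lemma poly_coeffs_add:
  assumes "p \<in> poly_coeffs" "q \<in> poly_coeffs"
  shows "p + q \<in> poly_coeffs"
proof -
  have "a + b \<in> range (\<lambda>f. Fract f 1)"
    if "a \<in> range (\<lambda>f. Fract f 1)" "b \<in> range (\<lambda>f. Fract f 1)" for a b :: "'a ratfun"
    using that by auto
  then show ?thesis using assms by (simp add: poly_coeffs_def lookup_add)
qed

lemma poly_coeffs_uminus:
  assumes "p \<in> poly_coeffs"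
  shows "- p \<in> poly_coeffs"
proof -
  have "- a \<in> range (\<lambda>f. Fract f 1)" if "a \<in> range (\<lambda>f. Fract f 1)" for a :: "'a ratfun"
    using that by auto
  then show ?thesis using assms by (simp add: poly_coeffs_def)
qed

lemma poly_coeffs_sum: "(\<And>i. i \<in> I \<Longrightarrow> h i \<in> poly_coeffs) \<Longrightarrow> sum h I \<in> poly_coeffs"
  by (induction I rule: infinite_finite_induct) (auto simp: poly_coeffs_zero poly_coeffs_add)

lemma poly_coeffs_induct [consumes 1, case_names zero add]:
  assumes "p \<in> poly_coeffs" "P 0"
    and add: "\<And>p \<alpha> f. P p \<Longrightarrow> P (p + Poly_Mapping.single \<alpha> (Fract f 1))"
  shows "P p"
proof -
  have *: "P (\<Sum>\<alpha>\<in>A. Poly_Mapping.single \<alpha> (Poly_Mapping.lookup p \<alpha>))" if "finite A" for A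
    using that
  proof (induction A rule: finite_induct)
    case (insert \<alpha> A)
    obtain f where "Poly_Mapping.lookup p \<alpha> = Fract f 1"
      using assms(1) by (auto simp: poly_coeffs_def)
    then show ?case using add[OF insert.IH, of \<alpha> f] insert by (simp add: add.commute)
  qed (simp add: assms(2))
  have "p = (\<Sum>\<alpha>\<in>Poly_Mapping.keys p. Poly_Mapping.single \<alpha> (Poly_Mapping.lookup p \<alpha>))"
    by (intro poly_mapping_eqI)
      (simp add: lookup_sum lookup_single when_def in_keys_iff sum.delta)
  then show ?thesis using *[of "Poly_Mapping.keys p"] by simp
qed

lemma poly_coeffs_smult:
  assumes "p \<in> poly_coeffs"
  shows "Poly_Mapping.single 0 (Fract f 1) * p \<in> poly_coeffs"
  using assms
  by (induction p rule: poly_coeffs_induct)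
    (simp_all add: poly_coeffs_zero poly_coeffs_add poly_coeffs_single distrib_left mult_single)

lemma poly_coeffs_nf_diff:
  assumes "p \<in> poly_coeffs"
  shows "nf_diff v p \<in> poly_coeffs"
  using assms
  by (induction p rule: poly_coeffs_induct)
    (simp_all add: poly_coeffs_zero poly_coeffs_add poly_coeffs_single nf_diff_add nf_diff_single
      ratfun_diff_poly)

lemma poly_coeffs_monom_act:
  assumes "p \<in> poly_coeffs"
  shows "monom_act nf_diff \<alpha> p \<in> poly_coeffs"
  using assms
  by (induction \<alpha> rule: exponent_induct) (simp_all add: monom_act_nf_add poly_coeffs_nf_diff del: One_nat_def)

lemma poly_coeffs_nf_times:
  assumes "p \<in> poly_coeffs" "q \<in> poly_coeffs"
  shows "nf_times p q \<in> poly_coeffs"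
  using assms
  by (induction p rule: poly_coeffs_induct)
    (simp_all add: nf_times_zero nf_times_add_left nf_times_single poly_coeffs_zero poly_coeffs_add
      poly_coeffs_smult poly_coeffs_monom_act)

lemma weyl_algebra_zero: "0 \<in> weyl_algebra"
  by (simp add: weyl_algebra_iff zero_rweyl.rep_eq poly_coeffs_zero)

lemma weyl_algebra_one: "1 \<in> weyl_algebra"
  using poly_coeffs_single[of 0 1]
  by (simp add: weyl_algebra_iff one_rweyl.rep_eq flip: One_fract_def)

lemma weyl_algebra_add: "p \<in> weyl_algebra \<Longrightarrow> q \<in> weyl_algebra \<Longrightarrow> p + q \<in> weyl_algebra"
  by (simp add: weyl_algebra_iff plus_rweyl.rep_eq poly_coeffs_add)

lemma weyl_algebra_uminus: "p \<in> weyl_algebra \<Longrightarrow> - p \<in> weyl_algebra"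
  by (simp add: weyl_algebra_iff uminus_rweyl.rep_eq poly_coeffs_uminus)

lemma weyl_algebra_diff: "p \<in> weyl_algebra \<Longrightarrow> q \<in> weyl_algebra \<Longrightarrow> p - q \<in> weyl_algebra"
  using weyl_algebra_add[of p "- q"] weyl_algebra_uminus[of q] by simp

lemma weyl_algebra_mult: "p \<in> weyl_algebra \<Longrightarrow> q \<in> weyl_algebra \<Longrightarrow> p * q \<in> weyl_algebra"
  by (simp add: weyl_algebra_iff times_rweyl.rep_eq poly_coeffs_nf_times)

lemma weyl_algebra_sum: "(\<And>i. i \<in> I \<Longrightarrow> h i \<in> weyl_algebra) \<Longrightarrow> sum h I \<in> weyl_algebra"
  by (induction I rule: infinite_finite_induct) (auto simp: weyl_algebra_zero weyl_algebra_add)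

lemma weyl_algebra_rweyl_diff: "rweyl_diff v \<in> weyl_algebra"
  using poly_coeffs_single[of "Poly_Mapping.single v 1" 1]
  by (simp add: weyl_algebra_iff rweyl_diff_def Abs_rweyl_inverse flip: One_fract_def)

lemma weyl_algebra_rweyl_var: "rweyl_var v \<in> weyl_algebra"
  by (simp add: weyl_algebra_iff rweyl_var_def rweyl_coeff_def Abs_rweyl_inverse poly_coeffs_single)

lemma weyl_algebra_of_int: "of_int k \<in> weyl_algebra"
proof -
  have "of_nat n \<in> weyl_algebra" for n
    by (induction n) (simp_all add: weyl_algebra_zero weyl_algebra_one weyl_algebra_add)
  note nat = this
  show ?thesis
  proof (cases k rule: int_cases2)
    case (nonneg n)
    then show ?thesis using nat[of n] by simp
  next
    case (nonpos n)
    then show ?thesis using weyl_algebra_uminus[OF nat[of n]] by simp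
  qed
qed

lemma left_ideal_weyl_algebra: "left_ideal weyl_algebra weyl_algebra"
  by (simp add: left_ideal_def weyl_algebra_zero weyl_algebra_add weyl_algebra_mult)

text \<open>The nine variables are the elements of the type \<^typ>\<open>9\<close> of integers modulo 9, and the entry
  \<open>(i, j)\<close> with \<open>1 \<le> i, j \<le> 3\<close> is the variable with number \<open>3 (i - 1) + j \<in> {1..9}\<close>,
  where \<open>9 = 0\<close>.\<close>

definition entry :: "nat \<Rightarrow> nat \<Rightarrow> 9" where
  "entry i j = of_nat (3 * (i - 1) + j)"

lemma bij_betw_entry: "bij_betw (\<lambda>(i, j). entry i j) ({1..3} \<times> {1..3}) UNIV"
proof -
  have img: "(\<lambda>(i, j). entry i j) ` ({1..3} \<times> {1..3}) = UNIV"
  proof (intro equalityI subset_UNIV subsetI)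
    fix x :: 9
    obtain z where z: "x = of_int z" "0 \<le> z" "z < 9"
      by (cases x rule: bit1_cases) auto
    define m where "m = nat ((z - 1) mod 9)"
    have m: "m < 9" "x = of_nat (m + 1)"
    proof -
      show "m < 9" by (simp add: m_def nat_less_iff)
      show "x = of_nat (m + 1)"
      proof (cases "z = 0")
        case True
        then have "m = 8" by (simp add: m_def)
        then show ?thesis using True z by simp
      next
        case False
        then have "int (m + 1) = z" using z by (simp add: m_def mod_pos_pos_trivial)
        then show ?thesis using z by (metis of_int_of_nat_eq)
      qed
    qed
    have "3 * (m div 3 + 1 - 1) + (m mod 3 + 1) = m + 1"
      by (simp add: mult_div_mod_eq)
    then have "x = entry (m div 3 + 1) (m mod 3 + 1)"
      unfolding entry_def m(2) by (rule arg_cong[OF sym])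
    moreover have "m div 3 < 3" "m mod 3 < 3"
      using m(1) by (auto intro: less_mult_imp_div_less)
    then have "m div 3 + 1 \<in> {1..3}" "m mod 3 + 1 \<in> {1..3}"
      by simp_all
    ultimately show "x \<in> (\<lambda>(i, j). entry i j) ` ({1..3} \<times> {1..3})"
      by blast
  qed
  then have "inj_on (\<lambda>(i, j). entry i j) ({1..3} \<times> {1..3})"
    by (intro eq_card_imp_inj_on) simp_all
  with img show ?thesis by (simp add: bij_betw_def)
qed

definition t_op :: "nat \<Rightarrow> nat \<Rightarrow> 9 rweyl" where
  "t_op i j = rweyl_var (entry i j)"

definition d_op :: "nat \<Rightarrow> nat \<Rightarrow> 9 rweyl" where
  "d_op i j = rweyl_diff (entry i j)"

text \<open>The Leibniz formula; the library's determinant requires a commutative ring. The formula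
  is applied only to a matrix with commuting entries.\<close>

definition det3 :: "(nat \<Rightarrow> nat \<Rightarrow> 'a::ring_1) \<Rightarrow> 'a" where
  "det3 A = (\<Sum>p | p permutes {1..3}. of_int (sign p) * (A 1 (p 1) * A 2 (p 2) * A 3 (p 3)))"

definition gen_d :: "9 rweyl" where
  "gen_d = 1 - det3 d_op"

definition gen_g :: "nat \<Rightarrow> nat \<Rightarrow> 9 rweyl" where
  "gen_g i j = (if i = j then 1 else 0) - (\<Sum>k=1..3. d_op i k * d_op j k)"

definition gen_P :: "nat \<Rightarrow> nat \<Rightarrow> 9 rweyl" where
  "gen_P i j = (\<Sum>k=1..3. t_op i k * d_op j k - t_op j k * d_op i k)"

lemma generators_in_weyl_algebra:
  "gen_d \<in> weyl_algebra" "gen_g i j \<in> weyl_algebra" "gen_P i j \<in> weyl_algebra"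
  unfolding gen_d_def gen_g_def gen_P_def det3_def t_op_def d_op_def
  by (auto intro!: weyl_algebra_diff weyl_algebra_uminus weyl_algebra_sum weyl_algebra_mult
      weyl_algebra_rweyl_diff weyl_algebra_rweyl_var weyl_algebra_of_int weyl_algebra_one
      weyl_algebra_zero)

end

theory Submission
  imports Defs "HOL-Analysis.Determinants" "HOL-Computational_Algebra.Polynomial"
begin

text \<open>Up to a constant, the normalising constant of the Fisher distribution on \<open>SO(3)\<close>, which \<open>J\<close>
  annihilates, is a contour integral of \<open>exp s / sqrt (\<chi> s)\<close>. Here \<open>\<chi>\<close> is the characteristic polynomial
  of the symmetric \<open>4 \<times> 4\<close> matrix that expresses the linear form \<open>tr (T\<^sup>T Y)\<close> in unit quaternions. If \<open>\<lambda>\<^sub>1, \<lambda>\<^sub>2, \<lambda>\<^sub>3\<close>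
  are the singular values of \<open>T\<close>, up to signs, then the roots of \<open>\<chi>\<close> are
  \<open>\<lambda>\<^sub>1 + \<lambda>\<^sub>2 + \<lambda>\<^sub>3\<close>, \<open>\<lambda>\<^sub>1 - \<lambda>\<^sub>2 - \<lambda>\<^sub>3\<close>, \<open>\<lambda>\<^sub>2 - \<lambda>\<^sub>1 - \<lambda>\<^sub>3\<close>, \<open>\<lambda>\<^sub>3 - \<lambda>\<^sub>1 - \<lambda>\<^sub>2\<close>.

  Lower bound: the algebra \<open>R\<close> acts on \<open>K(s)\<close> through derivations that are twisted by \<open>1 / sqrt \<chi>\<close>. The ideal
  sends 1 into the image of \<open>\<nabla>\<^sub>s = \<partial>/\<partial>s + 1 - \<chi>' / (2 \<chi>)\<close> on \<open>K[s, 1/\<chi>]\<close>. Comparing pole orders along \<open>\<chi>\<close>,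
  which is squarefree, shows that \<open>1, 1/\<chi>, s/\<chi>, s\<^sup>2/\<chi>\<close> are linearly independent modulo this image.

  Upper bound: modulo the ideal, the operators are invariant under left and right rotations. With \<open>S = T T\<^sup>T\<close>, this
  forces the matrix of the \<open>\<partial>\<^sub>i\<^sub>j\<close> to be a combination of \<open>T, S T, S\<^sup>2 T\<close>, so that three first order operators
  suffice. The symbols of the second order operators then form a symmetric \<open>3 \<times> 3\<close> matrix; orthogonality
  and the equality of \<open>(\<partial>\<^sub>i\<^sub>j)\<close> with its cofactor matrix give six linear equations for it, which are regular because the
  discriminant of \<open>S\<close> does not vanish.\<close>

declare One_nat_def [simp del]

section \<open>Holonomic rank from a basis modulo the ideal\<close>

lemma of_nat_Fract: "of_nat n = Fract (of_nat n) 1"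
  by (induction n) (simp_all add: Zero_fract_def One_fract_def)

text \<open>Characteristic zero is what lets both K = \<open>9 ratfun\<close> and K(s) =
  \<open>9 ratfun poly fract\<close> instantiate the locales over \<open>field_char_0\<close>
  below.\<close>

instance fract :: ("{idom, ring_char_0}") ring_char_0
  by standard (auto simp: inj_on_def of_nat_Fract eq_fract)

instance fract :: ("{idom, ring_char_0}") field_char_0 ..

lemma rweyl_coeff_uminus: "rweyl_coeff (- a) = - rweyl_coeff a"
  using rweyl_coeff_hom(3)[of a "- a"] by (simp add: rweyl_coeff_hom eq_neg_iff_add_eq_0 add.commute)

lemma left_idealD:
  assumes "left_ideal S I"
  shows "0 \<in> I" "a \<in> I \<Longrightarrow> b \<in> I \<Longrightarrow> a + b \<in> I" "s \<in> S \<Longrightarrow> a \<in> I \<Longrightarrow> s * a \<in> I"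
  using assms by (auto simp: left_ideal_def)

lemma left_ideal_uminus: "left_ideal UNIV I \<Longrightarrow> a \<in> I \<Longrightarrow> - a \<in> I"
  using left_idealD(3)[of UNIV I "- 1" a] by simp

lemma left_ideal_diff: "left_ideal UNIV I \<Longrightarrow> a \<in> I \<Longrightarrow> b \<in> I \<Longrightarrow> a - b \<in> I"
  using left_idealD(2)[of UNIV I a "- b"] left_ideal_uminus[of I b] by simp

lemma left_ideal_sum:
  assumes "left_ideal UNIV I" "\<And>i. i \<in> A \<Longrightarrow> f i \<in> I"
  shows "sum f A \<in> I"
  using assms(2)
  by (induction A rule: infinite_finite_induct) (auto intro: left_idealD[OF assms(1)])

text \<open>The rank concerns R L for an ideal L of the Weyl algebra. Since
  \<open>I \<inter> weyl_algebra\<close> is an ideal of the Weyl algebra containing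
  \<open>G\<close>, an ideal \<open>I\<close> of R contains R L as soon as it contains the
  generators.\<close>

lemma left_ideal_gen_weyl_subset:
  fixes I :: "'v::{finite,linorder} rweyl set"
  assumes I: "left_ideal UNIV I" and "G \<subseteq> I" "G \<subseteq> weyl_algebra"
  shows "left_ideal_gen UNIV (left_ideal_gen weyl_algebra G) \<subseteq> I"
proof (rule hull_minimal)
  have "left_ideal_gen weyl_algebra G \<subseteq> I \<inter> weyl_algebra"
  proof (rule hull_minimal)
    show "left_ideal weyl_algebra (I \<inter> weyl_algebra)"
      using I left_ideal_weyl_algebra by (auto simp: left_ideal_def)
  qed (use assms in auto)
  then show "left_ideal_gen weyl_algebra G \<subseteq> I" by blast
qed (fact I)

lemma rweyl_module_simps [simp]:
  "carrier rweyl_module = UNIV" "x \<oplus>\<^bsub>rweyl_module\<^esub> y = x + y" "\<zero>\<^bsub>rweyl_module\<^esub> = 0"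
  "c \<odot>\<^bsub>rweyl_module\<^esub> x = rweyl_coeff c * x"
  by (simp_all add: rweyl_module_def)

lemma field_record_simps [simp]:
  "carrier field_record = UNIV" "\<zero>\<^bsub>field_record\<^esub> = 0" "\<one>\<^bsub>field_record\<^esub> = 1"
  by (simp_all add: field_record_def)

text \<open>Moves the dimension count from cosets to operators: spanning and independence are tested
  modulo the ideal, for a family indexed by numbers.\<close>

lemma holonomic_rank_eqI:
  fixes L :: "'v::{finite,linorder} rweyl set" and b :: "nat \<Rightarrow> 'v rweyl"
  defines "I \<equiv> left_ideal_gen UNIV L"
  assumes gen: "\<And>x. \<exists>c. x - (\<Sum>i<n. rweyl_coeff (c i) * b i) \<in> I"
    and indep: "\<And>c. (\<Sum>i<n. rweyl_coeff (c i) * b i) \<in> I \<Longrightarrow> \<forall>i<n. c i = 0"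
  shows "holonomic_rank L = enat n"
proof -
  let ?Q = "holonomic_quotient L"
  let ?M = "rweyl_module :: ('v ratfun, 'v rweyl) module"
  have I: "left_ideal UNIV I"
    unfolding I_def by (rule left_ideal_gen_left_ideal) (auto intro: left_ideal_UNIV)
  interpret M: vectorspace field_record ?M by (rule rweyl_vectorspace)
  interpret N: Module.submodule I field_record ?M by (rule left_ideal_submodule[OF I])
  interpret N: abelian_subgroup I ?M
    by (intro abelian_subgroupI3 additive_subgroup.intro N.subgroup_axioms M.M.abelian_group_axioms)
  interpret Q: vectorspace field_record ?Q by (rule holonomic_quotient_vectorspace)
  define q where "q x = I +>\<^bsub>?M\<^esub> x" for x
  have mem_q: "y \<in> q x \<longleftrightarrow> y - x \<in> I" for x y
    unfolding q_def a_r_coset_def' by (auto simp: algebra_simps) (metis diff_add_cancel add.commute)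
  have q_eq: "q x = q y \<longleftrightarrow> x - y \<in> I" for x y
  proof
    assume "q x = q y"
    then have "x \<in> q y" using mem_q[of x x] left_idealD(1)[OF I] by simp
    then show "x - y \<in> I" by (simp add: mem_q)
  next
    assume xy: "x - y \<in> I"
    have "z - x \<in> I \<longleftrightarrow> z - y \<in> I" for z
      using left_idealD(2)[OF I, of "z - x" "x - y"] left_ideal_diff[OF I, of "z - y" "x - y"] xy
      by auto
    then show "q x = q y" using mem_q by blast
  qed
  have carrier: "carrier ?Q = range q"
    by (auto simp: holonomic_quotient_def quotient_module_def A_RCOSETS_def' q_def I_def)
  have q_add: "q x \<oplus>\<^bsub>?Q\<^esub> q y = q (x + y)" for x y
    using N.a_rcos_sum[of x y] by (simp add: holonomic_quotient_def quotient_module_def q_def I_def)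
  have q_zero: "\<zero>\<^bsub>?Q\<^esub> = q 0"
    using M.M.a_coset_add_zero[OF N.a_subset]
    by (simp add: holonomic_quotient_def quotient_module_def q_def I_def)
  have q_smult: "c \<odot>\<^bsub>?Q\<^esub> q x = q (rweyl_coeff c * x)" for c x
  proof -
    have "c \<odot>\<^bsub>?Q\<^esub> q x = (\<Union>y\<in>q x. q (rweyl_coeff c * y))"
      by (simp add: holonomic_quotient_def quotient_module_def q_def I_def)
    also have "\<dots> = (\<Union>y\<in>q x. q (rweyl_coeff c * x))"
    proof (rule SUP_cong[OF refl])
      fix y assume "y \<in> q x"
      then have "rweyl_coeff c * (y - x) \<in> I"
        using left_idealD(3)[OF I] by (simp add: mem_q)
      then show "q (rweyl_coeff c * y) = q (rweyl_coeff c * x)"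
        by (simp add: q_eq algebra_simps)
    qed
    also have "\<dots> = q (rweyl_coeff c * x)"
      using mem_q[of x x] left_idealD(1)[OF I] by auto
    finally show ?thesis .
  qed
  have q_sum: "(\<Oplus>\<^bsub>?Q\<^esub>i\<in>A. q (f i)) = q (\<Sum>i\<in>A. f i)" if "finite A" for A and f :: "nat \<Rightarrow> 'v rweyl"
    using that by (induction A) (auto simp: q_zero q_add carrier)
  have inj: "inj_on (\<lambda>i. q (b i)) {..<n}"
  proof (rule inj_onI)
    fix i j assume ij: "i \<in> {..<n}" "j \<in> {..<n}" "q (b i) = q (b j)"
    show "i = j"
    proof (rule ccontr)
      assume ne: "i \<noteq> j"
      let ?c = "\<lambda>k. (if k = i then 1 else 0) - (if k = j then 1 else 0) :: 'v ratfun"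
      have "(\<Sum>k<n. rweyl_coeff (?c k) * b k)
          = (\<Sum>k<n. (if k = i then b k else 0) - (if k = j then b k else 0))"
        by (rule sum.cong) (auto simp: rweyl_coeff_hom rweyl_coeff_uminus)
      also have "\<dots> = b i - b j" using ij by (simp add: sum_subtractf sum.delta')
      also have "\<dots> \<in> I" using ij q_eq by simp
      finally have "\<forall>k<n. ?c k = 0" by (rule indep)
      then show False using ne ij(1) by auto
    qed
  qed
  let ?B = "(\<lambda>i. q (b i)) ` {..<n}"
  have B: "?B \<subseteq> carrier ?Q" "finite ?B" by (auto simp: carrier)
  have lincomb: "Q.lincomb a ?B = q (\<Sum>i<n. rweyl_coeff (a (q (b i))) * b i)" for a
    unfolding Q.lincomb_def
    by (subst Q.M.finsum_reindex[OF _ inj]) (auto simp: q_smult q_sum carrier)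
  have "Q.lin_indpt ?B"
  proof (rule Q.finite_lin_indpt2[OF B(2,1)])
    fix a assume "Q.lincomb a ?B = \<zero>\<^bsub>?Q\<^esub>"
    then have "(\<Sum>i<n. rweyl_coeff (a (q (b i))) * b i) \<in> I"
      unfolding lincomb q_zero q_eq by simp
    then show "\<forall>v\<in>?B. a v = \<zero>\<^bsub>field_record\<^esub>" using indep by force
  qed
  moreover have "Q.gen_set ?B"
  proof -
    have "q x \<in> Q.span ?B" for x
    proof -
      obtain c where c: "x - (\<Sum>i<n. rweyl_coeff (c i) * b i) \<in> I" using gen by blast
      \<comment> \<open>\<open>Q.lincomb\<close> takes coefficients indexed by cosets;
        \<open>inj\<close> lets the index be recovered from the coset.\<close>
      define a where "a y = c (the_inv_into {..<n} (\<lambda>i. q (b i)) y)" for y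
      have "Q.lincomb a ?B = q (\<Sum>i<n. rweyl_coeff (c i) * b i)"
        unfolding lincomb by (simp add: a_def the_inv_into_f_f[OF inj])
      then have "q x = Q.lincomb a ?B" using c by (simp add: q_eq)
      then show ?thesis
        unfolding Q.span_def using B by (auto intro!: exI[of _ a] exI[of _ ?B])
    qed
    then show ?thesis using Q.span_is_subset2[OF B(1)] by (auto simp: carrier)
  qed
  ultimately have basis: "Q.basis ?B" using B by (simp add: Q.basis_def)
  then have "Q.fin_dim" using B unfolding Q.basis_def Q.fin_dim_def by blast
  moreover have "Q.dim = n"
    using Q.dim_basis[OF B(2) basis] card_image[OF inj] by simp
  ultimately show ?thesis by (simp add: holonomic_rank_def)
qed

section \<open>Three by three matrices\<close>

lemma matrix_mult_3:
  "(A ** B) $ i $ j = A $ i $ 1 * B $ 1 $ j + A $ i $ 2 * B $ 2 $ j + A $ i $ 3 * (B :: 'a::semiring_1^3^3) $ 3 $ j"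
  by (simp add: matrix_matrix_mult_def sum_3)

lemma matrix_vector_mult_3:
  "(A *v x) $ i = A $ i $ 1 * x $ 1 + A $ i $ 2 * x $ 2 + A $ i $ 3 * (x :: 'a::semiring_1^3) $ 3"
  by (simp add: matrix_vector_mult_def sum_3)

lemma index_3_simps [simp]: "(4::3) = 1" "(5::3) = 2" "(6::3) = 3"
  by simp_all

lemma mat_mult_entry: "(mat k ** A) $ i $ j = k * (A :: 'a::semiring_1^3^3) $ i $ j"
  by (simp add: matrix_matrix_mult_def mat_def if_distrib if_distribR sum.delta' cong: if_cong)

lemma matrix_add_rdistr: "(A + B) ** C = A ** C + B ** (C :: 'a::semiring_1^'n^'m)"
  by (simp add: vec_eq_iff matrix_matrix_mult_def distrib_right sum.distrib)

lemma index_3_distinct: "(1::3) \<noteq> 2" "(1::3) \<noteq> 3" "(2::3) \<noteq> 3" "(2::3) \<noteq> 1" "(3::3) \<noteq> 1" "(3::3) \<noteq> 2"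
  by simp_all

text \<open>Indices are taken in type \<open>3\<close>, hence modulo 3; the cyclic shifts produce
  the signs of the cofactors.\<close>

definition cofm :: "'a::comm_ring_1^3^3 \<Rightarrow> 'a^3^3" where
  "cofm A = (\<chi> i j. A $ (i+1) $ (j+1) * A $ (i+2) $ (j+2) - A $ (i+1) $ (j+2) * A $ (i+2) $ (j+1))"

definition inv1 :: "'a::comm_ring_1^3^3 \<Rightarrow> 'a" where
  "inv1 A = A$1$1 + A$2$2 + A$3$3"

text \<open>Together with \<open>inv1\<close> and \<open>det\<close>, a coefficient of the
  characteristic polynomial x^3 - \<open>inv1\<close> x^2 + \<open>inv2\<close> x -
  \<open>det\<close>.\<close>

definition inv2 :: "'a::comm_ring_1^3^3 \<Rightarrow> 'a" where
  "inv2 A = A$1$1 * A$2$2 - A$1$2 * A$2$1 + A$1$1 * A$3$3 - A$1$3 * A$3$1 + A$2$2 * A$3$3 - A$2$3 * A$3$2"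

lemma cayley_hamilton_3:
  fixes S :: "'a::comm_ring_1^3^3"
  shows "(S ** S ** S) $ i $ j = inv1 S * (S ** S) $ i $ j - inv2 S * S $ i $ j + det S * (if i = j then 1 else 0)"
proof -
  have "\<forall>i j. (S ** S ** S) $ i $ j = inv1 S * (S ** S) $ i $ j - inv2 S * S $ i $ j + det S * (if i = j then 1 else 0)"
    unfolding forall_3 by (simp add: matrix_mult_3 inv1_def inv2_def det_3 algebra_simps)
  then show ?thesis by blast
qed

text \<open>The polarisation of the quadratic map \<open>cofm\<close>: \<open>polcof A A = 2 cofm A\<close>.\<close>

definition polcof :: "'a::comm_ring_1^3^3 \<Rightarrow> 'a^3^3 \<Rightarrow> 'a^3^3" where
  "polcof A B = (\<chi> i j. A $ (i+1) $ (j+1) * B $ (i+2) $ (j+2) + B $ (i+1) $ (j+1) * A $ (i+2) $ (j+2)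
     - A $ (i+1) $ (j+2) * B $ (i+2) $ (j+1) - B $ (i+1) $ (j+2) * A $ (i+2) $ (j+1))"

text \<open>Polarisation of the multiplicativity \<open>cofm (A ** T) = cofm A ** cofm T\<close>. It
  pulls common right factors out of the cofactor relations.\<close>

lemma polcof_mult: "polcof (A ** T) (B ** T) = polcof A B ** cofm T"
proof -
  have "\<forall>i j. polcof (A ** T) (B ** T) $ i $ j = (polcof A B ** cofm T) $ i $ j"
    unfolding forall_3 by (simp add: matrix_mult_3 polcof_def cofm_def algebra_simps)
  then show ?thesis by (simp add: vec_eq_iff)
qed

lemma cofm_transpose: "cofm T ** transpose T = mat (det T)"
proof -
  have "\<forall>i j. (cofm T ** transpose T) $ i $ j = mat (det T) $ i $ j"
    unfolding forall_3 by (simp add: matrix_mult_3 cofm_def transpose_def mat_def det_3 algebra_simps)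
  then show ?thesis by (simp add: vec_eq_iff)
qed

lemma polcof_self: "polcof A A $ i $ j = 2 * cofm A $ i $ j"
  by (simp add: polcof_def cofm_def)

lemma transpose_mult_cofm: "transpose t ** cofm t = mat (det t)"
proof -
  have "\<forall>i j. (transpose t ** cofm t) $ i $ j = mat (det t) $ i $ j"
    unfolding forall_3 by (simp add: matrix_mult_3 cofm_def transpose_def mat_def det_3 algebra_simps)
  then show ?thesis by (simp add: vec_eq_iff)
qed

text \<open>For symmetric \<open>S\<close> the cofactor matrix is the adjugate, which is S^2 -
  \<open>inv1 S\<close> S + \<open>inv2 S\<close> by Cayley-Hamilton. So the polarised cofactors of
  powers of \<open>S\<close> reduce to combinations of 1, S, S^2.\<close>

lemma polcof_powers:
  fixes S :: "'a::comm_ring_1^3^3"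
  assumes "transpose S = S"
  defines "Dl \<equiv> \<lambda>i j. if i = j then 1 else 0 :: 'a"
  shows "polcof (mat 1) (mat 1) $ i $ j = 2 * Dl i j"
    "polcof (mat 1) S $ i $ j = inv1 S * Dl i j - S $ i $ j"
    "polcof (mat 1) (S ** S) $ i $ j = (inv1 S ^ 2 - 2 * inv2 S) * Dl i j - (S ** S) $ i $ j"
    "polcof S S $ i $ j = 2 * ((S ** S) $ i $ j - inv1 S * S $ i $ j + inv2 S * Dl i j)"
    "polcof S (S ** S) $ i $ j = inv1 S * (S ** S) $ i $ j - inv1 S ^ 2 * S $ i $ j + (inv1 S * inv2 S - det S) * Dl i j"
    "polcof (S ** S) (S ** S) $ i $ j
       = 2 * (inv2 S * (S ** S) $ i $ j + (det S - inv1 S * inv2 S) * S $ i $ j + (inv2 S ^ 2 - inv1 S * det S) * Dl i j)"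
proof -
  have sym: "S$2$1 = S$1$2" "S$3$1 = S$1$3" "S$3$2 = S$2$3"
    using arg_cong[OF assms(1), of "\<lambda>A. A $ 1 $ 2"] arg_cong[OF assms(1), of "\<lambda>A. A $ 1 $ 3"]
      arg_cong[OF assms(1), of "\<lambda>A. A $ 2 $ 3"]
    by (simp_all add: transpose_def)
  note defs = polcof_def matrix_mult_3 inv1_def inv2_def det_3 mat_def Dl_def sym power2_eq_square algebra_simps
  have "\<forall>i j. polcof (mat 1) (mat 1) $ i $ j = 2 * Dl i j"
    unfolding forall_3 by (simp add: defs)
  then show "polcof (mat 1) (mat 1) $ i $ j = 2 * Dl i j" by blast
  have "\<forall>i j. polcof (mat 1) S $ i $ j = inv1 S * Dl i j - S $ i $ j"
    unfolding forall_3 by (simp add: defs)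
  then show "polcof (mat 1) S $ i $ j = inv1 S * Dl i j - S $ i $ j" by blast
  have "\<forall>i j. polcof (mat 1) (S ** S) $ i $ j = (inv1 S ^ 2 - 2 * inv2 S) * Dl i j - (S ** S) $ i $ j"
    unfolding forall_3 by (simp add: defs)
  then show "polcof (mat 1) (S ** S) $ i $ j = (inv1 S ^ 2 - 2 * inv2 S) * Dl i j - (S ** S) $ i $ j" by blast
  have "\<forall>i j. polcof S S $ i $ j = 2 * ((S ** S) $ i $ j - inv1 S * S $ i $ j + inv2 S * Dl i j)"
    unfolding forall_3 by (simp add: defs)
  then show "polcof S S $ i $ j = 2 * ((S ** S) $ i $ j - inv1 S * S $ i $ j + inv2 S * Dl i j)" by blast
  have "\<forall>i j. polcof S (S ** S) $ i $ j = inv1 S * (S ** S) $ i $ j - inv1 S ^ 2 * S $ i $ j + (inv1 S * inv2 S - det S) * Dl i j"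
    unfolding forall_3 by (simp add: defs)
  then show "polcof S (S ** S) $ i $ j = inv1 S * (S ** S) $ i $ j - inv1 S ^ 2 * S $ i $ j + (inv1 S * inv2 S - det S) * Dl i j" by blast
  \<comment> \<open>The remaining formula has degree four in the entries of \<open>S\<close>; it is
    obtained from the square of the cofactor matrix instead of by expansion.\<close>
  have "\<forall>i j. cofm S $ i $ j = (S ** S) $ i $ j - inv1 S * S $ i $ j + inv2 S * Dl i j"
    unfolding forall_3 by (simp add: defs cofm_def)
  then have cof: "cofm S $ i $ j = (S ** S) $ i $ j - inv1 S * S $ i $ j + inv2 S * Dl i j" for i j by blast
  have right_mat: "(S ** mat k) $ i $ j = k * S $ i $ j" for k i j
    by (simp add: matrix_matrix_mult_def mat_def if_distrib if_distribR mult.commute cong: if_cong)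
  have SC: "S ** cofm S = mat (det S)" using transpose_mult_cofm[of S] assms(1) by simp
  have "cofm S = S ** S + mat (- inv1 S) ** S + mat (inv2 S)"
    by (simp add: vec_eq_iff cof mat_mult_entry) (simp add: mat_def Dl_def)
  then have "cofm S ** cofm S = (S ** S + mat (- inv1 S) ** S + mat (inv2 S)) ** cofm S" by simp
  also have "\<dots> = S ** (S ** cofm S) + mat (- inv1 S) ** (S ** cofm S) + mat (inv2 S) ** cofm S"
    by (simp only: matrix_add_rdistr matrix_mul_assoc)
  finally have f1: "(cofm S ** cofm S) $ i $ j = det S * S $ i $ j - inv1 S * (det S * Dl i j) + inv2 S * cofm S $ i $ j"
    unfolding SC by (simp add: mat_mult_entry right_mat) (simp add: mat_def Dl_def)
  have f2: "polcof (S ** S) (S ** S) $ i $ j = 2 * (cofm S ** cofm S) $ i $ j"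
    unfolding polcof_mult[of S S S] by (simp add: matrix_mult_3[of "polcof S S"] matrix_mult_3[of "cofm S"] polcof_self algebra_simps)
  show "polcof (S ** S) (S ** S) $ i $ j
       = 2 * (inv2 S * (S ** S) $ i $ j + (det S - inv1 S * inv2 S) * S $ i $ j + (inv2 S ^ 2 - inv1 S * det S) * Dl i j)"
    unfolding f2 f1 cof by (simp add: algebra_simps power2_eq_square)
qed

section \<open>Matrices whose Gram matrix has a cyclic vector\<close>

lemma matrix_inv_mult:
  fixes A :: "'a::field^'n^'n"
  assumes "det A \<noteq> 0"
  shows "A ** matrix_inv A = mat 1 \<and> matrix_inv A ** A = mat 1"
  unfolding matrix_inv_def
  by (rule someI_ex) (use assms in \<open>simp add: invertible_det_nz flip: invertible_def\<close>)

text \<open>The Krylov matrix; its determinant is nonzero exactly when \<open>v\<close> is a cyclic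
  vector of \<open>S\<close>.\<close>

definition krylov :: "'a::comm_ring_1^3^3 \<Rightarrow> 'a^3 \<Rightarrow> 'a^3^3" where
  "krylov S v = (\<chi> i j. if j = 1 then v $ i else if j = 2 then (S *v v) $ i else (S *v (S *v v)) $ i)"

locale generic_matrix =
  fixes T :: "'a::field_char_0^3^3" and v :: "'a^3"
  assumes det_T: "det T \<noteq> 0" and cyclic: "det (krylov (T ** transpose T) v) \<noteq> 0"
begin

definition "S = T ** transpose T"
definition "Ti = matrix_inv T"
definition "Ki = matrix_inv (krylov S v)"

lemma T_inverse: "T ** Ti = mat 1" "Ti ** T = mat 1"
  using matrix_inv_mult[of T] det_T by (simp_all add: Ti_def)

lemma Ki_inverse: "krylov S v ** Ki = mat 1" "Ki ** krylov S v = mat 1"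
  using matrix_inv_mult[of "krylov S v"] cyclic by (simp_all add: Ki_def S_def)

lemma S_sym: "transpose S = S"
  by (simp add: S_def matrix_transpose_mul)

text \<open>The linear conditions that invariance under left and right rotations imposes on the matrix of first derivatives.\<close>

definition symmetric_pair :: "'a^3^3 \<Rightarrow> bool" where
  "symmetric_pair X \<longleftrightarrow> X ** transpose T = T ** transpose X \<and> transpose T ** X = transpose X ** T"

text \<open>The frame in which every matrix satisfying \<open>symmetric_pair\<close> will be
  expanded.\<close>

definition Wm :: "3 \<Rightarrow> 'a^3^3" where
  "Wm c = (if c = 1 then T else if c = 2 then S ** T else S ** S ** T)"

text \<open>If \<open>X ** Ti\<close> is a polynomial in \<open>S\<close>, then its value at
  \<open>v\<close> is the combination of the Krylov columns with the same coefficients;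
  \<open>Ki\<close> recovers them.\<close>

definition coord :: "'a^3^3 \<Rightarrow> 'a^3" where
  "coord X = Ki *v ((X ** Ti) *v v)"

text \<open>Makes the coordinates explicit linear combinations of the entries, so that the same
  coefficients can be applied to a matrix of operators.\<close>

definition coeff_coord :: "3 \<Rightarrow> 3 \<Rightarrow> 3 \<Rightarrow> 'a" where
  "coeff_coord a i j = Ki $ a $ i * (Ti *v v) $ j"

lemma coord_eq_sum: "coord X $ a = (\<Sum>i\<in>UNIV. \<Sum>j\<in>UNIV. coeff_coord a i j * X $ i $ j)"
  by (simp add: coord_def coeff_coord_def matrix_vector_mult_def matrix_matrix_mult_def sum_3 algebra_simps)

lemma coord_eq_sum_pairs:
  "coord X $ a = (\<Sum>q\<in>UNIV. coeff_coord a (fst q) (snd q) * X $ fst q $ snd q)"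
  unfolding coord_eq_sum by (simp add: sum.cartesian_product case_prod_beta)

lemma krylov_mult_vec:
  "krylov S v *v x = x $ 1 *s v + x $ 2 *s (S *v v) + x $ 3 *s (S *v (S *v v))"
  by (simp add: vec_eq_iff krylov_def matrix_vector_mult_3 mult.commute)

lemma krylov_column: "krylov S v *v axis 1 1 = v" "krylov S v *v axis 2 1 = S *v v"
    "krylov S v *v axis 3 1 = S *v (S *v v)"
  by (simp_all add: krylov_mult_vec axis_def vec_eq_iff)

lemma coord_Wm: "coord (Wm c) = axis c 1"
proof -
  have TTi: "A ** T ** Ti = A" for A :: "'a^3^3"
    by (simp add: T_inverse flip: matrix_mul_assoc)
  have K: "Ki *v (krylov S v *v x) = x" for x
    by (simp add: matrix_vector_mul_assoc Ki_inverse)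
  have "(Wm c ** Ti) *v v = krylov S v *v axis c 1"
    using exhaust_3[of c]
    by (auto simp: Wm_def TTi T_inverse krylov_column matrix_vector_mul_assoc)
  then show ?thesis by (simp add: coord_def K)
qed

text \<open>The matrix \<open>E = X T\<^sup>-\<^sup>1\<close> commutes with \<open>S\<close>, which has \<open>v\<close> as a cyclic vector; hence \<open>E\<close> is a polynomial in \<open>S\<close>.\<close>

lemma symmetric_pair_expand:
  assumes "symmetric_pair X"
  shows "X $ i $ j = (\<Sum>c\<in>UNIV. coord X $ c * Wm c $ i $ j)"
proof -
  define E where "E = X ** Ti"
  define x where "x = coord X"
  define N where "N = mat (x $ 1) + mat (x $ 2) ** S + mat (x $ 3) ** (S ** S)"
  have X: "X = E ** T"
    by (simp add: E_def T_inverse flip: matrix_mul_assoc)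
  have ES: "E ** S = S ** E"
  proof -
    have s1: "X ** transpose T = T ** transpose X" and s2: "transpose T ** X = transpose X ** T"
      using assms by (auto simp only: symmetric_pair_def)
    \<comment> \<open>Both symmetry conditions enter: \<open>s1\<close> moves the transpose from
      \<open>T\<close> to \<open>X\<close>, and after insertion of \<open>T ** Ti\<close> the
      condition \<open>s2\<close> moves it back.\<close>
    have "E ** S = X ** (Ti ** T) ** transpose T"
      unfolding E_def S_def by (simp only: matrix_mul_assoc)
    also have "\<dots> = T ** transpose X"
      by (simp only: T_inverse matrix_mul_rid s1)
    also have "\<dots> = T ** (transpose X ** T) ** Ti"
      by (simp only: T_inverse matrix_mul_rid flip: matrix_mul_assoc)
    also have "\<dots> = S ** E"
      unfolding E_def S_def s2[symmetric] by (simp only: matrix_mul_assoc)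
    finally show ?thesis .
  qed
  have mat_comm: "A ** mat k = mat k ** A" for A :: "'a^3^3" and k
    by (simp add: vec_eq_iff matrix_mult_3 mat_def forall_3 mult.commute)
  have NS: "N ** S = S ** N"
    by (simp add: N_def matrix_add_ldistrib matrix_add_rdistr mat_comm matrix_mul_assoc)
  have smult: "mat k *v y = k *s y" for k and y :: "'a^3"
    by (simp add: vec_eq_iff matrix_vector_mult_3 mat_def forall_3)
  have "N *v v = krylov S v *v x"
    by (simp add: N_def krylov_mult_vec matrix_vector_mult_add_rdistrib smult flip: matrix_vector_mul_assoc)
  also have "\<dots> = E *v v"
  proof -
    have "krylov S v *v (Ki *v y) = y" for y
      by (simp add: matrix_vector_mul_assoc Ki_inverse)
    then show ?thesis by (simp add: x_def coord_def E_def)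
  qed
  finally have v: "(E - N) *v v = 0" by (simp add: matrix_vector_mult_diff_rdistrib)
  have "(A - B) ** C = A ** C - B ** C" for A B C :: "'a^3^3"
    by (simp add: vec_eq_iff matrix_matrix_mult_def left_diff_distrib sum_subtractf)
  moreover have "C ** (A - B) = C ** A - C ** B" for A B C :: "'a^3^3"
    by (simp add: vec_eq_iff matrix_matrix_mult_def right_diff_distrib sum_subtractf)
  ultimately have comm: "(E - N) ** S = S ** (E - N)" using ES NS by metis
  \<comment> \<open>\<open>E - N\<close> commutes with \<open>S\<close> and kills \<open>v\<close>,
    hence it kills every Krylov column and vanishes.\<close>
  have "(E - N) *v (S *v y) = S *v ((E - N) *v y)" for y
    by (simp add: matrix_vector_mul_assoc comm)
  then have "(E - N) *v (krylov S v *v y) = 0" for y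
    using v by (simp add: krylov_mult_vec vec.add vec.scale)
  then have "(E - N) ** krylov S v *v y = 0" for y
    by (simp add: matrix_vector_mul_assoc)
  then have "(E - N) ** krylov S v = 0"
    by (metis matrix_eq matrix_vector_mult_0)
  moreover have "0 ** Ki = 0" by (simp add: vec_eq_iff matrix_matrix_mult_def)
  ultimately have "(E - N) ** (krylov S v ** Ki) = 0" by (metis matrix_mul_assoc)
  then have "E = N" by (simp add: Ki_inverse)
  have "X $ i $ j = (N ** T) $ i $ j"
    using X \<open>E = N\<close> by metis
  also have "\<dots> = ((mat (x $ 1) + mat (x $ 2) ** S + mat (x $ 3) ** (S ** S)) ** T) $ i $ j"
    by (simp only: N_def)
  also have "\<dots> = x $ 1 * T $ i $ j + x $ 2 * (S ** T) $ i $ j + x $ 3 * (S ** S ** T) $ i $ j"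
    by (simp add: matrix_add_rdistr mat_mult_entry flip: matrix_mul_assoc)
  also have "\<dots> = (\<Sum>c\<in>UNIV. coord X $ c * Wm c $ i $ j)"
    by (simp add: sum_3 Wm_def x_def)
  finally show ?thesis .
qed

lemma symmetric_pair_iff:
  "symmetric_pair X \<longleftrightarrow>
     (\<forall>i j. (\<Sum>m\<in>UNIV. X $ i $ m * T $ j $ m) = (\<Sum>m\<in>UNIV. T $ i $ m * X $ j $ m)) \<and>
     (\<forall>i j. (\<Sum>m\<in>UNIV. T $ m $ i * X $ m $ j) = (\<Sum>m\<in>UNIV. X $ m $ i * T $ m $ j))"
  by (simp add: symmetric_pair_def vec_eq_iff matrix_matrix_mult_def transpose_def)

lemma symmetric_pair_lincomb:
  fixes X :: "'q \<Rightarrow> 'a^3^3"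
  assumes "\<And>q. symmetric_pair (X q)"
  shows "symmetric_pair (\<chi> i j. \<Sum>q\<in>A. n q * X q $ i $ j)"
proof -
  have swap: "(\<Sum>m\<in>UNIV. (\<Sum>q\<in>A. n q * f q m) * g m) = (\<Sum>q\<in>A. n q * (\<Sum>m\<in>UNIV. f q m * g m))"
    for f :: "'q \<Rightarrow> 3 \<Rightarrow> 'a" and g :: "3 \<Rightarrow> 'a"
    unfolding sum_distrib_left sum_distrib_right by (subst sum.swap) (simp add: mult.assoc)
  have swap': "(\<Sum>m\<in>UNIV. g m * (\<Sum>q\<in>A. n q * f q m)) = (\<Sum>q\<in>A. n q * (\<Sum>m\<in>UNIV. g m * f q m))"
    for f :: "'q \<Rightarrow> 3 \<Rightarrow> 'a" and g :: "3 \<Rightarrow> 'a"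
    using swap[of f g] by (simp add: mult.commute)
  show ?thesis
    using assms unfolding symmetric_pair_iff by (simp add: swap swap')
qed

text \<open>Applied to \<open>v\<close>, a relation among 1, S, S^2 becomes a relation among the
  columns of the invertible Krylov matrix.\<close>

lemma S_powers_independent:
  assumes "\<And>i j. a * (if i = j then 1 else 0) + b * S $ i $ j + c * (S ** S) $ i $ j = 0"
  shows "a = 0" "b = 0" "c = 0"
proof -
  define x :: "'a^3" where "x = vector [a, b, c]"
  have x: "x $ 1 = a" "x $ 2 = b" "x $ 3 = c" by (simp_all add: x_def)
  define N where "N = mat a + mat b ** S + mat c ** (S ** S)"
  have "N $ i $ j = 0" for i j
  proof -
    have "N $ i $ j = a * (if i = j then 1 else 0) + b * S $ i $ j + c * (S ** S) $ i $ j"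
      by (simp add: N_def mat_mult_entry) (simp add: mat_def)
    then show ?thesis using assms by simp
  qed
  then have "N = 0" by (simp add: vec_eq_iff)
  have smult: "mat k *v y = k *s y" for k and y :: "'a^3"
    by (simp add: vec_eq_iff matrix_vector_mult_3 mat_def forall_3)
  have "krylov S v *v x = N *v v"
    by (simp add: N_def krylov_mult_vec matrix_vector_mult_add_rdistrib smult x flip: matrix_vector_mul_assoc)
  then have "Ki *v (krylov S v *v x) = 0" by (simp add: \<open>N = 0\<close>)
  then have "x = 0" by (simp add: matrix_vector_mul_assoc Ki_inverse)
  then show "a = 0" "b = 0" "c = 0" using x by auto
qed

lemma S_inverse: "S ** (transpose Ti ** Ti) = mat 1"
proof -
  have "transpose T ** transpose Ti = mat 1"
    by (simp add: T_inverse transpose_mat flip: matrix_transpose_mul)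
  then have "T ** (transpose T ** transpose Ti) ** Ti = mat 1"
    by (simp add: T_inverse)
  then show ?thesis by (simp add: S_def matrix_mul_assoc)
qed

lemma S_power4:
  "(S ** S ** S ** S) $ i $ j = inv1 S * (S ** S ** S) $ i $ j - inv2 S * (S ** S) $ i $ j + det S * S $ i $ j"
proof -
  have "S ** S ** S = mat (inv1 S) ** (S ** S) + mat (- inv2 S) ** S + mat (det S)"
    by (simp add: vec_eq_iff mat_mult_entry cayley_hamilton_3) (simp add: mat_def)
  then have "S ** S ** S ** S = (mat (inv1 S) ** (S ** S) + mat (- inv2 S) ** S + mat (det S)) ** S"
    by simp
  also have "\<dots> = mat (inv1 S) ** (S ** S ** S) + mat (- inv2 S) ** (S ** S) + mat (det S) ** S"
    by (simp only: matrix_add_rdistr matrix_mul_assoc)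
  finally show ?thesis by (simp add: mat_mult_entry)
qed

end

section \<open>Six linear equations for the symbols of second order\<close>

lemma cramer_3:
  fixes x y z :: "'a::idom"
  assumes "a1 * x + b1 * y + c1 * z = 0" "a2 * x + b2 * y + c2 * z = 0" "a3 * x + b3 * y + c3 * z = 0"
    and "a1 * (b2 * c3 - b3 * c2) - b1 * (a2 * c3 - a3 * c2) + c1 * (a2 * b3 - a3 * b2) \<noteq> 0" (is "?D \<noteq> 0")
  shows "x = 0" "y = 0" "z = 0"
proof -
  have "?D * x = 0" "?D * y = 0" "?D * z = 0" using assms(1-3) by Groebner_Basis.algebra+
  then show "x = 0" "y = 0" "z = 0" using assms(4) by simp_all
qed

text \<open>The discriminant of \<open>x\<^sup>3 - p x\<^sup>2 + b x - e\<close>.\<close>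

definition cubic_disc :: "'a::comm_ring_1 \<Rightarrow> 'a \<Rightarrow> 'a \<Rightarrow> 'a" where
  "cubic_disc p b e = p^2 * b^2 - 4 * b^3 - 4 * p^3 * e - 27 * e^2 + 18 * p * b * e"

text \<open>In terms of the roots \<open>x\<^sub>i\<close> of \<open>x\<^sup>3 - p x\<^sup>2 + b x - e\<close>, the first three equations say that the symmetric form \<open>z(x, y) = \<Sum> z\<^sub>c\<^sub>d x\<^sup>c y\<^sup>d\<close>
  vanishes at all \<open>(x\<^sub>i, x\<^sub>i)\<close>, and the last three that it vanishes at all \<open>(x\<^sub>i, x\<^sub>j)\<close> with \<open>i \<noteq> j\<close>.\<close>

lemma symmetric_form_zero:
  fixes p b e :: "'a::field_char_0"
  assumes "z00 + 2 * e * z12 + p * e * z22 = 0"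
    and "2 * z01 - 2 * b * z12 + (e - p * b) * z22 = 0"
    and "2 * z02 + z11 + 2 * p * z12 + (p^2 - b) * z22 = 0"
    and "- z02 + z11 + p * z12 + b * z22 = 0"
    and "- z01 - p * z11 - p^2 * z12 + (e - b * p) * z22 = 0"
    and "z00 + p * z01 + (p^2 - 2 * b) * z02 + b * z11 + (p * b - e) * z12 + (b^2 - p * e) * z22 = 0"
    and disc: "cubic_disc p b e \<noteq> 0"
  shows "z00 = 0" "z01 = 0" "z02 = 0" "z11 = 0" "z12 = 0" "z22 = 0"
proof -
  have z: "z02 = 0" "z12 = 0" "z22 = 0"
  proof -
    have 1: "3 * z02 + p * z12 + (p^2 - 2 * b) * z22 = 0"
      using assms(3,4) by Groebner_Basis.algebra
    have 2: "(- 2 * p) * z02 + (- 2 * b) * z12 + (3 * e - p * b) * z22 = 0"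
      using assms(2,4,5) by Groebner_Basis.algebra
    have 3: "(2 * p^2 - 2 * b) * z02 + (2 * p * b - 6 * e) * z12 + (p^2 * b - 5 * p * e) * z22 = 0"
      using assms(1,2,4,6) by Groebner_Basis.algebra
    \<comment> \<open>Elimination of \<open>z00\<close>, \<open>z01\<close>, \<open>z11\<close> has
      left three equations for the other unknowns; their determinant is -2 times the
      discriminant.\<close>
    have D: "3 * ((- 2 * b) * (p^2 * b - 5 * p * e) - (2 * p * b - 6 * e) * (3 * e - p * b))
       - p * ((- 2 * p) * (p^2 * b - 5 * p * e) - (2 * p^2 - 2 * b) * (3 * e - p * b))
       + (p^2 - 2 * b) * ((- 2 * p) * (2 * p * b - 6 * e) - (2 * p^2 - 2 * b) * (- 2 * b)) = - 2 * cubic_disc p b e"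
      unfolding cubic_disc_def by Groebner_Basis.algebra
    show "z02 = 0" "z12 = 0" "z22 = 0"
      by (rule cramer_3[OF 1 2 3]; use D disc in simp)+
  qed
  show "z02 = 0" "z12 = 0" "z22 = 0" by fact+
  show "z00 = 0" "z01 = 0" "z11 = 0" using assms(1,2,4) z by simp_all
qed

context generic_matrix
begin

text \<open>Expanding \<open>Z\<close> in the frame \<open>Wm\<close> in both pairs of indices
  leaves a symmetric 3 by 3 array \<open>z\<close>. As 1, S, S^2 are independent,
  \<open>orth\<close> and \<open>cof\<close> amount to three scalar equations each for
  \<open>z\<close>.\<close>

lemma symmetric_tensor_zero:
  fixes Z :: "3 \<Rightarrow> 3 \<Rightarrow> 3 \<Rightarrow> 3 \<Rightarrow> 'a"
  assumes sym: "\<And>i j k l. Z i j k l = Z k l i j"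
    and pair: "\<And>i j. symmetric_pair (\<chi> k l. Z i j k l)"
    and orth: "\<And>i j. (\<Sum>k\<in>UNIV. Z i k j k) = 0"
    and cof: "\<And>i j. Z (i+1) (j+1) (i+2) (j+2) - Z (i+1) (j+2) (i+2) (j+1) = 0"
    and disc: "cubic_disc (inv1 S) (inv2 S) (det S) \<noteq> 0"
  shows "Z i j k l = 0"
proof -
  define n where "n a q = coeff_coord a (fst q) (snd q)" for a and q :: "3 \<times> 3"
  define y where "y c = (\<chi> i j. coord (\<chi> k l. Z i j k l) $ c)" for c
  define z where "z c d = coord (y c) $ d" for c d
  have y: "y c = (\<chi> i j. \<Sum>q\<in>UNIV. n c q * (\<chi> k l. Z (fst q) (snd q) k l) $ i $ j)" for c
    unfolding y_def coord_eq_sum_pairs n_def by (simp add: vec_eq_iff sym[of _ _ "fst _"])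
  have "symmetric_pair (y c)" for c
    unfolding y by (rule symmetric_pair_lincomb) (rule pair)
  then have y_expand: "y c $ i $ j = (\<Sum>d\<in>UNIV. z c d * Wm d $ i $ j)" for c i j
    unfolding z_def by (rule symmetric_pair_expand)
  have "Z i j k l = (\<Sum>c\<in>UNIV. y c $ i $ j * Wm c $ k $ l)" for i j k l
    using symmetric_pair_expand[OF pair, of i j k l] by (simp add: y_def)
  then have Z: "Z i j k l = (\<Sum>c\<in>UNIV. (\<Sum>d\<in>UNIV. z c d * Wm d $ i $ j) * Wm c $ k $ l)" for i j k l
    by (simp add: y_expand)
  have z_eq: "z c d = (\<Sum>r\<in>UNIV. \<Sum>q\<in>UNIV. n d r * n c q * Z (fst q) (snd q) (fst r) (snd r))" for c d
  proof -
    have "z c d = (\<Sum>r\<in>UNIV. n d r * y c $ fst r $ snd r)"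
      unfolding z_def coord_eq_sum_pairs n_def ..
    then show ?thesis unfolding y by (simp add: sum_distrib_left mult.assoc)
  qed
  have z_sym: "z c d = z d c" for c d
  proof -
    have "z c d = (\<Sum>q\<in>UNIV. \<Sum>r\<in>UNIV. n d r * n c q * Z (fst q) (snd q) (fst r) (snd r))"
      unfolding z_eq by (rule sum.swap)
    also have "\<dots> = (\<Sum>q\<in>UNIV. \<Sum>r\<in>UNIV. n c q * n d r * Z (fst r) (snd r) (fst q) (snd q))"
      by (intro sum.cong refl arg_cong2[where f = "(*)"] sym mult.commute)
    finally show ?thesis by (simp only: z_eq[of d c])
  qed
  note z_syms = z_sym[of 2 1] z_sym[of 3 1] z_sym[of 3 2]
  have TT: "A ** T ** transpose T = A ** S" for A :: "'a^3^3"
    by (simp add: S_def matrix_mul_assoc)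
  have TT': "T ** transpose T = S" by (simp add: S_def)
  have WW: "(\<Sum>k\<in>UNIV. Wm d $ i $ k * Wm c $ j $ k) = (Wm d ** transpose (Wm c)) $ i $ j" for c d i j
    by (simp add: matrix_matrix_mult_def transpose_def)
  \<comment> \<open>The condition \<open>orth\<close> will read R S = 0, where R is the form with
    coefficients \<open>z\<close> evaluated with both arguments equal to \<open>S\<close>.\<close>
  define R where "R = mat (z 1 1) + mat (2 * z 1 2) ** S + mat (2 * z 1 3 + z 2 2) ** (S ** S)
     + mat (2 * z 2 3) ** (S ** S ** S) + mat (z 3 3) ** (S ** S ** S ** S)"
  have "(R ** S) $ i $ j = 0" for i j
  proof -
    have "(\<Sum>k\<in>UNIV. Z i k j k) = (\<Sum>c\<in>UNIV. \<Sum>d\<in>UNIV. z c d * (\<Sum>k\<in>UNIV. Wm d $ i $ k * Wm c $ j $ k))"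
      unfolding Z by (simp add: sum_3 algebra_simps)
    also have "\<dots> = (R ** S) $ i $ j"
      unfolding WW R_def matrix_add_rdistr
      by (simp add: sum_3 Wm_def matrix_transpose_mul S_sym matrix_mul_assoc TT TT' z_syms)
        (simp add: mat_mult_entry matrix_mul_assoc[symmetric] algebra_simps)
    finally show ?thesis using orth[of i j] by simp
  qed
  then have "R ** S = 0" by (simp add: vec_eq_iff)
  moreover have "0 ** A = (0 :: 'a^3^3)" for A :: "'a^3^3" by (simp add: vec_eq_iff matrix_matrix_mult_def)
  ultimately have "R ** (S ** (transpose Ti ** Ti)) = 0" by (simp add: matrix_mul_assoc)
  then have "R = 0" by (simp add: S_inverse)
  let ?p = "inv1 S" and ?b = "inv2 S" and ?e = "det S"
  have "(z 1 1 + 2 * ?e * z 2 3 + ?p * ?e * z 3 3) * (if i = j then 1 else 0)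
      + (2 * z 1 2 - 2 * ?b * z 2 3 + (?e - ?p * ?b) * z 3 3) * S $ i $ j
      + (2 * z 1 3 + z 2 2 + 2 * ?p * z 2 3 + (?p^2 - ?b) * z 3 3) * (S ** S) $ i $ j = 0" (is "?l = 0") for i j
  proof -
    have "?l = R $ i $ j"
      by (simp add: R_def mat_mult_entry S_power4 cayley_hamilton_3[of S])
        (simp add: mat_def algebra_simps power2_eq_square)
    then show ?thesis by (simp add: \<open>R = 0\<close>)
  qed
  note 0 = S_powers_independent[OF this]
  have 1: "z 1 1 + 2 * ?e * z 2 3 + ?p * ?e * z 3 3 = 0"
      "2 * z 1 2 - 2 * ?b * z 2 3 + (?e - ?p * ?b) * z 3 3 = 0"
      "2 * z 1 3 + z 2 2 + 2 * ?p * z 2 3 + (?p^2 - ?b) * z 3 3 = 0"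
    by (fact 0)+
  define P :: "3 \<Rightarrow> 'a^3^3" where "P c = (if c = 1 then mat 1 else if c = 2 then S else S ** S)" for c
  \<comment> \<open>\<open>N\<close> collects the polarised cofactors once \<open>cofm T\<close> is
    split off on the right; multiplication by \<open>transpose T\<close> turns that factor into
    \<open>det T\<close>, which can be cancelled.\<close>
  define N where "N = (\<chi> i j. \<Sum>c\<in>UNIV. \<Sum>d\<in>UNIV. z c d * polcof (P d) (P c) $ i $ j)"
  have Wm: "Wm c = P c ** T" for c by (simp add: Wm_def P_def)
  have "(N ** cofm T) $ i $ j = 0" for i j
  proof -
    have "(N ** cofm T) $ i $ j = (\<Sum>c\<in>UNIV. \<Sum>d\<in>UNIV. z c d * polcof (Wm d) (Wm c) $ i $ j)"
      unfolding Wm polcof_mult N_def matrix_mult_3 by (simp add: sum_3 algebra_simps)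
    also have "\<dots> = 2 * (Z (i+1) (j+1) (i+2) (j+2) - Z (i+1) (j+2) (i+2) (j+1))"
      unfolding Z by (simp add: polcof_def sum_3 z_syms algebra_simps)
    finally show ?thesis using cof by simp
  qed
  then have "N ** cofm T = 0" by (simp add: vec_eq_iff)
  then have "N ** (cofm T ** transpose T) = 0"
    by (simp add: matrix_mul_assoc)
  then have N: "N $ i $ j = 0" for i j
    using det_T unfolding cofm_transpose
    by (simp add: vec_eq_iff matrix_matrix_mult_def mat_def if_distrib if_distribR sum.delta cong: if_cong)
  have polcof_sym: "polcof A B = polcof B A" for A B :: "'a^3^3"
    by (simp add: polcof_def vec_eq_iff)
  note pp = polcof_powers[OF S_sym]
  have "2 * (z 1 1 + ?p * z 1 2 + (?p^2 - 2 * ?b) * z 1 3 + ?b * z 2 2 + (?p * ?b - ?e) * z 2 3 + (?b^2 - ?p * ?e) * z 3 3)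
      * (if i = j then 1 else 0)
     + 2 * (- z 1 2 - ?p * z 2 2 - ?p^2 * z 2 3 + (?e - ?b * ?p) * z 3 3) * S $ i $ j
     + 2 * (- z 1 3 + z 2 2 + ?p * z 2 3 + ?b * z 3 3) * (S ** S) $ i $ j = 0" (is "?l = 0") for i j
  proof -
    have "?l = N $ i $ j"
      unfolding N_def
      by (simp only: vec_lambda_beta sum_3 P_def if_True if_False refl z_syms polcof_sym[of S "mat 1"]
        polcof_sym[of "S ** S" "mat 1"] polcof_sym[of "S ** S" S] pp simp_thms index_3_distinct)
      (simp add: algebra_simps)
    then show ?thesis by (simp add: N)
  qed
  note 0 = S_powers_independent[OF this]
  have 2: "2 * (z 1 1 + ?p * z 1 2 + (?p^2 - 2 * ?b) * z 1 3 + ?b * z 2 2 + (?p * ?b - ?e) * z 2 3 + (?b^2 - ?p * ?e) * z 3 3) = 0"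
      "2 * (- z 1 2 - ?p * z 2 2 - ?p^2 * z 2 3 + (?e - ?b * ?p) * z 3 3) = 0"
      "2 * (- z 1 3 + z 2 2 + ?p * z 2 3 + ?b * z 3 3) = 0"
    by (fact 0)+
  have half: "x = 0" if "2 * x = 0" for x :: 'a using that by simp
  \<comment> \<open>\<open>z c d\<close> belongs to the exponents c - 1 and d - 1. The equations
    \<open>2\<close> are listed by the coefficients of 1, S, S^2 and enter in reverse order.\<close>
  have "z 1 1 = 0" "z 1 2 = 0" "z 1 3 = 0" "z 2 2 = 0" "z 2 3 = 0" "z 3 3 = 0"
    by (rule symmetric_form_zero[OF 1 2(3,2,1)[THEN half] disc])+
  then have "z c d = 0" for c d
    using exhaust_3[of c] exhaust_3[of d] z_syms by auto
  then show ?thesis by (simp add: Z)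
qed

end

section \<open>The rotation ideal\<close>

text \<open>Left multiplication by coefficients makes R a vector space over K, so a point outside a
  subspace is separated from it by a linear functional. Relations modulo the ideal thus become
  identities between commuting values in K.\<close>

lemma rweyl_coeff_functional:
  fixes V :: "'v::{finite,linorder} rweyl set"
  assumes V: "0 \<in> V" "\<And>x y. x \<in> V \<Longrightarrow> y \<in> V \<Longrightarrow> x + y \<in> V" "\<And>c x. x \<in> V \<Longrightarrow> rweyl_coeff c * x \<in> V"
    and x: "x \<notin> V"
  obtains l :: "'v rweyl \<Rightarrow> 'v ratfun" where "\<And>y z. l (y + z) = l y + l z"
    "\<And>c y. l (rweyl_coeff c * y) = c * l y" "\<And>y. y \<in> V \<Longrightarrow> l y = 0" "l x \<noteq> 0"
proof -
  define sc where "sc c y = rweyl_coeff c * y" for c and y :: "'v rweyl"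
  interpret vector_space_pair sc "(*) :: 'v ratfun \<Rightarrow> 'v ratfun \<Rightarrow> 'v ratfun"
    by unfold_locales (simp_all add: sc_def rweyl_coeff_hom algebra_simps)
  have sub: "vs1.subspace V"
    using V by (simp add: vs1.subspace_def sc_def)
  obtain B where B: "B \<subseteq> V" "vs1.independent B" "vs1.span B = V"
    using vs1.maximal_independent_subset[of V] sub
    by (metis vs1.span_minimal subset_antisym)
  have "vs1.independent (insert x B)"
    using vs1.independent_insert[of x B] B x by auto
  then obtain l where l: "Vector_Spaces.linear sc (*) l" "\<forall>y\<in>insert x B. l y = (if y = x then 1 else 0)"
    using linear_independent_extend[of "insert x B" "\<lambda>y. if y = x then 1 else 0"] by blast
  interpret l: Vector_Spaces.linear sc "(*)" l by fact
  have "l y = 0" if "y \<in> V" for y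
  proof -
    have "y \<in> vs1.span B" using that B by simp
    then show ?thesis
      by (rule linear_eq_0_on_span[OF l(1), rotated]) (use l(2) B(1) x in auto)
  qed
  then show thesis
    using that[of l] l.add l.scale l(2) by (auto simp: sc_def)
qed

text \<open>In normal form every operator is a sum of coefficients times monomials in the
  derivations, and each monomial arises from 1 by left multiplication.\<close>

lemma rweyl_generated:
  fixes V :: "'v::{finite,linorder} rweyl set"
  assumes V: "\<And>x y. x \<in> V \<Longrightarrow> y \<in> V \<Longrightarrow> x + y \<in> V" "\<And>c x. x \<in> V \<Longrightarrow> rweyl_coeff c * x \<in> V"
    and diff: "\<And>v x. x \<in> V \<Longrightarrow> rweyl_diff v * x \<in> V" and one: "1 \<in> V"
  shows "x \<in> V"
proof -
  have mono: "Abs_rweyl (Poly_Mapping.single \<alpha> 1) \<in> V" for \<alpha>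
  proof (induction \<alpha> rule: exponent_induct)
    case zero
    then show ?case using one by (simp add: one_rweyl_def)
  next
    case (add \<alpha> v)
    have "Abs_rweyl (Poly_Mapping.single (\<alpha> + Poly_Mapping.single v 1) 1)
        = rweyl_diff v * Abs_rweyl (Poly_Mapping.single \<alpha> 1)"
      by (simp add: normal_form_simps nf_times_single monom_act_nf_diff_single nf_diff_single)
    then show ?case using diff[OF add] by simp
  qed
  have "Abs_rweyl p \<in> V" for p
  proof (induction p rule: poly_mapping_add_induct)
    case (single \<alpha> a)
    have "Abs_rweyl (Poly_Mapping.single \<alpha> a) = rweyl_coeff a * Abs_rweyl (Poly_Mapping.single \<alpha> 1)"
      by (simp add: normal_form_simps nf_times_single mult_single)
    then show ?case using V(2)[OF mono] by simp
  next
    case (add p q)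
    have "Abs_rweyl (p + q) = Abs_rweyl p + Abs_rweyl q"
      by (simp add: normal_form_simps)
    then show ?case using V(1) add by simp
  qed
  then show ?thesis by (metis normal_form_inverse)
qed

text \<open>The generators are indexed by the numbers 1 to 3, the matrices by the type
  \<open>3\<close>, where 3 = 0; hence the representative 3 in the last case.\<close>

definition nat3 :: "3 \<Rightarrow> nat" where
  "nat3 i = (if i = 1 then 1 else if i = 2 then 2 else 3)"

lemma nat3_simps [simp]: "nat3 1 = 1" "nat3 2 = 2" "nat3 3 = 3"
  by (simp_all add: nat3_def)

lemma nat3_inject: "nat3 i = nat3 j \<longleftrightarrow> i = j"
  using exhaust_3[of i] exhaust_3[of j] by auto

lemma nat3_cases:
  assumes "1 \<le> n" "n \<le> 3"
  obtains i where "n = nat3 i"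
proof -
  have "n = nat3 1 \<or> n = nat3 2 \<or> n = nat3 3" using assms by (simp; arith)
  then show thesis using that by blast
qed

lemma nat3_surj: "1 \<le> n \<Longrightarrow> n \<le> 3 \<Longrightarrow> \<exists>i. n = nat3 i"
  by (metis nat3_cases)

lemma atLeastAtMost_1_3: "{1..3::nat} = {1, 2, 3}"
  by auto

lemma sum_nat3: "(\<Sum>k=1..3. f k) = (\<Sum>k\<in>UNIV. f (nat3 k))"
  by (simp add: atLeastAtMost_1_3 sum_3 add.assoc)

definition dd :: "3 \<Rightarrow> 3 \<Rightarrow> 9 rweyl" where
  "dd i j = d_op (nat3 i) (nat3 j)"

definition tvar :: "3 \<Rightarrow> 3 \<Rightarrow> 9 ratfun" where
  "tvar i j = Fract (Poly_Mapping.single (Poly_Mapping.single (entry (nat3 i) (nat3 j)) 1) 1) 1"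

lemma t_op_eq: "t_op (nat3 i) (nat3 j) = rweyl_coeff (tvar i j)"
  by (simp add: t_op_def tvar_def rweyl_var_def)

lemma entry_eq_iff: "entry (nat3 i) (nat3 j) = entry (nat3 k) (nat3 l) \<longleftrightarrow> i = k \<and> j = l"
proof -
  have "nat3 i \<in> {1..3}" for i using exhaust_3[of i] by auto
  then have "entry (nat3 i) (nat3 j) = entry (nat3 k) (nat3 l) \<longleftrightarrow> nat3 i = nat3 k \<and> nat3 j = nat3 l"
    using inj_on_eq_iff[OF bij_betw_imp_inj_on[OF bij_betw_entry], of "(nat3 i, nat3 j)" "(nat3 k, nat3 l)"]
    by (simp del: atLeastAtMost_iff)
  then show ?thesis by (simp add: nat3_inject)
qed

lemma entry_cases: obtains i j where "v = entry (nat3 i) (nat3 j)"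
proof -
  have "v \<in> (\<lambda>(i, j). entry i j) ` ({1..3} \<times> {1..3})"
    using bij_betw_entry by (auto simp: bij_betw_def)
  then obtain m n where "v = entry m n" "1 \<le> m" "m \<le> 3" "1 \<le> n" "n \<le> 3" by auto
  then show thesis using that by (metis nat3_cases)
qed

section \<open>Commutation rules, cofactors and determinant for the matrix of derivations\<close>

lemma dd_commute: "dd i j * dd k l = dd k l * dd i j"
  by (simp add: dd_def d_op_def rweyl_diff_commute)

lemma dd_left_commute: "dd i j * (dd k l * x) = dd k l * (dd i j * x)"
  by (metis dd_commute mult.assoc)

lemma dd_coeff: "dd i j * rweyl_coeff a = rweyl_coeff a * dd i j + rweyl_coeff (ratfun_diff (entry (nat3 i) (nat3 j)) a)"
  by (simp add: dd_def d_op_def rweyl_diff_coeff)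

lemma ratfun_diff_tvar:
  "ratfun_diff (entry (nat3 i) (nat3 j)) (tvar k l) = (if i = k \<and> j = l then 1 else 0)"
  by (auto simp: tvar_def ratfun_diff_poly mpoly_diff_single lookup_single entry_eq_iff
      One_fract_def Zero_fract_def when_def)

lemma dd_tvar: "dd i j * rweyl_coeff (tvar k l) = rweyl_coeff (tvar k l) * dd i j + (if i = k \<and> j = l then 1 else 0)"
  by (simp add: dd_coeff ratfun_diff_tvar rweyl_coeff_hom)

definition dcof :: "3 \<Rightarrow> 3 \<Rightarrow> 9 rweyl" where
  "dcof i j = dd (i+1) (j+1) * dd (i+2) (j+2) - dd (i+1) (j+2) * dd (i+2) (j+1)"

definition ddet :: "9 rweyl" where
  "ddet = (\<Sum>j\<in>UNIV. dcof 1 j * dd 1 j)"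

lemma dcof_column: "(\<Sum>i\<in>UNIV. dcof i a * dd i b) = (if a = b then ddet else 0)"
proof -
  have "\<forall>a b. (\<Sum>i\<in>UNIV. dcof i a * dd i b) = (if a = b then ddet else 0)"
    unfolding forall_3
    by (simp add: sum_3 dcof_def ddet_def left_diff_distrib mult.assoc)
      (simp add: dd_commute dd_left_commute algebra_simps)
  then show ?thesis by blast
qed

lemma det3_expand:
  fixes A :: "nat \<Rightarrow> nat \<Rightarrow> 'a::ring_1"
  shows "det3 A = A 1 1 * A 2 2 * A 3 3 + A 1 2 * A 2 3 * A 3 1 + A 1 3 * A 2 1 * A 3 2
    - A 1 1 * A 2 3 * A 3 2 - A 1 2 * A 2 1 * A 3 3 - A 1 3 * A 2 2 * A 3 1"
proof -
  have f123: "finite {2::nat, 3}" "1 \<notin> {2::nat, 3}" by auto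
  have f23: "finite {3::nat}" "2 \<notin> {3::nat}" by auto
  show ?thesis
    unfolding det3_def atLeastAtMost_1_3
    unfolding sum_over_permutations_insert[OF f123]
    unfolding sum_over_permutations_insert[OF f23]
    unfolding permutes_sing
    by (simp add: sign_swap_id permutation_swap_id sign_compose sign_id swap_id_eq)
qed

lemma gen_d_eq: "gen_d = 1 - ddet"
proof -
  have d: "d_op 1 j = dd 1 k" "d_op 2 j = dd 2 k" "d_op 3 j = dd 3 k" if "j = nat3 k" for j k
    by (simp_all add: dd_def that)
  have "det3 d_op = ddet"
    unfolding det3_expand ddet_def d[of 1 1, simplified] d[of 2 2, simplified] d[of 3 3, simplified]
    by (simp add: sum_3 dcof_def left_diff_distrib mult.assoc)
      (simp add: dd_commute dd_left_commute)
  then show ?thesis by (simp add: gen_d_def)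
qed

lemma gen_g_eq: "gen_g (nat3 i) (nat3 j) = (if i = j then 1 else 0) - (\<Sum>k\<in>UNIV. dd i k * dd j k)"
  unfolding gen_g_def sum_nat3 dd_def by (simp add: nat3_inject)

lemma gen_P_eq: "gen_P (nat3 i) (nat3 j)
    = (\<Sum>k\<in>UNIV. rweyl_coeff (tvar i k) * dd j k) - (\<Sum>k\<in>UNIV. rweyl_coeff (tvar j k) * dd i k)"
  unfolding gen_P_def sum_nat3 dd_def t_op_eq by (simp add: sum_subtractf)

lemma dd_ddet: "dd i j * ddet = ddet * dd i j"
  by (simp add: ddet_def dcof_def sum_3 algebra_simps mult.assoc)
    (simp add: dd_commute dd_left_commute)?

lemma dd_dcof: "dd i j * dcof k l = dcof k l * dd i j"
  by (simp add: dcof_def algebra_simps mult.assoc) (simp add: dd_commute dd_left_commute)?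

lemma three_mult: "3 * x = x + 2 * (x :: 'a::ring_1)"
  using distrib_right[of 1 2 x] by simp

lemma sum_mult_delta_diff:
  fixes f g :: "'i::finite \<Rightarrow> 'a::ring_1"
  shows "(\<Sum>i\<in>UNIV. f i * ((if i = j then 1 else 0) - g i)) = f j - (\<Sum>i\<in>UNIV. f i * g i)"
    "(\<Sum>i\<in>UNIV. f i * (g i - (if j = i then 1 else 0))) = (\<Sum>i\<in>UNIV. f i * g i) - f j"
proof -
  have "(\<Sum>i\<in>UNIV. f i * (if i = j then 1 else 0)) = f j"
    by (simp add: if_distrib[of "\<lambda>x. f _ * x"] cong: if_cong)
  moreover have "(\<Sum>i\<in>UNIV. f i * (if j = i then 1 else 0)) = f j"
    by (simp add: if_distrib[of "\<lambda>x. f _ * x"] cong: if_cong)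
  ultimately show "(\<Sum>i\<in>UNIV. f i * ((if i = j then 1 else 0) - g i)) = f j - (\<Sum>i\<in>UNIV. f i * g i)"
    "(\<Sum>i\<in>UNIV. f i * (g i - (if j = i then 1 else 0))) = (\<Sum>i\<in>UNIV. f i * g i) - f j"
    by (simp_all only: right_diff_distrib sum_subtractf)
qed

section \<open>Relations that follow from the generators\<close>

locale rotation_ideal =
  fixes I :: "9 rweyl set"
  assumes ideal: "left_ideal UNIV I"
    and gen_d: "gen_d \<in> I"
    and gen_g: "\<And>i j. 1 \<le> i \<Longrightarrow> i \<le> j \<Longrightarrow> j \<le> 3 \<Longrightarrow> gen_g i j \<in> I"
    and gen_P: "\<And>i j. 1 \<le> i \<Longrightarrow> i < j \<Longrightarrow> j \<le> 3 \<Longrightarrow> gen_P i j \<in> I"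
begin

lemma mult_mem: "a \<in> I \<Longrightarrow> s * a \<in> I"
  using left_idealD(3)[OF ideal] by simp

lemmas zero_mem = left_idealD(1)[OF ideal]
lemmas add_mem = left_idealD(2)[OF ideal]
lemmas uminus_mem = left_ideal_uminus[OF ideal]
lemmas diff_mem = left_ideal_diff[OF ideal]
lemmas sum_mem = left_ideal_sum[OF ideal]

lemma orthogonal_rows: "(if i = j then 1 else 0) - (\<Sum>k\<in>UNIV. dd i k * dd j k) \<in> I"
proof -
  have *: "gen_g (nat3 i) (nat3 j) \<in> I" if "nat3 i \<le> nat3 j" for i j
    using gen_g[of "nat3 i" "nat3 j"] that exhaust_3[of i] exhaust_3[of j] by auto
  have "nat3 i \<le> nat3 j \<or> nat3 j \<le> nat3 i" by auto
  then show ?thesis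
    using *[of i j] *[of j i] unfolding gen_g_eq by (auto simp: dd_commute[of j _ i])
qed

lemma left_invariance:
  "(\<Sum>k\<in>UNIV. rweyl_coeff (tvar i k) * dd j k) - (\<Sum>k\<in>UNIV. rweyl_coeff (tvar j k) * dd i k) \<in> I"
proof -
  have *: "gen_P (nat3 i) (nat3 j) \<in> I" if "nat3 i < nat3 j" for i j
    using gen_P[of "nat3 i" "nat3 j"] that exhaust_3[of i] exhaust_3[of j] by auto
  consider "i = j" | "nat3 i < nat3 j" | "nat3 j < nat3 i"
    by (metis nat3_inject linorder_neqE_nat)
  then show ?thesis
  proof cases
    case 1
    then show ?thesis by (simp add: zero_mem)
  next
    case 2
    then show ?thesis using * by (simp add: gen_P_eq)
  next
    case 3
    then show ?thesis using uminus_mem[OF *[OF 3]] by (simp add: gen_P_eq)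
  qed
qed

lemma det_mem: "ddet - 1 \<in> I"
  using uminus_mem[OF gen_d] by (simp add: gen_d_eq)

text \<open>Modulo the ideal the matrix of derivations is orthogonal of determinant 1, so it equals
  its cofactor matrix. The row relations are multiplied by cofactors from the left, and
  \<open>ddet - 1\<close> corrects the result.\<close>

lemma cof_mem: "dcof j b - dd j b \<in> I"
proof -
  have "dcof j b - dd j b = (\<Sum>i\<in>UNIV. dcof i b * ((if i = j then 1 else 0) - (\<Sum>a\<in>UNIV. dd i a * dd j a)))
      + dd j b * (ddet - 1)"
  proof -
    have "(\<Sum>i\<in>UNIV. dcof i b * (\<Sum>a\<in>UNIV. dd i a * dd j a)) = (\<Sum>a\<in>UNIV. (\<Sum>i\<in>UNIV. dcof i b * dd i a) * dd j a)"
      unfolding sum_distrib_left sum_distrib_right mult.assoc by (rule sum.swap)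
    also have "\<dots> = dd j b * ddet"
      by (simp add: dcof_column dd_ddet if_distribR if_distrib cong: if_cong)
    finally show ?thesis
      unfolding sum_mult_delta_diff by (simp add: right_diff_distrib)
  qed
  also have "\<dots> \<in> I"
    by (intro add_mem sum_mem mult_mem orthogonal_rows det_mem)
  finally show ?thesis .
qed

text \<open>In the expansion of \<open>ddet\<close> along a column, each cofactor may be replaced by
  the corresponding entry.\<close>

lemma orthogonal_columns: "(\<Sum>i\<in>UNIV. dd i a * dd i b) - (if a = b then 1 else 0) \<in> I"
proof -
  have "(\<Sum>i\<in>UNIV. dd i a * dd i b) - (if a = b then 1 else 0)
      = (if a = b then ddet - 1 else 0) - (\<Sum>i\<in>UNIV. dd i b * (dcof i a - dd i a))"
    using dcof_column[of a b] by (auto simp: right_diff_distrib sum_subtractf dd_dcof dd_commute[of _ a _ b])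
  also have "\<dots> \<in> I"
    by (intro diff_mem sum_mem mult_mem cof_mem) (simp add: det_mem zero_mem)
  finally show ?thesis .
qed

text \<open>Multiply the relations of left invariance by \<open>\<partial>\<^sub>j\<^sub>b\<close>, sum over \<open>j\<close>, and contract with the orthogonality of the columns. Doing the
  same once more with \<open>\<partial>\<^sub>i\<^sub>a\<close> yields right invariance.\<close>

lemma right_invariance_aux:
  "rweyl_coeff (tvar i b) - ((\<Sum>j\<in>UNIV. \<Sum>k\<in>UNIV. rweyl_coeff (tvar j k) * (dd j b * dd i k)) + 2 * dd i b) \<in> I"
proof -
  \<comment> \<open>Moving \<open>dd j b\<close> past the variables produces \<open>dd i b\<close>
    once in the first sum and once for each of the three \<open>j\<close> in the second; the net
    correction is the term \<open>2 * dd i b\<close> of the statement.\<close>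
  have L: "(\<Sum>j\<in>UNIV. dd j b * ((\<Sum>k\<in>UNIV. rweyl_coeff (tvar i k) * dd j k) - (\<Sum>k\<in>UNIV. rweyl_coeff (tvar j k) * dd i k)))
      = (\<Sum>k\<in>UNIV. rweyl_coeff (tvar i k) * (\<Sum>j\<in>UNIV. dd j b * dd j k)) + dd i b
       - ((\<Sum>j\<in>UNIV. \<Sum>k\<in>UNIV. rweyl_coeff (tvar j k) * (dd j b * dd i k)) + 3 * dd i b)" (is "?L = _")
  proof -
    have *: "dd j b * (rweyl_coeff (tvar l k) * x) = rweyl_coeff (tvar l k) * (dd j b * x) + (if j = l \<and> b = k then x else 0)" for j l k x
      by (simp add: dd_tvar algebra_simps flip: mult.assoc) (simp add: mult.assoc)?
    have "(\<Sum>j\<in>UNIV. \<Sum>k\<in>UNIV. rweyl_coeff (tvar i k) * (dd j b * dd j k)) = (\<Sum>k\<in>UNIV. rweyl_coeff (tvar i k) * (\<Sum>j\<in>UNIV. dd j b * dd j k))"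
      unfolding sum_distrib_left by (rule sum.swap)
    moreover have "(\<Sum>j\<in>UNIV. \<Sum>k\<in>UNIV. if j = i \<and> b = k then dd j k else 0) = dd i b"
    proof -
      have "(\<Sum>k\<in>UNIV. if j = i \<and> b = k then dd j k else 0) = (if j = i then dd i b else 0)" for j
        by (cases "j = i") simp_all
      then show ?thesis by simp
    qed
    moreover have "(\<Sum>j\<in>(UNIV::3 set). \<Sum>k\<in>UNIV. if b = k then dd i k else 0) = 3 * dd i b"
      by simp
    ultimately show ?thesis
      by (simp add: right_diff_distrib sum_subtractf sum_distrib_left * sum.distrib)
  qed
  have "(rweyl_coeff (tvar i b) - ((\<Sum>j\<in>UNIV. \<Sum>k\<in>UNIV. rweyl_coeff (tvar j k) * (dd j b * dd i k)) + 2 * dd i b))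
     = ?L - (\<Sum>k\<in>UNIV. rweyl_coeff (tvar i k) * ((\<Sum>j\<in>UNIV. dd j b * dd j k) - (if b = k then 1 else 0)))"
    unfolding sum_mult_delta_diff L three_mult by simp
  also have "\<dots> \<in> I"
    by (intro diff_mem sum_mem mult_mem left_invariance orthogonal_columns)
  finally show ?thesis .
qed

lemma right_invariance:
  "(\<Sum>i\<in>UNIV. rweyl_coeff (tvar i b) * dd i a) - (\<Sum>i\<in>UNIV. rweyl_coeff (tvar i a) * dd i b) \<in> I"
proof -
  have *: "dd i a * (rweyl_coeff (tvar j k) * x) = rweyl_coeff (tvar j k) * (dd i a * x) + (if i = j \<and> a = k then x else 0)" for i j k x
    by (simp add: dd_tvar algebra_simps flip: mult.assoc)
  let ?L = "\<Sum>i\<in>UNIV. dd i a * (rweyl_coeff (tvar i b) - ((\<Sum>j\<in>UNIV. \<Sum>k\<in>UNIV. rweyl_coeff (tvar j k) * (dd j b * dd i k)) + 2 * dd i b))"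
  have S: "(\<Sum>i\<in>UNIV. dd i a * (\<Sum>j\<in>UNIV. \<Sum>k\<in>UNIV. rweyl_coeff (tvar j k) * (dd j b * dd i k)))
      = (\<Sum>j\<in>UNIV. rweyl_coeff (tvar j a) * dd j b)
        + (\<Sum>j\<in>UNIV. \<Sum>k\<in>UNIV. rweyl_coeff (tvar j k) * dd j b * ((\<Sum>i\<in>UNIV. dd i a * dd i k) - (if a = k then 1 else 0)))
        + (\<Sum>i\<in>UNIV. dd i a * dd i b)" (is "?S = _")
  proof -
    have d: "(\<Sum>j\<in>UNIV. \<Sum>k\<in>UNIV. if i = j \<and> a = k then dd j b * dd i k else 0) = dd i a * dd i b" for i
    proof -
      have "(\<Sum>k\<in>UNIV. if i = j \<and> a = k then dd j b * dd i k else 0) = (if i = j then dd i b * dd i a else 0)" for j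
        by (cases "i = j") simp_all
      then show ?thesis by (simp add: dd_commute)
    qed
    have "(\<Sum>i\<in>UNIV. \<Sum>j\<in>UNIV. \<Sum>k\<in>UNIV. rweyl_coeff (tvar j k) * (dd j b * (dd i a * dd i k)))
        = (\<Sum>j\<in>UNIV. \<Sum>k\<in>UNIV. \<Sum>i\<in>UNIV. rweyl_coeff (tvar j k) * (dd j b * (dd i a * dd i k)))"
      by (subst sum.swap) (intro sum.cong refl sum.swap)
    then have e: "(\<Sum>i\<in>UNIV. \<Sum>j\<in>UNIV. \<Sum>k\<in>UNIV. rweyl_coeff (tvar j k) * (dd j b * (dd i a * dd i k)))
       = (\<Sum>j\<in>UNIV. \<Sum>k\<in>UNIV. rweyl_coeff (tvar j k) * dd j b * (\<Sum>i\<in>UNIV. dd i a * dd i k))"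
      by (simp add: sum_distrib_left mult.assoc)
    have "?S = (\<Sum>i\<in>UNIV. \<Sum>j\<in>UNIV. \<Sum>k\<in>UNIV. rweyl_coeff (tvar j k) * (dd j b * (dd i a * dd i k))) + (\<Sum>i\<in>UNIV. dd i a * dd i b)"
      by (simp add: sum_distrib_left * sum.distrib d dd_left_commute[of _ a])
    then show ?thesis
      unfolding e sum_mult_delta_diff sum_subtractf by simp
  qed
  have U: "(\<Sum>i\<in>UNIV. dd i a * rweyl_coeff (tvar i b)) = (\<Sum>i\<in>UNIV. rweyl_coeff (tvar i b) * dd i a) + 3 * (if a = b then 1 else 0)"
    by (simp add: dd_tvar sum.distrib)
  have L: "?L = (\<Sum>i\<in>UNIV. dd i a * rweyl_coeff (tvar i b)) - ?S - 2 * (\<Sum>i\<in>UNIV. dd i a * dd i b)"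
  proof -
    have "(\<Sum>i\<in>UNIV. dd i a * (2 * dd i b)) = 2 * (\<Sum>i\<in>UNIV. dd i a * dd i b)"
      by (simp add: mult_2 mult_2_right distrib_left sum.distrib)
    then show ?thesis by (simp add: right_diff_distrib distrib_left sum_subtractf sum.distrib)
  qed
  \<comment> \<open>The commutators contribute three times the Kronecker delta, which the column
    relation, taken three times, absorbs.\<close>
  have "(\<Sum>i\<in>UNIV. rweyl_coeff (tvar i b) * dd i a) - (\<Sum>i\<in>UNIV. rweyl_coeff (tvar i a) * dd i b)
      = ?L + (\<Sum>j\<in>UNIV. \<Sum>k\<in>UNIV. rweyl_coeff (tvar j k) * dd j b * ((\<Sum>i\<in>UNIV. dd i a * dd i k) - (if a = k then 1 else 0)))
        + 3 * ((\<Sum>i\<in>UNIV. dd i a * dd i b) - (if a = b then 1 else 0))"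
    unfolding L S U three_mult right_diff_distrib[of 2] by simp
  also have "\<dots> \<in> I"
    by (intro add_mem sum_mem mult_mem right_invariance_aux orthogonal_columns)
  finally show ?thesis .
qed

end

section \<open>Genericity of the matrix of variables\<close>

definition ring_hom_fun :: "('a::comm_ring_1 \<Rightarrow> 'b::comm_ring_1) \<Rightarrow> bool" where
  "ring_hom_fun h \<longleftrightarrow> h 1 = 1 \<and> (\<forall>a b. h (a + b) = h a + h b) \<and> (\<forall>a b. h (a * b) = h a * h b)"

lemma ring_hom_funD:
  assumes "ring_hom_fun h"
  shows "h 1 = 1" "h (a + b) = h a + h b" "h (a * b) = h a * h b" "h 0 = 0" "h (- a) = - h a" "h (a - b) = h a - h b"
    "h (numeral n) = numeral n" "h (a ^ k) = h a ^ k"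
proof -
  show 1: "h 1 = 1" and add: "h (a + b) = h a + h b" and mult: "h (a * b) = h a * h b" for a b
    using assms by (auto simp: ring_hom_fun_def)
  show 0: "h 0 = 0" using add[of 0 0] by simp
  show neg: "h (- a) = - h a" for a using add[of a "- a"] by (simp add: 0 eq_neg_iff_add_eq_0 add.commute)
  show "h (a - b) = h a - h b" using add[of a "- b"] by (simp add: neg)
  show "h (numeral n) = numeral n"
    by (induction n) (simp_all only: numeral.simps add 1)
  show "h (a ^ k) = h a ^ k" by (induction k) (simp_all add: 1 mult)
qed

definition map_matrix :: "('a \<Rightarrow> 'b) \<Rightarrow> 'a^3^3 \<Rightarrow> 'b^3^3" where
  "map_matrix h A = (\<chi> i j. h (A $ i $ j))"

lemma map_matrix_hom:
  assumes "ring_hom_fun h"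
  shows "map_matrix h (A ** B) = map_matrix h A ** map_matrix h B"
    "map_matrix h (transpose A) = transpose (map_matrix h A)"
    "det (map_matrix h A) = h (det A)" "inv1 (map_matrix h A) = h (inv1 A)" "inv2 (map_matrix h A) = h (inv2 A)"
proof -
  note h = ring_hom_funD[OF assms]
  show "map_matrix h (A ** B) = map_matrix h A ** map_matrix h B"
    by (simp add: map_matrix_def vec_eq_iff matrix_mult_3 h)
  show "map_matrix h (transpose A) = transpose (map_matrix h A)"
    by (simp add: map_matrix_def vec_eq_iff transpose_def)
  show "det (map_matrix h A) = h (det A)"
    by (simp add: map_matrix_def det_3 h)
  show "inv1 (map_matrix h A) = h (inv1 A)" "inv2 (map_matrix h A) = h (inv2 A)"
    by (simp_all add: map_matrix_def inv1_def inv2_def h)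
qed

text \<open>One polynomial in the entries that gathers all quantities required to be nonzero. The
  vector \<open>1\<close> is the all-ones vector, used as cyclic vector.\<close>

definition genericity :: "'a::comm_ring_1^3^3 \<Rightarrow> 'a" where
  "genericity A = det A * det (krylov (A ** transpose A) 1)
     * cubic_disc (inv1 (A ** transpose A)) (inv2 (A ** transpose A)) (det (A ** transpose A))"

lemma genericity_map_matrix:
  assumes "ring_hom_fun h"
  shows "h (genericity A) = genericity (map_matrix h A)"
proof -
  note h = ring_hom_funD[OF assms]
  have "map_matrix h (krylov A 1) = krylov (map_matrix h A) 1" for A
    by (simp add: map_matrix_def krylov_def vec_eq_iff matrix_vector_mult_3 h)
  then show ?thesis
    by (simp add: genericity_def cubic_disc_def h flip: map_matrix_hom[OF assms])
qed

definition insertion :: "('v::finite \<Rightarrow> complex) \<Rightarrow> 'v mpoly \<Rightarrow> complex" where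
  "insertion x p = (\<Sum>m\<in>Poly_Mapping.keys p. Poly_Mapping.lookup p m * (\<Prod>v\<in>UNIV. x v ^ Poly_Mapping.lookup m v))"

lemma insertion_single:
  "insertion x (Poly_Mapping.single m c) = c * (\<Prod>v\<in>UNIV. x v ^ Poly_Mapping.lookup m v)"
  by (cases "c = 0") (simp_all add: insertion_def)

lemma insertion_add: "insertion x (p + q) = insertion x p + insertion x q"
  unfolding insertion_def by (rule setsum_keys_plus_distrib) (simp_all add: algebra_simps)

lemma insertion_mult: "insertion x (p * q) = insertion x p * insertion x q"
proof (induction p rule: poly_mapping_add_induct)
  case (single k a)
  show ?case
    by (induction q rule: poly_mapping_add_induct)
      (simp_all add: mult_single insertion_single insertion_add lookup_add power_add prod.distrib algebra_simps)
qed (simp add: insertion_add algebra_simps)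

lemma ring_hom_insertion: "ring_hom_fun (insertion x)"
  using insertion_single[of x 0 1] by (simp add: ring_hom_fun_def insertion_add insertion_mult)

lemma ring_hom_Fract: "ring_hom_fun (\<lambda>p :: 'a::idom. Fract p 1)"
  by (simp add: ring_hom_fun_def One_fract_def)

definition Tm :: "9 ratfun^3^3" where
  "Tm = (\<chi> i j. tvar i j)"

text \<open>A polynomial is nonzero if one of its values is. The chosen point is diag(1, 2, 3),
  where S has eigenvalues 1, 4, 9 and the Krylov determinant is a Vandermonde determinant.\<close>

lemma genericity_Tm: "genericity Tm \<noteq> 0"
proof
  let ?P = "(\<chi> i j. Poly_Mapping.single (Poly_Mapping.single (entry (nat3 i) (nat3 j)) 1) 1) :: 9 mpoly^3^3"
  let ?x = "\<lambda>v. if v = entry (nat3 1) (nat3 1) then 1 else if v = entry (nat3 2) (nat3 2) then 2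
    else if v = entry (nat3 3) (nat3 3) then 3 else 0 :: complex"
  have "Tm = map_matrix (\<lambda>p. Fract p 1) ?P"
    by (simp add: Tm_def map_matrix_def tvar_def)
  moreover assume "genericity Tm = 0"
  ultimately have "Fract (genericity ?P) 1 = 0"
    by (simp add: genericity_map_matrix[OF ring_hom_Fract])
  then have "genericity ?P = 0"
    by (simp add: Zero_fract_def eq_fract)
  then have "genericity (map_matrix (insertion ?x) ?P) = 0"
    by (simp add: ring_hom_funD[OF ring_hom_insertion] flip: genericity_map_matrix[OF ring_hom_insertion])
  moreover have "insertion ?x (Poly_Mapping.single (Poly_Mapping.single w 1) 1) = ?x w" for w
  proof -
    have "(\<Prod>v\<in>UNIV. ?x v ^ Poly_Mapping.lookup (Poly_Mapping.single w 1) v) = (\<Prod>v\<in>UNIV. if v = w then ?x v else 1)"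
      by (rule prod.cong) (simp_all add: lookup_single when_def)
    then show ?thesis by (simp add: insertion_single)
  qed
  then have "map_matrix (insertion ?x) ?P = (\<chi> i j. if i = j then of_nat (nat3 i) else 0)"
    unfolding vec_eq_iff forall_3 by (simp add: map_matrix_def entry_eq_iff del: nat3_simps) simp
  moreover have "genericity ((\<chi> i j. if i = j then of_nat (nat3 i) else 0) :: complex^3^3) \<noteq> 0" (is "genericity ?A \<noteq> 0")
  proof -
    have "?A ** transpose ?A = (\<chi> i j. if i = j then of_nat (nat3 i ^ 2) else 0)" (is "_ = ?S")
      by (simp add: vec_eq_iff forall_3 matrix_mult_3 transpose_def)
    moreover have "det ?A = 6" by (simp add: det_3)
    moreover have "det (krylov ?S 1) = 120"
      by (simp add: krylov_def det_3 matrix_vector_mult_3)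
    moreover have "inv1 ?S = 14" "inv2 ?S = 49" "det ?S = 36"
      by (simp_all add: inv1_def inv2_def det_3)
    ultimately show ?thesis by (simp add: genericity_def cubic_disc_def)
  qed
  ultimately show False by simp
qed

global_interpretation gm: generic_matrix Tm 1
  using genericity_Tm by unfold_locales (auto simp: genericity_def)

section \<open>The upper bound\<close>

lemma functional_sum:
  fixes l :: "'a::ab_group_add \<Rightarrow> 'b::ab_group_add"
  assumes add: "\<And>y z. l (y + z) = l y + l z"
  shows "l 0 = 0" "l (sum f A) = (\<Sum>i\<in>A. l (f i))" "l (y - z) = l y - l z"
proof -
  show 0: "l 0 = 0" using add[of 0 0] by simp
  show "l (sum f A) = (\<Sum>i\<in>A. l (f i))"
    by (induction A rule: infinite_finite_induct) (simp_all add: add 0)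
  show "l (y - z) = l y - l z" using add[of "y - z" z] by simp
qed

text \<open>Modulo the ideal, \<open>frame_op c\<close> is the coefficient of \<open>S\<^sup>c\<^sup>-\<^sup>1 T\<close> in the matrix of the \<open>\<partial>\<^sub>i\<^sub>j\<close>.\<close>

definition frame_op :: "3 \<Rightarrow> 9 rweyl" where
  "frame_op c = (\<Sum>i\<in>UNIV. \<Sum>j\<in>UNIV. rweyl_coeff (gm.coeff_coord c i j) * dd i j)"

definition basis_op :: "nat \<Rightarrow> 9 rweyl" where
  "basis_op n = (if n = 0 then 1 else if n = 1 then frame_op 1 else if n = 2 then frame_op 2 else frame_op 3)"

lemma sum_lessThan_4: "(\<Sum>n<4::nat. f n) = f 0 + f 1 + f 2 + f 3"
proof -
  have "{..<4} = {0, 1, 2, 3::nat}" by auto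
  then show ?thesis by (simp add: add.assoc)
qed

context rotation_ideal
begin

definition basis_span :: "9 rweyl set" where
  "basis_span = {x. \<exists>c. x - (\<Sum>n<4. rweyl_coeff (c n) * basis_op n) \<in> I}"

lemma basis_spanI: "x - (\<Sum>n<4. rweyl_coeff (c n) * basis_op n) \<in> I \<Longrightarrow> x \<in> basis_span"
  unfolding basis_span_def by blast

lemma ideal_subset_basis_span: "x \<in> I \<Longrightarrow> x \<in> basis_span"
  by (rule basis_spanI[of _ "\<lambda>_. 0"]) (simp add: rweyl_coeff_hom)

lemma basis_span_add:
  assumes "x \<in> basis_span" "y \<in> basis_span"
  shows "x + y \<in> basis_span"
proof -
  obtain c d where c: "x - (\<Sum>n<4. rweyl_coeff (c n) * basis_op n) \<in> I"
    and d: "y - (\<Sum>n<4. rweyl_coeff (d n) * basis_op n) \<in> I"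
    using assms unfolding basis_span_def by blast
  show ?thesis
    by (rule basis_spanI[of _ "\<lambda>n. c n + d n"])
      (use add_mem[OF c d] in \<open>simp add: rweyl_coeff_hom distrib_right sum.distrib algebra_simps\<close>)
qed

lemma basis_span_smult:
  assumes "x \<in> basis_span"
  shows "rweyl_coeff a * x \<in> basis_span"
proof -
  obtain c where c: "x - (\<Sum>n<4. rweyl_coeff (c n) * basis_op n) \<in> I"
    using assms unfolding basis_span_def by blast
  show ?thesis
    by (rule basis_spanI[of _ "\<lambda>n. a * c n"])
      (use mult_mem[OF c, of "rweyl_coeff a"] in
        \<open>simp add: rweyl_coeff_hom right_diff_distrib sum_distrib_left mult.assoc\<close>)
qed

lemma basis_span_sum: "(\<And>i. i \<in> A \<Longrightarrow> f i \<in> basis_span) \<Longrightarrow> sum f A \<in> basis_span"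
  by (induction A rule: infinite_finite_induct)
    (auto intro: basis_span_add ideal_subset_basis_span zero_mem)

lemma basis_op_mem: "m < 4 \<Longrightarrow> basis_op m \<in> basis_span"
  by (rule basis_spanI[of _ "\<lambda>n. if n = m then 1 else 0"])
    (simp add: rweyl_coeff_hom if_distrib if_distribR zero_mem cong: if_cong)

lemma one_mem: "1 \<in> basis_span"
  using basis_op_mem[of 0] by (simp add: basis_op_def)

lemma frame_op_mem: "frame_op c \<in> basis_span"
  using basis_op_mem[of 1] basis_op_mem[of 2] basis_op_mem[of 3] exhaust_3[of c]
  by (auto simp: basis_op_def)

lemma basis_span_functional:
  assumes "x \<notin> basis_span"
  obtains l :: "9 rweyl \<Rightarrow> 9 ratfun" where "\<And>y z. l (y + z) = l y + l z"
    "\<And>c y. l (rweyl_coeff c * y) = c * l y" "\<And>y. y \<in> basis_span \<Longrightarrow> l y = 0" "l x \<noteq> 0"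
  using rweyl_coeff_functional[of basis_span x] assms
  by (auto intro: basis_span_add basis_span_smult ideal_subset_basis_span zero_mem)

text \<open>A functional that kills the span turns the matrix of the \<open>dd i j\<close> into a
  matrix over K that satisfies both invariance conditions and has zero coordinates, hence
  vanishes.\<close>

lemma dd_mem: "dd i j \<in> basis_span"
proof (rule ccontr)
  assume "dd i j \<notin> basis_span"
  then obtain l where l: "\<And>y z. l (y + z) = l y + l z" "\<And>c y. l (rweyl_coeff c * y) = c * l y"
      "\<And>y. y \<in> basis_span \<Longrightarrow> l y = 0" "l (dd i j) \<noteq> 0"
    by (rule basis_span_functional) blast
  note ls = functional_sum[of l, OF l(1)]
  define X where "X = (\<chi> i j. l (dd i j))"
  have "gm.symmetric_pair X"
    using l(3)[OF ideal_subset_basis_span[OF left_invariance]] l(3)[OF ideal_subset_basis_span[OF right_invariance]]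
    unfolding gm.symmetric_pair_iff by (simp add: ls l(2) X_def Tm_def mult.commute)
  moreover have "gm.coord X $ c = 0" for c
    using l(3)[OF frame_op_mem[of c]]
    by (simp add: gm.coord_eq_sum frame_op_def ls l(2) X_def)
  ultimately have "X $ i $ j = 0" by (simp add: gm.symmetric_pair_expand)
  then show False using l(4) by (simp add: X_def)
qed

text \<open>A functional that kills the ideal and all operators of order at most one sees only the symbols of the
  second order relations.\<close>

lemma dd_dd_mem: "dd i j * dd k m \<in> basis_span"
proof (rule ccontr)
  assume "dd i j * dd k m \<notin> basis_span"
  then obtain l where l: "\<And>y z. l (y + z) = l y + l z" "\<And>c y. l (rweyl_coeff c * y) = c * l y"
      "\<And>y. y \<in> basis_span \<Longrightarrow> l y = 0" "l (dd i j * dd k m) \<noteq> 0"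
    by (rule basis_span_functional) blast
  note ls = functional_sum[of l, OF l(1)]
  have ld: "l (dd i j) = 0" for i j using l(3) dd_mem by simp
  have lI: "l y = 0" if "y \<in> I" for y using that l(3) ideal_subset_basis_span by simp
  \<comment> \<open>The commutator of \<open>dd i j\<close> with \<open>tvar a b\<close> leaves
    \<open>dd c d\<close> or zero, which \<open>l\<close> kills.\<close>
  have move: "l (dd i j * (rweyl_coeff (tvar a b) * dd c d)) = tvar a b * l (dd i j * dd c d)" for i j a b c d
    by (simp add: dd_tvar distrib_right l(1,2) ld ls(1) mult.assoc flip: mult.assoc[of "dd i j"])
  have "l (dd i j * dd k m) = 0"
  proof (rule gm.symmetric_tensor_zero[of "\<lambda>i j k m. l (dd i j * dd k m)"])
    show "l (dd i j * dd k m) = l (dd k m * dd i j)" for i j k m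
      by (simp add: dd_commute)
    show "gm.symmetric_pair (\<chi> k m. l (dd i j * dd k m))" for i j
      using lI[OF mult_mem[OF left_invariance, of "dd i j"]] lI[OF mult_mem[OF right_invariance, of "dd i j"]]
      unfolding gm.symmetric_pair_iff
      by (simp add: right_diff_distrib sum_distrib_left ls move Tm_def mult.commute)
    show "(\<Sum>k\<in>UNIV. l (dd i k * dd j k)) = 0" for i j
    proof -
      have "l (if i = j then 1 else 0) = 0" using l(3)[OF one_mem] by (simp add: ls)
      then show ?thesis using lI[OF orthogonal_rows[of i j]] by (simp add: ls)
    qed
    show "l (dd (i + 1) (j + 1) * dd (i + 2) (j + 2)) - l (dd (i + 1) (j + 2) * dd (i + 2) (j + 1)) = 0" for i j
      using lI[OF cof_mem[of i j]] by (simp add: dcof_def ls ld)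
    show "cubic_disc (inv1 gm.S) (inv2 gm.S) (det gm.S) \<noteq> 0"
      using genericity_Tm by (simp add: genericity_def gm.S_def)
  qed
  then show False using l(4) by simp
qed

lemma dd_mult_basis_op: "dd i j * basis_op n \<in> basis_span"
proof -
  have "dd i j * frame_op c \<in> basis_span" for c
    unfolding frame_op_def sum_distrib_left mult.assoc[symmetric] dd_coeff
    by (intro basis_span_sum)
      (simp add: distrib_right mult.assoc basis_span_add basis_span_smult dd_mem dd_dd_mem)
  then show ?thesis by (simp add: basis_op_def dd_mem)
qed

text \<open>The span contains 1 and is stable under left multiplication by coefficients and
  derivations. This bounds the rank by four.\<close>

lemma basis_span_UNIV: "x \<in> basis_span"
proof (rule rweyl_generated)
  fix v x assume "x \<in> basis_span"
  then obtain c where c: "x - (\<Sum>n<4. rweyl_coeff (c n) * basis_op n) \<in> I" (is "x - ?y \<in> I")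
    unfolding basis_span_def by blast
  obtain i j where v: "v = entry (nat3 i) (nat3 j)" by (rule entry_cases)
  have "dd i j * (x - ?y) \<in> basis_span"
    using mult_mem[OF c] ideal_subset_basis_span by simp
  moreover have "dd i j * ?y \<in> basis_span"
    unfolding sum_distrib_left mult.assoc[symmetric] dd_coeff
    by (intro basis_span_sum)
      (simp add: distrib_right mult.assoc basis_span_add basis_span_smult dd_mult_basis_op basis_op_mem)
  ultimately have "dd i j * (x - ?y) + dd i j * ?y \<in> basis_span" by (rule basis_span_add)
  then have "dd i j * x \<in> basis_span" by (simp add: right_diff_distrib)
  then show "rweyl_diff v * x \<in> basis_span" by (simp add: v dd_def d_op_def)
qed (auto intro: basis_span_add basis_span_smult one_mem)

end

section \<open>Actions of the rational Weyl algebra and twisted derivations\<close>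

lemma sum_mem_closed:
  assumes "0 \<in> W" "\<And>x y. x \<in> W \<Longrightarrow> y \<in> W \<Longrightarrow> x + y \<in> W" "\<And>i. i \<in> A \<Longrightarrow> f i \<in> W"
  shows "sum f A \<in> W"
  using assms(3) by (induction A rule: infinite_finite_induct) (auto intro: assms(1,2))

text \<open>A left module over R, presented as a K-vector space with a flat connection: commuting
  operators that obey the Leibniz rule.\<close>

locale weyl_action =
  fixes sc :: "'v::{finite,linorder} ratfun \<Rightarrow> 'm::ab_group_add \<Rightarrow> 'm" and N :: "'v \<Rightarrow> 'm \<Rightarrow> 'm"
  assumes sc_add_left: "sc (a + b) m = sc a m + sc b m"
    and sc_add_right: "sc a (m + n) = sc a m + sc a n"
    and sc_mult: "sc (a * b) m = sc a (sc b m)"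
    and sc_one: "sc 1 m = m"
    and N_add: "N v (m + n) = N v m + N v n"
    and N_sc: "N v (sc a m) = sc (ratfun_diff v a) m + sc a (N v m)"
    and N_commute: "N v (N w m) = N w (N v m)"
begin

lemma sc_zero: "sc 0 m = 0" "sc a 0 = 0"
  using sc_add_left[of 0 0 m] sc_add_right[of a 0 0] by simp_all

definition nf_act :: "(('v \<Rightarrow>\<^sub>0 nat) \<Rightarrow>\<^sub>0 'v ratfun) \<Rightarrow> 'm \<Rightarrow> 'm" where
  "nf_act p m = (\<Sum>\<alpha>\<in>Poly_Mapping.keys p. sc (Poly_Mapping.lookup p \<alpha>) (monom_act N \<alpha> m))"

lemma nf_act_single: "nf_act (Poly_Mapping.single \<alpha> a) m = sc a (monom_act N \<alpha> m)"
  by (cases "a = 0") (simp_all add: nf_act_def sc_zero)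

lemma nf_act_add: "nf_act (p + q) m = nf_act p m + nf_act q m"
  unfolding nf_act_def by (rule setsum_keys_plus_distrib) (simp_all add: sc_zero sc_add_left)

lemmas monom_act_N_add = monom_act_add[of N, OF N_commute]

lemma monom_act_N_plus: "monom_act N \<alpha> (m + n) = monom_act N \<alpha> m + monom_act N \<alpha> n"
  by (induction \<alpha> rule: exponent_induct) (simp_all add: monom_act_N_add N_add)

lemma nf_act_smult: "nf_act (Poly_Mapping.single 0 a * q) m = sc a (nf_act q m)"
  by (induction q rule: poly_mapping_add_induct)
    (simp_all add: mult_single nf_act_single sc_mult distrib_left nf_act_add sc_add_right)

lemma nf_act_nf_diff: "nf_act (nf_diff v q) m = N v (nf_act q m)"
  by (induction q rule: poly_mapping_add_induct)
    (simp_all add: nf_diff_single nf_diff_add nf_act_add nf_act_single N_sc N_add monom_act_N_add)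

lemma nf_act_nf_times: "nf_act (nf_times p q) m = nf_act p (nf_act q m)"
proof (induction p rule: poly_mapping_add_induct)
  case (single \<alpha> a)
  have "nf_act (monom_act nf_diff \<alpha> q) m = monom_act N \<alpha> (nf_act q m)"
    by (induction \<alpha> rule: exponent_induct)
      (simp_all add: monom_act_nf_add monom_act_N_add nf_act_nf_diff)
  then show ?case by (simp add: nf_times_single nf_act_smult nf_act_single)
next
  case (add p q)
  then show ?case by (simp add: nf_times_add_left nf_act_add)
qed

definition act :: "'v rweyl \<Rightarrow> 'm \<Rightarrow> 'm" where
  "act P m = nf_act (normal_form P) m"

lemma act_add: "act (P + Q) m = act P m + act Q m"
  by (simp add: act_def plus_rweyl.rep_eq nf_act_add)

lemma act_zero: "act 0 m = 0"
  using act_add[of 0 0 m] by simp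

lemma act_uminus: "act (- P) m = - act P m"
  using act_add[of P "- P" m] by (simp add: act_zero eq_neg_iff_add_eq_0 add.commute)

lemma act_diff: "act (P - Q) m = act P m - act Q m"
  using act_add[of P "- Q" m] by (simp add: act_uminus)

lemma act_sum: "act (sum f A) m = (\<Sum>i\<in>A. act (f i) m)"
  by (induction A rule: infinite_finite_induct) (simp_all add: act_add act_zero)

lemma act_mult: "act (P * Q) m = act P (act Q m)"
  by (simp add: act_def times_rweyl.rep_eq nf_act_nf_times)

lemma act_coeff: "act (rweyl_coeff a) m = sc a m"
  by (simp add: act_def rweyl_coeff_def Abs_rweyl_inverse nf_act_single)

lemma act_rweyl_diff: "act (rweyl_diff v) m = N v m"
  using monom_act_N_add[of 0 v m]
  by (simp add: act_def rweyl_diff_def Abs_rweyl_inverse nf_act_single sc_one)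

lemma act_one: "act 1 m = m"
  using act_coeff[of 1 m] by (simp add: rweyl_coeff_hom sc_one)

text \<open>\<open>W\<close> is a submodule, and the set is the annihilator of the class of
  \<open>m\<close> modulo \<open>W\<close>.\<close>

lemma left_ideal_annihilator:
  assumes W: "0 \<in> W" "\<And>x y. x \<in> W \<Longrightarrow> y \<in> W \<Longrightarrow> x + y \<in> W" "\<And>a x. x \<in> W \<Longrightarrow> sc a x \<in> W"
    "\<And>v x. x \<in> W \<Longrightarrow> N v x \<in> W"
  shows "left_ideal UNIV {P. act P m \<in> W}"
proof -
  have "act P x \<in> W" if "x \<in> W" for P x
  proof -
    have mono: "monom_act N \<alpha> x \<in> W" for \<alpha>
      by (induction \<alpha> rule: exponent_induct) (simp_all add: monom_act_N_add W that)
    show ?thesis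
      unfolding act_def nf_act_def
      using mono W by (intro sum_mem_closed) auto
  qed
  then show ?thesis
    by (auto simp: left_ideal_def act_zero act_add act_mult W)
qed

end

section \<open>Derivations and their extension to fractions and polynomials\<close>

definition derivation :: "('a::comm_ring_1 \<Rightarrow> 'a) \<Rightarrow> bool" where
  "derivation \<delta> \<longleftrightarrow> (\<forall>a b. \<delta> (a + b) = \<delta> a + \<delta> b) \<and> (\<forall>a b. \<delta> (a * b) = \<delta> a * b + a * \<delta> b)"

lemma derivationD:
  assumes "derivation \<delta>"
  shows "\<delta> (a + b) = \<delta> a + \<delta> b" "\<delta> (a * b) = \<delta> a * b + a * \<delta> b" "\<delta> 0 = 0" "\<delta> 1 = 0" "\<delta> (- a) = - \<delta> a"
    "\<delta> (a - b) = \<delta> a - \<delta> b" "\<delta> (numeral n) = 0"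
proof -
  show add: "\<delta> (a + b) = \<delta> a + \<delta> b" and mult: "\<delta> (a * b) = \<delta> a * b + a * \<delta> b" for a b
    using assms by (auto simp: derivation_def)
  show 0: "\<delta> 0 = 0" using add[of 0 0] by simp
  show 1: "\<delta> 1 = 0" using mult[of 1 1] by simp
  show neg: "\<delta> (- a) = - \<delta> a" for a using add[of a "- a"] by (simp add: 0 eq_neg_iff_add_eq_0 add.commute)
  show "\<delta> (a - b) = \<delta> a - \<delta> b" using add[of a "- b"] by (simp add: neg)
  show "\<delta> (numeral n) = 0" by (induction n) (simp_all only: numeral.simps add 1 add_0)
qed

lemma derivation_divide:
  fixes a b :: "'a::field"
  assumes "derivation \<delta>" "b \<noteq> 0"
  shows "\<delta> (a / b) = (\<delta> a * b - a * \<delta> b) / (b * b)"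
proof -
  have "\<delta> a = \<delta> (a / b) * b + a / b * \<delta> b"
    using derivationD(2)[OF assms(1), of "a / b" b] assms(2) by simp
  then have "\<delta> (a / b) * b = \<delta> a - a / b * \<delta> b" by simp
  then show ?thesis using assms(2) by (simp add: field_simps)
qed

text \<open>The quotient rule for a chosen representation; independence of the choice rests on
  \<delta> being a derivation and is the content of \<open>fract_deriv_Fract\<close>.\<close>

definition fract_deriv :: "('a::idom \<Rightarrow> 'a) \<Rightarrow> 'a fract \<Rightarrow> 'a fract" where
  "fract_deriv \<delta> f = (SOME g. \<exists>a b. b \<noteq> 0 \<and> f = Fract a b \<and> g = Fract (\<delta> a * b - a * \<delta> b) (b * b))"

lemma fract_deriv_Fract:
  assumes d: "derivation \<delta>" and b: "b \<noteq> 0"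
  shows "fract_deriv \<delta> (Fract a b) = Fract (\<delta> a * b - a * \<delta> b) (b * b)"
  unfolding fract_deriv_def
proof (rule some_equality)
  show "\<exists>c e. e \<noteq> 0 \<and> Fract a b = Fract c e \<and> Fract (\<delta> a * b - a * \<delta> b) (b * b) = Fract (\<delta> c * e - c * \<delta> e) (e * e)"
    using b by blast
  fix g assume "\<exists>c e. e \<noteq> 0 \<and> Fract a b = Fract c e \<and> g = Fract (\<delta> c * e - c * \<delta> e) (e * e)"
  then obtain c e where e: "e \<noteq> 0" "Fract a b = Fract c e" and g: "g = Fract (\<delta> c * e - c * \<delta> e) (e * e)"
    by blast
  have eq: "a * e = c * b" using e b by (simp add: eq_fract)
  then have "\<delta> (a * e) = \<delta> (c * b)" by simp
  then have "\<delta> a * e + a * \<delta> e = \<delta> c * b + c * \<delta> b"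
    by (simp only: derivationD[OF d])
  \<comment> \<open>The two cross-multiplied quotients differ by a combination of
    \<open>a * e = c * b\<close> and its derivative.\<close>
  moreover have "(\<delta> a * b - a * \<delta> b) * (e * e) - (\<delta> c * e - c * \<delta> e) * (b * b)
    = b * e * ((\<delta> a * e + a * \<delta> e) - (\<delta> c * b + c * \<delta> b)) + (\<delta> b * e + \<delta> e * b) * (c * b - a * e)"
    by (simp add: algebra_simps)
  ultimately have "(\<delta> a * b - a * \<delta> b) * (e * e) = (\<delta> c * e - c * \<delta> e) * (b * b)"
    using eq by simp
  then show "g = Fract (\<delta> a * b - a * \<delta> b) (b * b)"
    using b e by (simp add: g eq_fract)
qed

lemma fract_deriv_Fract_1: "derivation \<delta> \<Longrightarrow> fract_deriv \<delta> (Fract a 1) = Fract (\<delta> a) 1"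
  by (simp add: fract_deriv_Fract derivationD)

lemma derivation_fract_deriv:
  assumes d: "derivation \<delta>"
  shows "derivation (fract_deriv \<delta>)"
  unfolding derivation_def
proof (intro conjI allI)
  fix f g :: "'a fract"
  show "fract_deriv \<delta> (f + g) = fract_deriv \<delta> f + fract_deriv \<delta> g"
    by (cases f, cases g)
      (simp add: fract_deriv_Fract[OF d] eq_fract derivationD[OF d] algebra_simps)
  show "fract_deriv \<delta> (f * g) = fract_deriv \<delta> f * g + f * fract_deriv \<delta> g"
    by (cases f, cases g)
      (simp add: fract_deriv_Fract[OF d] eq_fract derivationD[OF d] algebra_simps)
qed

text \<open>The commutator of two derivations is a derivation. As it vanishes on numerators and
  denominators, it vanishes on quotients.\<close>

lemma fract_deriv_commute:
  assumes d: "derivation \<delta>" "derivation \<epsilon>" and comm: "\<And>a. \<delta> (\<epsilon> a) = \<epsilon> (\<delta> a)"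
  shows "fract_deriv \<delta> (fract_deriv \<epsilon> f) = fract_deriv \<epsilon> (fract_deriv \<delta> f)"
proof (cases f)
  case (Fract a b)
  note dd = derivationD[OF derivation_fract_deriv[OF d(1)]] derivationD[OF derivation_fract_deriv[OF d(2)]]
  let ?C = "\<lambda>f. fract_deriv \<delta> (fract_deriv \<epsilon> f) - fract_deriv \<epsilon> (fract_deriv \<delta> f)"
  have "f * Fract b 1 = Fract a 1"
    using Fract by (simp add: eq_fract)
  then have "?C (f * Fract b 1) = 0"
    by (simp add: fract_deriv_Fract_1 d comm)
  moreover have "?C (f * Fract b 1) = ?C f * Fract b 1 + f * ?C (Fract b 1)"
    by (simp add: dd algebra_simps)
  moreover have "?C (Fract b 1) = 0"
    by (simp add: fract_deriv_Fract_1 d comm)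
  moreover have "Fract b 1 \<noteq> 0"
    using Fract by (simp add: Zero_fract_def eq_fract)
  ultimately show ?thesis by simp
qed

lemma derivation_pderiv: "derivation (pderiv :: 'a::idom poly \<Rightarrow> 'a poly)"
  by (simp add: derivation_def pderiv_add pderiv_mult algebra_simps)

lemma derivation_map_poly:
  assumes "derivation \<delta>"
  shows "derivation (map_poly \<delta>)"
proof -
  note d = derivationD[OF assms]
  have sum: "\<delta> (sum f A) = (\<Sum>i\<in>A. \<delta> (f i))" for f and A :: "nat set"
    by (induction A rule: infinite_finite_induct) (simp_all add: d)
  show ?thesis
    unfolding derivation_def
    by (auto simp: poly_eq_iff coeff_map_poly d coeff_mult sum sum.distrib)
qed

lemma map_poly_pderiv_commute:
  assumes "derivation \<delta>"
  shows "map_poly \<delta> (pderiv p) = pderiv (map_poly \<delta> p)"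
proof -
  note d = derivationD[OF assms]
  have nat: "\<delta> (of_nat n) = 0" for n by (induction n) (simp_all add: d)
  show ?thesis by (simp add: poly_eq_iff coeff_map_poly coeff_pderiv d nat del: of_nat_Suc)
qed

lemma map_poly_commute:
  assumes "derivation \<delta>" "derivation \<epsilon>" "\<And>a. \<delta> (\<epsilon> a) = \<epsilon> (\<delta> a)"
  shows "map_poly \<delta> (map_poly \<epsilon> p) = map_poly \<epsilon> (map_poly \<delta> p)"
  using assms by (simp add: poly_eq_iff coeff_map_poly derivationD)

text \<open>The derivation \<open>\<delta>\<close> conjugated by \<open>1 / sqrt u\<close>.\<close>

definition twist :: "'a::field \<Rightarrow> ('a \<Rightarrow> 'a) \<Rightarrow> 'a \<Rightarrow> 'a" where
  "twist u \<delta> f = \<delta> f - \<delta> u / (2 * u) * f"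

lemma twist_add: "derivation \<delta> \<Longrightarrow> twist u \<delta> (f + g) = twist u \<delta> f + twist u \<delta> g"
  by (simp add: twist_def derivationD distrib_left)

lemma twist_mult: "derivation \<delta> \<Longrightarrow> twist u \<delta> (a * f) = \<delta> a * f + a * twist u \<delta> f"
  by (simp add: twist_def derivationD algebra_simps)

lemma twist_one: "derivation \<delta> \<Longrightarrow> twist u \<delta> 1 = - \<delta> u / (2 * u)"
  by (simp add: twist_def derivationD)

text \<open>This is sqrt u times the second derivative of 1 / sqrt u, the form in which second order
  operators meet \<open>u\<close>.\<close>

lemma twist_twist_one:
  fixes u :: "'a::field_char_0"
  assumes "derivation \<delta>" "derivation \<epsilon>" "u \<noteq> 0"
  shows "twist u \<delta> (twist u \<epsilon> 1) = (3 * \<delta> u * \<epsilon> u - 2 * u * \<delta> (\<epsilon> u)) / (4 * u * u)"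
proof -
  have "\<delta> (- \<epsilon> u / (2 * u)) = (\<delta> (- \<epsilon> u) * (2 * u) + \<epsilon> u * \<delta> (2 * u)) / (2 * u * (2 * u))"
    by (subst derivation_divide) (use assms in simp_all)
  then show ?thesis
    unfolding twist_one[OF assms(2)] unfolding twist_def
    using assms(3) by (simp add: derivationD[OF assms(1)] field_simps)
qed

lemma twist_commute:
  fixes u :: "'a::field_char_0"
  assumes d: "derivation \<delta>" "derivation \<epsilon>" and u: "u \<noteq> 0" and comm: "\<And>a. \<delta> (\<epsilon> a) = \<epsilon> (\<delta> a)"
  shows "twist u \<delta> (twist u \<epsilon> f) = twist u \<epsilon> (twist u \<delta> f)"
proof -
  \<comment> \<open>Writing \<open>f\<close> as \<open>f * 1\<close> reduces the claim to
    \<open>f = 1\<close>, where the preceding formula is symmetric because \<delta> and \<epsilon>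
    commute.\<close>
  have "twist u \<delta> (twist u \<epsilon> (f * 1)) = \<delta> (\<epsilon> f) + \<epsilon> f * twist u \<delta> 1 + \<delta> f * twist u \<epsilon> 1 + f * twist u \<delta> (twist u \<epsilon> 1)"
    if "derivation \<delta>" "derivation \<epsilon>" for \<delta> \<epsilon>
    unfolding twist_mult[OF that(2)] twist_add[OF that(1)] twist_mult[OF that(1)]
    by (simp add: twist_add twist_mult that)
  from this[OF d] this[OF d(2,1)] show ?thesis
    by (simp add: twist_twist_one d u comm algebra_simps)
qed

section \<open>The characteristic polynomial and its derivatives\<close>

lemma cofm_cofm: "cofm (cofm t) $ i $ j = det t * t $ i $ j"
proof -
  have "\<forall>i j. cofm (cofm t) $ i $ j = det t * t $ i $ j"
    unfolding forall_3 by (simp add: cofm_def det_3 algebra_simps)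
  then show ?thesis by blast
qed

text \<open>The Cauchy-Binet formula for 2 by 2 minors; this form of \<open>inv2\<close> is easy to
  differentiate.\<close>

lemma inv2_gram: "inv2 (t ** transpose t) = (\<Sum>i\<in>UNIV. \<Sum>j\<in>UNIV. (cofm t $ i $ j) ^ 2)"
  by (simp add: inv2_def matrix_mult_3 transpose_def cofm_def sum_3 power2_eq_square algebra_simps)

lemma cofm_mult_cofm_transpose:
  fixes t :: "'a::comm_ring_1^3^3"
  defines "S \<equiv> t ** transpose t"
  shows "(cofm t ** transpose (cofm t)) $ i $ j = (S ** S) $ i $ j - inv1 S * S $ i $ j + inv2 S * (if i = j then 1 else 0)"
proof -
  have "\<forall>i j. (cofm t ** transpose (cofm t)) $ i $ j = (S ** S) $ i $ j - inv1 S * S $ i $ j + inv2 S * (if i = j then 1 else 0)"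
    unfolding forall_3 S_def by (simp add: matrix_mult_3 cofm_def transpose_def inv1_def inv2_def algebra_simps)
  then show ?thesis by blast
qed

lemma polcof_cofm:
  fixes t :: "'a::comm_ring_1^3^3"
  defines "S \<equiv> t ** transpose t"
  shows "polcof t t $ i $ j = 2 * cofm t $ i $ j"
    "polcof t (cofm t) $ i $ j = inv1 S * t $ i $ j - (S ** t) $ i $ j"
    "polcof t (S ** t) $ i $ j = inv1 S * cofm t $ i $ j - det t * t $ i $ j"
    "polcof (cofm t) (cofm t) $ i $ j = 2 * det t * t $ i $ j"
    "polcof (S ** t) (S ** t) $ i $ j = 2 * (det t * (S ** t) $ i $ j - inv1 S * det t * t $ i $ j + inv2 S * cofm t $ i $ j)"
proof -
  have "S ** cofm t = t ** (transpose t ** cofm t)" by (simp add: S_def matrix_mul_assoc)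
  then have "S ** cofm t = t ** mat (det t)" by (simp only: transpose_mult_cofm)
  then have SC: "(S ** cofm t) $ i $ j = det t * t $ i $ j" for i j
    by (simp add: matrix_matrix_mult_def mat_def if_distrib if_distribR mult.commute cong: if_cong)
  have SSC: "(S ** S ** cofm t) $ i $ j = det t * (S ** t) $ i $ j" for i j
  proof -
    have "(S ** S ** cofm t) $ i $ j = (S ** (S ** cofm t)) $ i $ j" by (simp add: matrix_mul_assoc)
    also have "\<dots> = (\<Sum>k\<in>UNIV. S $ i $ k * (S ** cofm t) $ k $ j)"
      by (simp add: matrix_matrix_mult_def[of S "S ** cofm t"])
    finally show ?thesis
      by (simp add: SC matrix_matrix_mult_def[of S t] sum_distrib_left mult.left_commute)
  qed
  have S: "transpose S = S" by (simp add: S_def matrix_transpose_mul)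
  note pp = polcof_powers[OF S]
  have 1: "polcof t (S ** t) = polcof (mat 1) S ** cofm t"
    using polcof_mult[of "mat 1" t S] by simp
  have 2: "polcof (S ** t) (S ** t) = polcof S S ** cofm t" by (rule polcof_mult)
  have lin: "(A ** cofm t) $ i $ j = x * cofm t $ i $ j + y * (S ** cofm t) $ i $ j + z * (S ** S ** cofm t) $ i $ j"
    if "\<And>i j. A $ i $ j = x * (if i = j then 1 else 0) + y * S $ i $ j + z * (S ** S) $ i $ j" for A x y z i j
  proof -
    have "A = mat x + mat y ** S + mat z ** (S ** S)"
      by (simp add: vec_eq_iff that mat_mult_entry) (simp add: mat_def)
    then show ?thesis by (simp add: matrix_add_rdistr mat_mult_entry flip: matrix_mul_assoc)
  qed
  show "polcof t (S ** t) $ i $ j = inv1 S * cofm t $ i $ j - det t * t $ i $ j"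
    unfolding 1 by (subst lin[of _ "inv1 S" "- 1" 0]) (simp_all add: pp SC)
  show "polcof (S ** t) (S ** t) $ i $ j = 2 * (det t * (S ** t) $ i $ j - inv1 S * det t * t $ i $ j + inv2 S * cofm t $ i $ j)"
    unfolding 2 by (subst lin[of _ "2 * inv2 S" "- 2 * inv1 S" 2]) (simp_all add: pp SC SSC algebra_simps)
  have "\<forall>i j. polcof t t $ i $ j = 2 * cofm t $ i $ j \<and> polcof t (cofm t) $ i $ j = inv1 S * t $ i $ j - (S ** t) $ i $ j
     \<and> polcof (cofm t) (cofm t) $ i $ j = 2 * det t * t $ i $ j"
    unfolding forall_3 by (simp add: polcof_def cofm_def matrix_mult_3 S_def transpose_def inv1_def det_3 algebra_simps)
  then show "polcof t t $ i $ j = 2 * cofm t $ i $ j" "polcof t (cofm t) $ i $ j = inv1 S * t $ i $ j - (S ** t) $ i $ j"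
    "polcof (cofm t) (cofm t) $ i $ j = 2 * det t * t $ i $ j"
    by blast+
qed

lemma cofm_transpose_mult: "transpose (cofm t) ** t = mat (det t)"
  using arg_cong[OF transpose_mult_cofm[of t], of transpose] by (simp add: matrix_transpose_mul transpose_mat)

text \<open>The identity for \<open>cofm t ** transpose (cofm t)\<close>, multiplied by
  \<open>t\<close> on the right. It trades S^2 t for \<open>cofm t\<close>.\<close>

lemma S_square_mult:
  fixes t :: "'a::comm_ring_1^3^3"
  defines "S \<equiv> t ** transpose t"
  shows "(S ** S ** t) $ i $ j = det t * cofm t $ i $ j + inv1 S * (S ** t) $ i $ j - inv2 S * t $ i $ j"
proof -
  have "cofm t ** transpose (cofm t) = S ** S + mat (- inv1 S) ** S + mat (inv2 S)"
    by (simp add: vec_eq_iff cofm_mult_cofm_transpose mat_mult_entry S_def) (simp add: mat_def)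
  then have "cofm t ** (transpose (cofm t) ** t) = (S ** S + mat (- inv1 S) ** S + mat (inv2 S)) ** t"
    by (simp add: matrix_mul_assoc)
  then have "(cofm t ** mat (det t)) $ i $ j = (S ** S ** t + mat (- inv1 S) ** (S ** t) + mat (inv2 S) ** t) $ i $ j"
    by (simp only: matrix_add_rdistr matrix_mul_assoc cofm_transpose_mult)
  moreover have "(cofm t ** mat (det t)) $ i $ j = det t * cofm t $ i $ j"
    by (simp add: matrix_matrix_mult_def mat_def if_distrib if_distribR mult.commute cong: if_cong)
  ultimately show ?thesis by (simp add: mat_mult_entry algebra_simps)
qed

text \<open>Scaled by \<open>det t\<close>, the matrix S t becomes S^2 \<open>cofm t\<close>, so
  both arguments share the right factor \<open>cofm t\<close> and \<open>polcof_mult\<close>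
  applies; the scalar is cancelled at the end.\<close>

lemma polcof_cofm_cubic:
  fixes t :: "'a::idom^3^3"
  defines "S \<equiv> t ** transpose t"
  assumes "det t \<noteq> 0"
  shows "polcof (cofm t) (S ** t) $ i $ j = (inv1 S ^ 2 - inv2 S) * t $ i $ j - inv1 S * (S ** t) $ i $ j - det t * cofm t $ i $ j"
proof -
  have S: "transpose S = S" by (simp add: S_def matrix_transpose_mul)
  have C: "cofm (cofm t) = mat (det t) ** t"
    by (simp add: vec_eq_iff mat_mult_entry cofm_cofm)
  have "mat (det t) ** (S ** t) = S ** S ** cofm t"
  proof -
    have "S ** S ** cofm t = S ** t ** (transpose t ** cofm t)" by (simp add: S_def matrix_mul_assoc)
    then show ?thesis
      by (simp only: transpose_mult_cofm) (simp add: vec_eq_iff mat_mult_entry, simp add: matrix_matrix_mult_def mat_def if_distrib if_distribR mult.commute cong: if_cong)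
  qed
  then have a: "polcof (cofm t) (mat (det t) ** (S ** t)) = polcof (mat 1) (S ** S) ** (mat (det t) ** t)"
    using polcof_mult[of "mat 1" "cofm t" "S ** S"] by (simp add: C)
  have b: "polcof (cofm t) (mat (det t) ** (S ** t)) $ i $ j = det t * polcof (cofm t) (S ** t) $ i $ j"
    by (simp add: polcof_def mat_mult_entry algebra_simps)
  have c: "(polcof (mat 1) (S ** S) ** (mat (det t) ** t)) $ i $ j = det t * ((inv1 S ^ 2 - 2 * inv2 S) * t $ i $ j - (S ** S ** t) $ i $ j)"
  proof -
    have "polcof (mat 1) (S ** S) = mat (inv1 S ^ 2 - 2 * inv2 S) + mat (- 1) ** (S ** S)"
      by (simp add: vec_eq_iff polcof_powers[OF S] mat_mult_entry) (simp add: mat_def)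
    then have "(polcof (mat 1) (S ** S) ** (mat (det t) ** t)) $ i $ j
       = (mat (inv1 S ^ 2 - 2 * inv2 S) ** (mat (det t) ** t)) $ i $ j + (mat (- 1) ** (S ** S ** (mat (det t) ** t))) $ i $ j"
      by (simp add: matrix_add_rdistr matrix_mul_assoc)
    moreover have "(S ** S ** (mat (det t) ** t)) $ i $ j = det t * (S ** S ** t) $ i $ j"
      by (simp add: matrix_mult_3[of "S ** S"] mat_mult_entry algebra_simps)
    ultimately show ?thesis by (simp add: mat_mult_entry algebra_simps)
  qed
  have "det t * polcof (cofm t) (S ** t) $ i $ j = det t * ((inv1 S ^ 2 - 2 * inv2 S) * t $ i $ j - (S ** S ** t) $ i $ j)"
    using a b c by metis
  then have "polcof (cofm t) (S ** t) $ i $ j = (inv1 S ^ 2 - 2 * inv2 S) * t $ i $ j - (S ** S ** t) $ i $ j"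
    using assms(2) by simp
  then show ?thesis using S_square_mult[of t i j] by (simp add: S_def algebra_simps)
qed

section \<open>First and second derivatives of the quartic \<open>chi\<close>\<close>

locale chi_calculus =
  fixes D :: "3 \<Rightarrow> 3 \<Rightarrow> 'f::field_char_0 \<Rightarrow> 'f" and Ds :: "'f \<Rightarrow> 'f" and t :: "'f^3^3" and s :: 'f
  assumes D: "derivation (D i j)" and Ds: "derivation Ds"
    and D_t: "D i j (t $ k $ l) = (if i = k \<and> j = l then 1 else 0)" and D_s: "D i j s = 0"
    and Ds_t: "Ds (t $ k $ l) = 0" and Ds_s: "Ds s = 1"
begin

definition "S = t ** transpose t"
definition "p = inv1 S"
definition "b = inv2 S"
definition "d = det t"
text \<open>The expanded product over the four roots: \<open>p\<close> and \<open>b\<close> are the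
  first two elementary symmetric functions of the squared singular values, and \<open>d\<close> is
  the product of the signed ones.\<close>

definition "chi = s^4 - 2 * p * s^2 - 8 * d * s + p^2 - 4 * b"
definition "chi_s = 4 * s^3 - 4 * p * s - 8 * d"
text \<open>The gradient of \<open>chi\<close> in the entries of \<open>t\<close>, assembled from
  the gradients of \<open>p\<close>, \<open>d\<close> and \<open>b\<close>.\<close>

definition G :: "'f^3^3" where
  "G = (\<chi> i j. - 4 * (s^2 + p) * t $ i $ j - 8 * s * cofm t $ i $ j + 8 * (S ** t) $ i $ j)"

lemmas D_rules = derivationD[OF D] D_t D_s
lemmas Ds_rules = derivationD[OF Ds] Ds_t Ds_s

lemma D_p: "D i j p = 2 * t $ i $ j"
proof -
  have "\<forall>i j. D i j p = 2 * t $ i $ j"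
    unfolding forall_3 by (simp add: p_def S_def inv1_def matrix_mult_3 transpose_def D_rules)
  then show ?thesis by blast
qed

lemma D_d: "D i j d = cofm t $ i $ j"
proof -
  have "\<forall>i j. D i j d = cofm t $ i $ j"
    unfolding forall_3 by (simp add: d_def det_3 cofm_def D_rules algebra_simps)
  then show ?thesis by blast
qed

lemma D_b: "D i j b = 2 * (p * t $ i $ j - (S ** t) $ i $ j)"
proof -
  have "\<forall>i j. D i j b = 2 * (p * t $ i $ j - (S ** t) $ i $ j)"
    unfolding forall_3 b_def S_def p_def inv2_gram
    by (simp add: sum_3 cofm_def D_rules power2_eq_square inv1_def matrix_mult_3 transpose_def) (simp add: algebra_simps)
  then show ?thesis by blast
qed

lemma power_expand: "x ^ 2 = x * x" "x ^ 3 = x * x * x" "x ^ 4 = x * x * x * (x::'f)"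
  by (simp_all add: power2_eq_square power3_eq_cube power4_eq_xxxx)

lemma D_chi: "D i j chi = G $ i $ j"
  by (simp add: chi_def G_def power_expand D_rules D_p D_d D_b algebra_simps)

lemma Ds_invariants: "Ds p = 0" "Ds b = 0" "Ds d = 0"
  by (simp_all add: p_def b_def d_def S_def inv1_def inv2_def matrix_mult_3 transpose_def det_3 Ds_rules)

lemma Ds_chi: "Ds chi = chi_s"
  by (simp add: chi_def chi_s_def power_expand Ds_rules Ds_invariants algebra_simps)

lemma Ds_chi_s: "Ds chi_s = 12 * s^2 - 4 * p"
  by (simp add: chi_s_def power_expand Ds_rules Ds_invariants algebra_simps)

lemma Ds_G: "Ds (G $ i $ j) = - 8 * s * t $ i $ j - 8 * cofm t $ i $ j"
  by (simp add: G_def cofm_def S_def matrix_mult_3 transpose_def power_expand Ds_rules Ds_invariants algebra_simps)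

lemma D_D_chi_trace: "(\<Sum>k\<in>UNIV. D i k (G $ j $ k)) = (- 12 * s^2 - 4 * p) * (if i = j then 1 else 0) + 24 * S $ i $ j"
proof -
  have "\<forall>i j. (\<Sum>k\<in>UNIV. D i k (G $ j $ k)) = (- 12 * s^2 - 4 * p) * (if i = j then 1 else 0) + 24 * S $ i $ j"
    unfolding forall_3
    by (simp add: sum_3 G_def cofm_def D_rules D_p S_def matrix_mult_3 transpose_def power_expand p_def[unfolded S_def] inv1_def)
  then show ?thesis by blast
qed

lemma D_D_chi_minor:
  "D (i+1) (j+1) (G $ (i+2) $ (j+2)) - D (i+1) (j+2) (G $ (i+2) $ (j+1)) = - 16 * cofm t $ i $ j - 16 * s * t $ i $ j"
proof -
  have "\<forall>i j. D (i+1) (j+1) (G $ (i+2) $ (j+2)) - D (i+1) (j+2) (G $ (i+2) $ (j+1)) = - 16 * cofm t $ i $ j - 16 * s * t $ i $ j"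
    unfolding forall_3
    by (simp add: G_def cofm_def D_rules D_p S_def matrix_mult_3 transpose_def power_expand)
  then show ?thesis by blast
qed

text \<open>The products of \<open>t\<close>, \<open>cofm t\<close>, \<open>S ** t\<close> with each
  other's transposes are polynomials in \<open>S\<close>. The contributions of S^2 cancel.\<close>

lemma G_gram: "(\<Sum>k\<in>UNIV. G $ i $ k * G $ j $ k) = 16 * (((s^2 + p)^2 - 4 * p * s^2 - 4 * b - 8 * s * d) * S $ i $ j
    + (4 * s^2 * b + 4 * d^2 + 4 * s * (s^2 + p) * d) * (if i = j then 1 else 0))"
proof -
  have S: "transpose S = S" by (simp add: S_def matrix_transpose_mul)
  have prod: "(\<Sum>k\<in>UNIV. A $ i $ k * B $ j $ k) = (A ** transpose B) $ i $ j" for A B :: "'f^3^3" and i j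
    by (simp add: matrix_matrix_mult_def transpose_def)
  have CT: "cofm t ** transpose t = mat d" by (simp add: cofm_transpose d_def)
  have TC: "t ** transpose (cofm t) = mat d"
    using arg_cong[OF CT, of transpose] by (simp add: matrix_transpose_mul transpose_mat)
  have mat_right: "(A ** mat k) $ i $ j = k * A $ i $ j" for A :: "'f^3^3" and k i j
    by (simp add: matrix_matrix_mult_def mat_def if_distrib if_distribR mult.commute cong: if_cong)
  have "det S = d ^ 2" by (simp add: S_def d_def det_mul det_transpose power2_eq_square)
  then have CH: "(S ** S ** S) $ i $ j = p * (S ** S) $ i $ j - b * S $ i $ j + d^2 * (if i = j then 1 else 0)"
    by (simp add: cayley_hamilton_3 p_def b_def)
  have st: "S ** t ** transpose (S ** t) = S ** S ** S"
    by (simp add: matrix_transpose_mul S) (simp add: S_def matrix_mul_assoc)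
  have f1: "(cofm t ** transpose (S ** t)) $ i $ j = d * S $ i $ j"
    by (simp add: matrix_transpose_mul S matrix_mul_assoc CT mat_mult_entry)
  have f2: "(S ** t ** transpose (cofm t)) $ i $ j = d * S $ i $ j"
    by (simp add: mat_right TC flip: matrix_mul_assoc)
  have f3: "t ** transpose (S ** t) = S ** S" "S ** t ** transpose t = S ** S"
    by (simp_all add: matrix_transpose_mul S matrix_mul_assoc) (simp_all add: S_def matrix_mul_assoc)
  have f4: "(cofm t ** transpose (cofm t)) $ i $ j = (S ** S) $ i $ j - p * S $ i $ j + b * (if i = j then 1 else 0)"
    unfolding p_def b_def S_def by (rule cofm_mult_cofm_transpose)
  have f5: "t ** transpose t = S" by (simp add: S_def)
  have f6: "mat d $ i $ j = d * (if i = j then 1 else 0)" by (simp add: mat_def)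
  have f7: "(\<Sum>k\<in>UNIV. (x * A $ i $ k + y * B $ i $ k + z * C $ i $ k) * (x * A $ j $ k + y * B $ j $ k + z * C $ j $ k))
     = x * x * (\<Sum>k\<in>UNIV. A $ i $ k * A $ j $ k) + x * y * ((\<Sum>k\<in>UNIV. A $ i $ k * B $ j $ k) + (\<Sum>k\<in>UNIV. B $ i $ k * A $ j $ k))
      + x * z * ((\<Sum>k\<in>UNIV. A $ i $ k * C $ j $ k) + (\<Sum>k\<in>UNIV. C $ i $ k * A $ j $ k))
      + y * y * (\<Sum>k\<in>UNIV. B $ i $ k * B $ j $ k) + y * z * ((\<Sum>k\<in>UNIV. B $ i $ k * C $ j $ k) + (\<Sum>k\<in>UNIV. C $ i $ k * B $ j $ k))
      + z * z * (\<Sum>k\<in>UNIV. C $ i $ k * C $ j $ k)" for x y z and A B C :: "'f^3^3"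
    by (simp add: sum_3 algebra_simps)
  note f8 = f7[of "- 4 * (s^2 + p)" t "- 8 * s" "cofm t" 8 "S ** t"]
  have f9: "G $ i $ k = - 4 * (s^2 + p) * t $ i $ k + - 8 * s * cofm t $ i $ k + 8 * (S ** t) $ i $ k" for i k
    by (simp add: G_def)
  show ?thesis
    unfolding f9 f8 prod
    by (simp only: f1 f2 f3 f4 f5 f6 CT TC st CH) (simp add: algebra_simps power2_eq_square)
qed

text \<open>This says that \<open>\<Sum>\<^sub>k \<partial>\<^sub>i\<^sub>k \<partial>\<^sub>j\<^sub>k\<close> and \<open>\<delta>\<^sub>i\<^sub>j \<partial>\<^sup>2/\<partial>s\<^sup>2\<close> agree on \<open>1 / sqrt chi\<close>; the next identity says that the cofactors of \<open>(\<partial>\<^sub>i\<^sub>j)\<close> agree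
  with \<open>- \<partial>/\<partial>s \<partial>\<^sub>i\<^sub>j\<close> there.\<close>

lemma row_identity:
  "(\<Sum>k\<in>UNIV. 3 * G $ i $ k * G $ j $ k - 2 * chi * D i k (G $ j $ k))
     = (if i = j then 3 * chi_s * chi_s - 2 * chi * Ds chi_s else 0)"
proof -
  have "(\<Sum>k\<in>UNIV. 3 * G $ i $ k * G $ j $ k - 2 * chi * D i k (G $ j $ k))
     = 3 * (\<Sum>k\<in>UNIV. G $ i $ k * G $ j $ k) - 2 * chi * (\<Sum>k\<in>UNIV. D i k (G $ j $ k))"
    by (simp add: sum_subtractf sum_distrib_left mult.assoc)
  also have "\<dots> = (if i = j then 3 * chi_s * chi_s - 2 * chi * Ds chi_s else 0)"
    unfolding G_gram D_D_chi_trace Ds_chi_s unfolding chi_def chi_s_def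
    by (auto simp: power_expand algebra_simps)
  finally show ?thesis .
qed

lemma cofactor_identity:
  assumes "det t \<noteq> 0"
  shows "(3 * G $ (i+1) $ (j+1) * G $ (i+2) $ (j+2) - 2 * chi * D (i+1) (j+1) (G $ (i+2) $ (j+2)))
     - (3 * G $ (i+1) $ (j+2) * G $ (i+2) $ (j+1) - 2 * chi * D (i+1) (j+2) (G $ (i+2) $ (j+1)))
     = - (3 * chi_s * G $ i $ j - 2 * chi * Ds (G $ i $ j))" (is "?l = ?r")
proof -
  have "polcof G G $ i $ j = (16 * (s^2 + p)^2) * polcof t t $ i $ j + 2 * (32 * s * (s^2 + p)) * polcof t (cofm t) $ i $ j
     - 2 * (32 * (s^2 + p)) * polcof t (S ** t) $ i $ j + (64 * s^2) * polcof (cofm t) (cofm t) $ i $ j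
     - 2 * (64 * s) * polcof (cofm t) (S ** t) $ i $ j + 64 * polcof (S ** t) (S ** t) $ i $ j"
  proof -
    have "polcof H H $ i $ j = x * x * polcof A A $ i $ j + 2 * x * y * polcof A B $ i $ j + 2 * x * z * polcof A C $ i $ j
       + y * y * polcof B B $ i $ j + 2 * y * z * polcof B C $ i $ j + z * z * polcof C C $ i $ j"
      if "\<And>i j. H $ i $ j = x * A $ i $ j + y * B $ i $ j + z * C $ i $ j" for x y z and A B C H :: "'f^3^3"
      by (simp add: polcof_def that algebra_simps)
    from this[of G "- 4 * (s^2 + p)" t "- 8 * s" "cofm t" 8 "S ** t"] show ?thesis
      by (simp add: G_def power2_eq_square algebra_simps)
  qed
  \<comment> \<open>Along \<open>chi\<close> = 0 the cofactor matrix of \<open>G\<close> is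
    \<open>- chi_s\<close> times \<open>G\<close>; the other summand is an explicit multiple of
    \<open>chi\<close>.\<close>
  also have "\<dots> = 2 * (- chi_s * G $ i $ j - 16 * chi * (s * t $ i $ j + cofm t $ i $ j))"
    unfolding polcof_cofm[of t i j, folded S_def, folded p_def b_def d_def]
      polcof_cofm_cubic[OF assms, of i j, folded S_def, folded p_def b_def d_def]
    by (simp add: chi_def chi_s_def G_def power_expand algebra_simps)
  finally have "2 * cofm G $ i $ j = 2 * (- chi_s * G $ i $ j - 16 * chi * (s * t $ i $ j + cofm t $ i $ j))"
    by (simp only: polcof_self)
  then have cof: "cofm G $ i $ j = - chi_s * G $ i $ j - 16 * chi * (s * t $ i $ j + cofm t $ i $ j)"
    by (rule mult_left_cancel[THEN iffD1, rotated]) simp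
  have l: "?l = 3 * cofm G $ i $ j
      - 2 * chi * (D (i+1) (j+1) (G $ (i+2) $ (j+2)) - D (i+1) (j+2) (G $ (i+2) $ (j+1)))"
    by (simp add: cofm_def algebra_simps)
  show ?thesis
    unfolding l cof D_D_chi_minor Ds_G by (simp add: algebra_simps)
qed

text \<open>\<open>G ** transpose t\<close> is a polynomial in the symmetric matrix
  \<open>S\<close>, hence symmetric.\<close>

lemma rotation_identity: "(\<Sum>k\<in>UNIV. t $ i $ k * G $ j $ k) = (\<Sum>k\<in>UNIV. t $ j $ k * G $ i $ k)"
proof -
  have prod: "(\<Sum>k\<in>UNIV. A $ i $ k * B $ j $ k) = (A ** transpose B) $ i $ j" for A B :: "'f^3^3" and i j
    by (simp add: matrix_matrix_mult_def transpose_def)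
  have "(\<Sum>k\<in>UNIV. t $ i $ k * G $ j $ k) = - 4 * (s^2 + p) * (\<Sum>k\<in>UNIV. t $ i $ k * t $ j $ k)
      - 8 * s * (\<Sum>k\<in>UNIV. cofm t $ j $ k * t $ i $ k) + 8 * (\<Sum>k\<in>UNIV. (S ** t) $ j $ k * t $ i $ k)" for i j
    by (simp add: G_def sum_3 algebra_simps)
  moreover have "(S ** t ** transpose t) = S ** S" by (simp add: S_def matrix_mul_assoc)
  moreover have sym: "A $ i $ j = A $ j $ i" if "transpose A = A" for A :: "'f^3^3"
    using arg_cong[OF that, of "\<lambda>A. A $ j $ i"] by (simp add: transpose_def)
  have "(S ** S) $ i $ j = (S ** S) $ j $ i" "(t ** transpose t) $ i $ j = (t ** transpose t) $ j $ i"
    by (rule sym, simp add: S_def matrix_transpose_mul matrix_mul_assoc)+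
  ultimately show ?thesis
    unfolding prod by (simp add: cofm_transpose mat_def)
qed

end

section \<open>The lower bound\<close>

definition emb :: "'k::field \<Rightarrow> 'k poly fract" where
  "emb a = Fract [:a:] 1"

lemma ring_hom_emb: "ring_hom_fun emb"
  by (simp add: ring_hom_fun_def emb_def One_fract_def one_pCons mult.commute)

lemmas emb_simps = ring_hom_funD[OF ring_hom_emb]

lemma emb_eq_0: "emb a = 0 \<longleftrightarrow> a = 0"
  by (simp add: emb_def Zero_fract_def eq_fract)

lemma derivation_ratfun_diff: "derivation (ratfun_diff v)"
  by (simp add: derivation_def ratfun_diff_add ratfun_diff_mult)

definition Dv :: "'v::{finite,linorder} \<Rightarrow> 'v ratfun poly fract \<Rightarrow> 'v ratfun poly fract" where
  "Dv v = fract_deriv (map_poly (ratfun_diff v))"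

definition Ds :: "'k::field poly fract \<Rightarrow> 'k poly fract" where
  "Ds = fract_deriv pderiv"

lemma derivation_Dv: "derivation (Dv v)"
  unfolding Dv_def by (intro derivation_fract_deriv derivation_map_poly derivation_ratfun_diff)

lemma derivation_Ds: "derivation Ds"
  unfolding Ds_def by (intro derivation_fract_deriv derivation_pderiv)

lemma Dv_commute: "Dv v (Dv w f) = Dv w (Dv v f)"
  unfolding Dv_def
  by (intro fract_deriv_commute derivation_map_poly derivation_ratfun_diff map_poly_commute ratfun_diff_commute)

lemma Dv_Ds_commute: "Dv v (Ds f) = Ds (Dv v f)"
  unfolding Dv_def Ds_def
  by (intro fract_deriv_commute derivation_map_poly derivation_ratfun_diff derivation_pderiv map_poly_pderiv_commute)

lemma Dv_Fract: "Dv v (Fract a 1) = Fract (map_poly (ratfun_diff v) a) 1"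
  unfolding Dv_def by (rule fract_deriv_Fract_1) (intro derivation_map_poly derivation_ratfun_diff)

lemma Ds_Fract: "Ds (Fract a 1) = Fract (pderiv a) 1"
  unfolding Ds_def by (rule fract_deriv_Fract_1) (rule derivation_pderiv)

lemma Dv_emb: "Dv v (emb a) = emb (ratfun_diff v a)"
  by (simp add: emb_def Dv_Fract map_poly_pCons)

lemma Ds_emb: "Ds (emb a) = 0"
  by (simp add: emb_def Ds_Fract pderiv_pCons Zero_fract_def)

definition svar :: "'k::field poly fract" where
  "svar = Fract [:0, 1:] 1"

lemma Dv_svar: "Dv v svar = 0"
proof -
  have "map_poly (ratfun_diff v) [:0, 1:] = 0" by (simp add: map_poly_pCons)
  then show ?thesis by (simp add: svar_def Dv_Fract flip: Zero_fract_def)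
qed

lemma Ds_svar: "Ds svar = 1"
  by (simp add: svar_def Ds_Fract pderiv_pCons flip: One_fract_def one_pCons)

global_interpretation chi: chi_calculus "\<lambda>i j. Dv (entry (nat3 i) (nat3 j))" Ds "map_matrix emb Tm" svar
  by unfold_locales
    (simp_all add: derivation_Dv derivation_Ds Dv_svar Ds_svar map_matrix_def Tm_def Dv_emb Ds_emb ratfun_diff_tvar emb_simps)

section \<open>The quartic over K and its coprimality with its derivative\<close>

abbreviation "pK \<equiv> inv1 gm.S"
abbreviation "bK \<equiv> inv2 gm.S"
abbreviation "dK \<equiv> det Tm"

definition chi_poly :: "9 ratfun poly" where
  "chi_poly = [: pK ^ 2 - 4 * bK, - 8 * dK, - 2 * pK, 0, 1 :]"

lemma chi_invariants: "chi.S = map_matrix emb gm.S" "chi.p = emb pK" "chi.b = emb bK" "chi.d = emb dK"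
proof -
  show S: "chi.S = map_matrix emb gm.S"
    by (simp add: chi.S_def gm.S_def map_matrix_hom[OF ring_hom_emb])
  show "chi.p = emb pK" "chi.b = emb bK" "chi.d = emb dK"
    by (simp_all add: chi.p_def chi.b_def chi.d_def S map_matrix_hom[OF ring_hom_emb])
qed

lemma Fract_pCons: "Fract (pCons a q) 1 = emb a + svar * Fract q 1"
  by (simp add: emb_def svar_def)

lemma chi_eq: "chi.chi = Fract chi_poly 1"
  by (simp add: chi_poly_def Fract_pCons chi.chi_def chi_invariants emb_simps flip: Zero_fract_def)
    (simp add: power2_eq_square power4_eq_xxxx algebra_simps emb_simps)

lemma chi_poly_nonzero: "chi_poly \<noteq> 0"
  by (simp add: chi_poly_def)

lemma chi_nonzero: "chi.chi \<noteq> 0"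
  using chi_poly_nonzero by (simp add: chi_eq Zero_fract_def eq_fract)

lemma disc_nonzero: "cubic_disc pK bK (dK ^ 2) \<noteq> 0" "dK \<noteq> 0"
proof -
  have "det gm.S = dK ^ 2" by (simp add: gm.S_def det_mul det_transpose power2_eq_square)
  then show "cubic_disc pK bK (dK ^ 2) \<noteq> 0" "dK \<noteq> 0"
    using genericity_Tm by (auto simp: genericity_def gm.S_def[symmetric])
qed

text \<open>\<open>chi_poly\<close> is coprime to its derivative: the product of the squared
  differences of its roots is a constant times the discriminant of the characteristic polynomial of
  S, which is nonzero.\<close>

lemma chi_poly_dvd_cancel:
  assumes "chi_poly dvd q * pderiv chi_poly"
  shows "chi_poly dvd q"
proof -
  define A where "A = 9 * dK^2 - pK * bK"
  define B where "B = - 2 * dK * (pK^2 - 3 * bK)"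
  \<comment> \<open>Found with the Euclidean algorithm for \<open>chi_poly\<close> and its derivative.\<close>
  have bezout: "[: 64 * (bK^2 - 3 * pK * dK^2), - 16 * B, 16 * A :] * chi_poly
      - [: - 24 * dK * A + 4 * pK * B, 16 * (bK^2 - 3 * pK * dK^2) - 4 * pK * A, - 4 * B, 4 * A :] * pderiv chi_poly
      = [: 64 * cubic_disc pK bK (dK^2) :]"
    by (simp add: chi_poly_def pderiv_pCons A_def B_def cubic_disc_def) (simp add: algebra_simps power2_eq_square power3_eq_cube power4_eq_xxxx)
  then obtain U V where UV: "U * chi_poly - V * pderiv chi_poly = [: 64 * cubic_disc pK bK (dK^2) :]" by blast
  have "chi_poly dvd U * q * chi_poly - V * (q * pderiv chi_poly)"
    by (intro dvd_diff dvd_triv_right dvd_mult[OF assms])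
  also have "U * q * chi_poly - V * (q * pderiv chi_poly) = q * (U * chi_poly - V * pderiv chi_poly)"
    by (simp add: algebra_simps)
  finally have "chi_poly dvd smult (64 * cubic_disc pK bK (dK^2)) q"
    unfolding UV by simp
  then show ?thesis
    using disc_nonzero by (simp add: dvd_smult_cancel)
qed

text \<open>The derivation \<open>Ds\<close> conjugated by \<open>exp s / sqrt chi\<close>, so that its values integrate to zero.\<close>

definition nabla_s :: "9 ratfun poly fract \<Rightarrow> 9 ratfun poly fract" where
  "nabla_s h = twist chi.chi Ds h + h"

text \<open>The ring K[s, 1/\<open>chi\<close>]; the exponent \<open>k\<close> bounds the pole order
  along \<open>chi\<close>.\<close>

definition chi_local :: "9 ratfun poly fract set" where
  "chi_local = {f. \<exists>k a. f * chi.chi ^ k = Fract a 1}"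

lemma chi_localI: "f * chi.chi ^ k = Fract a 1 \<Longrightarrow> f \<in> chi_local"
  by (auto simp: chi_local_def)

lemma chi_local_Fract: "Fract a 1 \<in> chi_local"
  by (rule chi_localI[of _ 0]) simp

lemma chi_power: "chi.chi ^ k = Fract (chi_poly ^ k) 1"
  by (induction k) (simp_all add: chi_eq One_fract_def)

lemma chi_local_add:
  assumes "f \<in> chi_local" "g \<in> chi_local"
  shows "f + g \<in> chi_local"
proof -
  obtain k a l c where "f * chi.chi ^ k = Fract a 1" "g * chi.chi ^ l = Fract c 1"
    using assms by (auto simp: chi_local_def)
  moreover have "(f + g) * chi.chi ^ (k + l) = (f * chi.chi ^ k) * chi.chi ^ l + (g * chi.chi ^ l) * chi.chi ^ k"
    by (simp add: power_add algebra_simps)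
  ultimately have "(f + g) * chi.chi ^ (k + l) = Fract (a * chi_poly ^ l + c * chi_poly ^ k) 1"
    by (simp add: chi_power)
  then show ?thesis by (rule chi_localI)
qed

lemma chi_local_mult:
  assumes "f \<in> chi_local" "g \<in> chi_local"
  shows "f * g \<in> chi_local"
proof -
  obtain k a l c where "f * chi.chi ^ k = Fract a 1" "g * chi.chi ^ l = Fract c 1"
    using assms by (auto simp: chi_local_def)
  moreover have "(f * g) * chi.chi ^ (k + l) = (f * chi.chi ^ k) * (g * chi.chi ^ l)"
    by (simp add: power_add algebra_simps)
  ultimately have "(f * g) * chi.chi ^ (k + l) = Fract (a * c) 1"
    by simp
  then show ?thesis by (rule chi_localI)
qed

lemma chi_local_emb: "emb a \<in> chi_local"
  unfolding emb_def by (rule chi_local_Fract)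

lemma chi_local_one: "1 \<in> chi_local"
  unfolding One_fract_def by (rule chi_local_Fract)

lemma chi_local_diff: "f \<in> chi_local \<Longrightarrow> g \<in> chi_local \<Longrightarrow> f - g \<in> chi_local"
  using chi_local_add[of f "emb (- 1) * g"] chi_local_mult[OF chi_local_emb, of g "- 1"] by (simp add: emb_simps)

lemma chi_local_twist:
  assumes D: "derivation D" and Fr: "\<And>a. \<exists>c. D (Fract a 1) = Fract c 1" and f: "f \<in> chi_local"
  shows "twist chi.chi D f \<in> chi_local"
proof -
  obtain k a where a: "f * chi.chi ^ k = Fract a 1" using f by (auto simp: chi_local_def)
  obtain c e g where c: "D (Fract a 1) = Fract c 1" and e: "D (Fract (chi_poly ^ k) 1) = Fract e 1" and g: "D (Fract chi_poly 1) = Fract g 1"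
    using Fr by meson
  have "D f * chi.chi ^ (k + k) = D f * chi.chi ^ k * chi.chi ^ k"
    by (simp add: power_add)
  also have "D f * chi.chi ^ k = D (f * chi.chi ^ k) - f * D (chi.chi ^ k)"
    by (simp add: derivationD[OF D])
  also have "\<dots> * chi.chi ^ k = D (f * chi.chi ^ k) * chi.chi ^ k - (f * chi.chi ^ k) * D (chi.chi ^ k)"
    by (simp add: algebra_simps)
  also have "\<dots> = Fract (c * chi_poly ^ k - a * e) 1"
    unfolding a unfolding chi_power c e by simp
  finally have "D f \<in> chi_local" by (rule chi_localI)
  moreover have "D chi.chi / (2 * chi.chi) * chi.chi ^ 1 = emb (1 / 2) * Fract g 1"
  proof -
    have "2 * emb (1 / 2 :: 9 ratfun) = 1"
      using emb_simps(3)[of 2 "1 / 2 :: 9 ratfun"] by (simp add: emb_simps)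
    then have "emb (1 / 2 :: 9 ratfun) = 1 / 2" by (simp add: field_simps)
    then show ?thesis using chi_nonzero by (simp add: chi_eq g field_simps)
  qed
  then have "D chi.chi / (2 * chi.chi) \<in> chi_local"
    by (intro chi_localI[of _ 1 "[:1/2:] * g"]) (simp add: emb_def)
  ultimately show ?thesis
    unfolding twist_def using f by (intro chi_local_diff chi_local_mult)
qed

lemma chi_local_twist_Dv: "f \<in> chi_local \<Longrightarrow> twist chi.chi (Dv v) f \<in> chi_local"
  by (rule chi_local_twist) (auto simp: derivation_Dv Dv_Fract)

lemma chi_local_twist_Ds: "f \<in> chi_local \<Longrightarrow> twist chi.chi Ds f \<in> chi_local"
  by (rule chi_local_twist) (auto simp: derivation_Ds Ds_Fract)

section \<open>The twisted derivative in s and its image\<close>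

lemma nabla_s_add: "nabla_s (f + g) = nabla_s f + nabla_s g"
  by (simp add: nabla_s_def twist_add derivation_Ds)

lemma nabla_s_emb: "nabla_s (emb a * f) = emb a * nabla_s f"
  by (simp add: nabla_s_def twist_mult derivation_Ds Ds_emb distrib_left)

text \<open>Since the derivations commute, the image of \<open>nabla_s\<close> on
  \<open>chi_local\<close> is stable under the action of R.\<close>

lemma nabla_s_twist: "nabla_s (twist chi.chi (Dv v) f) = twist chi.chi (Dv v) (nabla_s f)"
proof -
  have "twist chi.chi Ds (twist chi.chi (Dv v) f) = twist chi.chi (Dv v) (twist chi.chi Ds f)"
    by (rule twist_commute[OF derivation_Ds derivation_Dv chi_nonzero]) (rule Dv_Ds_commute[symmetric])
  then show ?thesis by (simp only: nabla_s_def twist_add[OF derivation_Dv])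
qed

lemma derivation_power_Suc:
  "derivation D \<Longrightarrow> D (u ^ Suc m) = of_nat (Suc m) * u ^ m * D (u :: 'a::comm_ring_1)"
  by (induction m) (simp_all add: derivationD algebra_simps)

text \<open>A pole of order k > 0 in \<open>h\<close> becomes one of order k + 1, too deep for the
  right-hand side. So \<open>h\<close> is a polynomial, and comparing top coefficients forces it to
  vanish.\<close>

lemma nabla_s_image_independent:
  assumes h: "h \<in> chi_local" and eq: "nabla_s h = emb \<alpha> + Fract [:b0, b1, b2:] 1 / chi.chi"
  shows "\<alpha> = 0 \<and> b0 = 0 \<and> b1 = 0 \<and> b2 = 0"
proof -
  have "\<exists>k a. h * chi.chi ^ k = Fract a 1" using h by (simp add: chi_local_def)
  \<comment> \<open>By minimality, \<open>k\<close> is the exact pole order.\<close>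
  then obtain k where "\<exists>a. h * chi.chi ^ k = Fract a 1" and least: "\<And>m. m < k \<Longrightarrow> \<nexists>a. h * chi.chi ^ m = Fract a 1"
    using exists_least_iff[of "\<lambda>k. \<exists>a. h * chi.chi ^ k = Fract a 1"] by blast
  then obtain a where a: "h * chi.chi ^ k = Fract a 1" by blast
  let ?B = "[:b0, b1, b2:]"
  have chi_s: "Ds chi.chi = Fract (pderiv chi_poly) 1" by (simp add: chi_eq Ds_Fract)
  have eq2: "2 * chi.chi * Ds h + 2 * chi.chi * h - Ds chi.chi * h = 2 * chi.chi * emb \<alpha> + 2 * Fract ?B 1"
  proof -
    have "2 * chi.chi * Ds h + 2 * chi.chi * h - Ds chi.chi * h = 2 * chi.chi * nabla_s h"
      using chi_nonzero by (simp add: nabla_s_def twist_def field_simps)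
    also have "\<dots> = 2 * chi.chi * emb \<alpha> + 2 * Fract ?B 1"
      unfolding eq using chi_nonzero by (simp add: field_simps)
    finally show ?thesis .
  qed
  have two: "2 = Fract 2 (1 :: 9 ratfun poly)"
    using ring_hom_funD(7)[OF ring_hom_Fract, of "num.Bit0 num.One"] by simp
  have "k = 0"
  proof (rule ccontr)
    assume "k \<noteq> 0"
    then obtain m where k: "k = Suc m" by (cases k) auto
    have "Fract (pderiv a) 1 = Ds h * chi.chi ^ k + h * (of_nat k * chi.chi ^ m * Ds chi.chi)"
      using arg_cong[OF a, of Ds] derivation_power_Suc[OF derivation_Ds, of "chi.chi" m]
      by (simp add: derivationD[OF derivation_Ds] Ds_Fract k del: of_nat_Suc power_Suc)
    then have "Ds h * chi.chi ^ k * chi.chi = Fract (pderiv a) 1 * chi.chi - of_nat k * (h * chi.chi ^ k) * Ds chi.chi"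
      by (simp add: k algebra_simps)
    then have 1: "chi.chi * Ds h * chi.chi ^ k = Fract (pderiv a) 1 * chi.chi - of_nat k * Fract a 1 * Ds chi.chi"
      unfolding a by (simp add: mult.commute mult.left_commute)
    have "(2 * chi.chi * Ds h + 2 * chi.chi * h - Ds chi.chi * h) * chi.chi ^ k
        = 2 * (chi.chi * Ds h * chi.chi ^ k) + 2 * chi.chi * (h * chi.chi ^ k) - Ds chi.chi * (h * chi.chi ^ k)"
      by (simp add: algebra_simps)
    then have "2 * (Fract (pderiv a) 1 * chi.chi - of_nat k * Fract a 1 * Ds chi.chi) + 2 * chi.chi * Fract a 1 - Ds chi.chi * Fract a 1
       = (2 * chi.chi * emb \<alpha> + 2 * Fract ?B 1) * chi.chi ^ k"
      unfolding 1 a eq2 by simp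
    then have "2 * (pderiv a * chi_poly - of_nat k * a * pderiv chi_poly) + 2 * chi_poly * a - pderiv chi_poly * a = (2 * chi_poly * [:\<alpha>:] + 2 * ?B) * chi_poly ^ k"
      unfolding chi_s chi_power unfolding chi_eq emb_def two of_nat_Fract by (simp add: eq_fract)
    \<comment> \<open>Only this term survives modulo \<open>chi_poly\<close>. Its factor 2k + 1
      combines k from differentiating the pole with one half from the twist, and is nonzero in
      characteristic zero.\<close>
    then have "of_nat (2 * k + 1) * a * pderiv chi_poly = chi_poly * (2 * pderiv a + 2 * a - (2 * chi_poly * [:\<alpha>:] + 2 * ?B) * chi_poly ^ m)"
      by (simp add: k algebra_simps)
    then have "chi_poly dvd of_nat (2 * k + 1) * a * pderiv chi_poly" by (simp only: dvd_triv_left)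
    then have "chi_poly dvd of_nat (2 * k + 1) * a" by (rule chi_poly_dvd_cancel)
    then have "chi_poly dvd smult (of_nat (2 * k + 1)) a" by (simp only: of_nat_poly) simp
    then have "chi_poly dvd a" by (simp add: dvd_smult_cancel del: of_nat_add of_nat_mult of_nat_Suc)
    then obtain c where "a = chi_poly * c" by blast
    then have "h * chi.chi ^ m * chi.chi = Fract c 1 * chi.chi"
      using a by (simp add: k chi_eq mult.commute mult.left_commute)
    then have "h * chi.chi ^ m = Fract c 1" using chi_nonzero by simp
    then show False using least[of m] k by blast
  qed
  then have ha: "h = Fract a 1" using a by simp
  have "2 * chi_poly * pderiv a + 2 * chi_poly * a - pderiv chi_poly * a = 2 * chi_poly * [:\<alpha>:] + 2 * ?B"
    using eq2 unfolding ha chi_s unfolding Ds_Fract chi_eq emb_def two by (simp add: eq_fract)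
  then have poly_eq: "smult 2 (chi_poly * pderiv a) + smult 2 (chi_poly * a) - pderiv chi_poly * a = smult (2 * \<alpha>) chi_poly + smult 2 ?B"
    by (simp add: numeral_poly mult.commute)
  have deg: "degree chi_poly = 4" and c4: "coeff chi_poly 4 = 1" and c3: "coeff chi_poly 3 = 0"
  proof -
    have n: "3 = Suc (Suc (Suc 0))" "4 = Suc (Suc (Suc (Suc 0)))" by arith+
    show "degree chi_poly = 4" by (simp add: chi_poly_def)
    show "coeff chi_poly 4 = 1" "coeff chi_poly 3 = 0"
      unfolding n by (simp_all add: chi_poly_def)
  qed
  have B: "coeff [:x, y, z:] n = 0" if "n \<ge> 3" for n and x y z :: "9 ratfun"
    using that by (intro coeff_eq_0) auto
  \<comment> \<open>The coefficient of degree 4 + n forces \<open>a\<close> to be constant. Then s^3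
    has coefficient -4 a on the left and 0 on the right, since the quartic has no cubic
    term.\<close>
  have "a = 0"
  proof (rule ccontr)
    assume "a \<noteq> 0"
    define n where "n = degree a"
    have "coeff (chi_poly * pderiv a) (4 + n) = 0"
    proof (cases "n = 0")
      case True
      then have "pderiv a = 0" by (simp add: n_def pderiv_eq_0_iff)
      then show ?thesis by simp
    next
      case False
      have "degree (chi_poly * pderiv a) \<le> 4 + (n - 1)"
        using degree_mult_le[of chi_poly "pderiv a"] by (simp add: deg n_def degree_pderiv)
      then show ?thesis using False by (intro coeff_eq_0) auto
    qed
    moreover have "coeff (pderiv chi_poly * a) (4 + n) = 0"
    proof -
      have "degree (pderiv chi_poly * a) \<le> 3 + n"
        using degree_mult_le[of "pderiv chi_poly" a] by (simp add: deg n_def degree_pderiv)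
      then show ?thesis by (intro coeff_eq_0) auto
    qed
    moreover have "coeff (chi_poly * a) (4 + n) = lead_coeff a"
      using coeff_mult_degree_sum[of chi_poly a] by (simp add: deg n_def c4)
    ultimately have lead: "2 * lead_coeff a = 2 * \<alpha> * coeff chi_poly (4 + n)"
      using arg_cong[OF poly_eq, of "\<lambda>p. coeff p (4 + n)"] B[of "4 + n"] by simp
    have "n = 0"
    proof (rule ccontr)
      assume "n \<noteq> 0"
      then have "coeff chi_poly (4 + n) = 0" by (intro coeff_eq_0) (simp add: deg)
      then show False using lead \<open>a \<noteq> 0\<close> by simp
    qed
    then obtain c where c: "a = [:c:]" using degree_eq_zeroE[of a] by (auto simp: n_def)
    have "coeff (pderiv chi_poly) 3 = 4"
      using c4 by (simp add: coeff_pderiv)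
    then have "c = 0"
      using arg_cong[OF poly_eq, of "\<lambda>p. coeff p 3"] B[of 3] c3 by (simp add: c)
    then show False using c \<open>a \<noteq> 0\<close> by simp
  qed
  then have zero: "smult (2 * \<alpha>) chi_poly + smult 2 ?B = 0" using poly_eq by simp
  have "coeff (smult (2 * \<alpha>) chi_poly + smult 2 ?B) 4 = 0" unfolding zero by simp
  then have "\<alpha> = 0" using B[of 4] c4 by simp
  then show ?thesis using zero by simp
qed

section \<open>The module K(s) and the operators with exact image\<close>

global_interpretation wa: weyl_action "\<lambda>a f. emb a * f" "\<lambda>v. twist chi.chi (Dv v)"
proof
  fix v w :: 9 and a c :: "9 ratfun" and m n :: "9 ratfun poly fract"
  show "emb (a + c) * m = emb a * m + emb c * m" "emb a * (m + n) = emb a * m + emb a * n"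
    "emb (a * c) * m = emb a * (emb c * m)" "emb 1 * m = m"
    by (simp_all only: emb_simps distrib_left distrib_right mult.assoc mult_1)
  show "twist chi.chi (Dv v) (m + n) = twist chi.chi (Dv v) m + twist chi.chi (Dv v) n"
    by (rule twist_add[OF derivation_Dv])
  show "twist chi.chi (Dv v) (emb a * m) = emb (ratfun_diff v a) * m + emb a * twist chi.chi (Dv v) m"
    unfolding twist_mult[OF derivation_Dv] Dv_emb ..
  show "twist chi.chi (Dv v) (twist chi.chi (Dv w) m) = twist chi.chi (Dv w) (twist chi.chi (Dv v) m)"
    by (rule twist_commute[OF derivation_Dv derivation_Dv chi_nonzero]) (rule Dv_commute)
qed

text \<open>The element 1 stands for the integrand exp s / sqrt chi; membership says that the
  operator turns the integrand into a total derivative in s.\<close>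

definition exact_ops :: "9 rweyl set" where
  "exact_ops = {P. wa.act P 1 \<in> nabla_s ` chi_local}"

lemma nabla_s_zero: "nabla_s 0 = 0"
  using nabla_s_add[of 0 0] by simp

lemma left_ideal_exact_ops: "left_ideal UNIV exact_ops"
  unfolding exact_ops_def
proof (rule wa.left_ideal_annihilator)
  show "0 \<in> nabla_s ` chi_local"
    using nabla_s_zero chi_local_emb[of 0] by (metis emb_eq_0 image_eqI)
next
  fix x y assume "x \<in> nabla_s ` chi_local" "y \<in> nabla_s ` chi_local"
  then show "x + y \<in> nabla_s ` chi_local"
    using chi_local_add by (auto simp flip: nabla_s_add)
next
  fix a x assume "x \<in> nabla_s ` chi_local"
  then show "emb a * x \<in> nabla_s ` chi_local"
    using chi_local_mult[OF chi_local_emb] by (auto simp flip: nabla_s_emb)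
next
  fix v x assume "x \<in> nabla_s ` chi_local"
  then show "twist chi.chi (Dv v) x \<in> nabla_s ` chi_local"
    using chi_local_twist_Dv by (auto simp flip: nabla_s_twist)
qed

abbreviation "Dm i j \<equiv> Dv (entry (nat3 i) (nat3 j))"

lemma act_dd: "wa.act (dd i j) f = twist chi.chi (Dm i j) f"
  by (simp add: dd_def d_op_def wa.act_rweyl_diff)

lemma act_dd_one: "wa.act (dd i j) 1 = - chi.G $ i $ j / (2 * chi.chi)"
  by (simp add: act_dd twist_one derivation_Dv chi.D_chi)

lemma act_dd_dd_one: "wa.act (dd i j * dd k l) 1
    = (3 * chi.G $ i $ j * chi.G $ k $ l - 2 * chi.chi * Dm i j (chi.G $ k $ l)) / (4 * chi.chi * chi.chi)"
  by (simp only: wa.act_mult act_dd twist_twist_one[OF derivation_Dv derivation_Dv chi_nonzero] chi.D_chi)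

text \<open>By \<open>row_identity\<close> the sum acts on 1 as x^2 if i = j and as zero otherwise,
  where x is \<open>twist chi.chi Ds\<close>. The primitive comes from 1 - x^2 = (1 + x)(1 - x), as
  \<open>nabla_s\<close> is 1 + x.\<close>

lemma exact_ops_orthogonal: "(if i = j then 1 else 0) - (\<Sum>k\<in>UNIV. dd i k * dd j k) \<in> exact_ops"
proof -
  let ?u = "twist chi.chi Ds 1"
  have "wa.act (\<Sum>k\<in>UNIV. dd i k * dd j k) 1
      = (\<Sum>k\<in>UNIV. 3 * chi.G $ i $ k * chi.G $ j $ k - 2 * chi.chi * Dm i k (chi.G $ j $ k)) / (4 * chi.chi * chi.chi)"
    by (simp only: wa.act_sum act_dd_dd_one sum_divide_distrib)
  also have "\<dots> = (if i = j then twist chi.chi Ds ?u else 0)"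
    unfolding chi.row_identity twist_twist_one[OF derivation_Ds derivation_Ds chi_nonzero] chi.Ds_chi by simp
  finally have "wa.act ((if i = j then 1 else 0) - (\<Sum>k\<in>UNIV. dd i k * dd j k)) 1
      = (if i = j then 1 - twist chi.chi Ds ?u else 0)"
    by (simp add: wa.act_diff wa.act_one wa.act_zero)
  also have "\<dots> = nabla_s (if i = j then 1 - ?u else 0)"
  proof -
    have "twist chi.chi Ds (1 - ?u) = ?u - twist chi.chi Ds ?u"
      by (simp add: eq_diff_eq derivation_Ds flip: twist_add)
    then have "nabla_s (1 - ?u) = 1 - twist chi.chi Ds ?u" by (simp add: nabla_s_def)
    then show ?thesis by (simp add: nabla_s_zero)
  qed
  finally show ?thesis
    unfolding exact_ops_def using chi_local_diff[OF chi_local_one chi_local_twist_Ds[OF chi_local_one]] chi_local_emb[of 0]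
    by (auto simp: emb_simps intro!: image_eqI)
qed

text \<open>By \<open>cofactor_identity\<close> the cofactor acts on 1 as minus the twisted
  s-derivative of \<open>dd i j\<close>; subtracting \<open>dd i j\<close> completes this to minus
  \<open>nabla_s\<close>.\<close>

lemma exact_ops_cofactor: "dcof i j - dd i j \<in> exact_ops"
proof -
  let ?u = "twist chi.chi (Dm i j) 1"
  have det: "det (map_matrix emb Tm) \<noteq> 0"
    using disc_nonzero by (simp add: map_matrix_hom[OF ring_hom_emb] emb_eq_0)
  have "wa.act (dcof i j) 1 = - ((3 * chi.chi_s * chi.G $ i $ j - 2 * chi.chi * Ds (chi.G $ i $ j)) / (4 * chi.chi * chi.chi))"
    unfolding dcof_def wa.act_diff act_dd_dd_one diff_divide_distrib[symmetric] chi.cofactor_identity[OF det]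
    by (rule minus_divide_left[symmetric])
  also have "\<dots> = - twist chi.chi Ds ?u"
    unfolding twist_twist_one[OF derivation_Ds derivation_Dv chi_nonzero] chi.D_chi chi.Ds_chi ..
  finally have "wa.act (dcof i j - dd i j) 1 = - nabla_s ?u"
    by (simp add: wa.act_diff act_dd nabla_s_def)
  also have "\<dots> = nabla_s (emb (- 1) * ?u)"
    by (simp only: nabla_s_emb) (simp add: emb_simps)
  finally show ?thesis
    unfolding exact_ops_def using chi_local_mult[OF chi_local_emb chi_local_twist_Dv[OF chi_local_one]] by blast
qed

text \<open>Expansion along the first row combines the cofactor relations with one row
  relation.\<close>

lemma exact_ops_det: "1 - ddet \<in> exact_ops"
proof -
  note I = left_idealD[OF left_ideal_exact_ops]
  have "ddet = (\<Sum>j\<in>UNIV. dd 1 j * dcof 1 j)"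
    by (simp add: ddet_def dd_dcof)
  then have "1 - ddet = (1 - (\<Sum>j\<in>UNIV. dd 1 j * dd 1 j)) - (\<Sum>j\<in>UNIV. dd 1 j * (dcof 1 j - dd 1 j))"
    by (simp add: right_diff_distrib sum_subtractf)
  also have "\<dots> \<in> exact_ops"
  proof (rule left_ideal_diff[OF left_ideal_exact_ops])
    show "1 - (\<Sum>j\<in>UNIV. dd 1 j * dd 1 j) \<in> exact_ops"
      using exact_ops_orthogonal[of 1 1] by simp
    show "(\<Sum>j\<in>UNIV. dd 1 j * (dcof 1 j - dd 1 j)) \<in> exact_ops"
      by (intro left_ideal_sum[OF left_ideal_exact_ops] I(3) exact_ops_cofactor UNIV_I)
  qed
  finally show ?thesis .
qed

text \<open>These operators annihilate 1 itself, by \<open>rotation_identity\<close>.\<close>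

lemma exact_ops_rotation:
  "(\<Sum>k\<in>UNIV. rweyl_coeff (tvar i k) * dd j k) - (\<Sum>k\<in>UNIV. rweyl_coeff (tvar j k) * dd i k) \<in> exact_ops"
proof -
  have "wa.act (\<Sum>k\<in>UNIV. rweyl_coeff (tvar i k) * dd j k) 1
      = - (\<Sum>k\<in>UNIV. map_matrix emb Tm $ i $ k * chi.G $ j $ k) / (2 * chi.chi)" for i j
  proof -
    have "map_matrix emb Tm $ i $ k = emb (tvar i k)" for k by (simp add: map_matrix_def Tm_def)
    then show ?thesis
      by (simp add: wa.act_sum wa.act_mult wa.act_coeff act_dd_one sum_divide_distrib sum_negf)
  qed
  then have "wa.act ((\<Sum>k\<in>UNIV. rweyl_coeff (tvar i k) * dd j k) - (\<Sum>k\<in>UNIV. rweyl_coeff (tvar j k) * dd i k)) 1 = 0"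
    using chi.rotation_identity[of i j] by (simp only: wa.act_diff) simp
  then show ?thesis
    unfolding exact_ops_def using nabla_s_zero chi_local_emb[of 0] by (auto simp: emb_simps intro!: image_eqI[of _ _ 0])
qed

section \<open>The ideal of the theorem and independence of the basis operators\<close>

definition "generators = {gen_d} \<union> {gen_g i j | i j. 1 \<le> i \<and> i \<le> j \<and> j \<le> 3} \<union> {gen_P i j | i j. 1 \<le> i \<and> i < j \<and> j \<le> 3}"

lemma generators_subset_exact_ops: "generators \<subseteq> exact_ops"
proof -
  have "gen_g i j \<in> exact_ops" if *: "1 \<le> i" "i \<le> j" "j \<le> 3" for i j
  proof -
    obtain a where "i = nat3 a" using nat3_surj[of i] * by auto
    moreover obtain c where "j = nat3 c" using nat3_surj[of j] * by auto
    ultimately show ?thesis using exact_ops_orthogonal[of a c] by (simp add: gen_g_eq)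
  qed
  moreover have "gen_P i j \<in> exact_ops" if *: "1 \<le> i" "i < j" "j \<le> 3" for i j
  proof -
    obtain a where "i = nat3 a" using nat3_surj[of i] * by auto
    moreover obtain c where "j = nat3 c" using nat3_surj[of j] * by auto
    ultimately show ?thesis using exact_ops_rotation[of a c] by (simp add: gen_P_eq)
  qed
  ultimately show ?thesis
    using exact_ops_det by (auto simp: generators_def gen_d_eq)
qed

lemma generators_subset_weyl: "generators \<subseteq> weyl_algebra"
  using generators_in_weyl_algebra by (auto simp: generators_def)

definition rot_ideal :: "9 rweyl set" where
  "rot_ideal = left_ideal_gen UNIV (left_ideal_gen weyl_algebra generators)"

lemma rot_ideal_subset_exact_ops: "rot_ideal \<subseteq> exact_ops"
  unfolding rot_ideal_def
  by (intro left_ideal_gen_weyl_subset left_ideal_exact_ops generators_subset_exact_ops generators_subset_weyl)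

interpretation ri: rotation_ideal rot_ideal
proof
  show "left_ideal UNIV rot_ideal"
    unfolding rot_ideal_def by (rule left_ideal_gen_left_ideal) (auto intro: left_ideal_UNIV)
  have sub: "generators \<subseteq> rot_ideal"
    unfolding rot_ideal_def by (meson hull_subset order_trans)
  show "gen_d \<in> rot_ideal" using sub by (auto simp: generators_def)
  show "gen_g i j \<in> rot_ideal" if "1 \<le> i" "i \<le> j" "j \<le> 3" for i j
    using that by (intro subsetD[OF sub]) (auto simp: generators_def)
  show "gen_P i j \<in> rot_ideal" if "1 \<le> i" "i < j" "j \<le> 3" for i j
    using that by (intro subsetD[OF sub]) (auto simp: generators_def)
qed

text \<open>Cayley-Hamilton expresses \<open>dK\<close> times \<open>cofm Tm\<close> in the frame.
  The coordinate along S^2 T is nonzero, which makes the third frame operator detectable.\<close>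

lemma coord_cofm: "dK * gm.coord (cofm Tm) $ c = (if c = 1 then bK else if c = 2 then - pK else 1)"
proof -
  have "dK * cofm Tm $ i $ j = gm.Wm 3 $ i $ j - pK * gm.Wm 2 $ i $ j + bK * gm.Wm 1 $ i $ j" for i j
    using S_square_mult[of Tm i j] by (simp add: gm.Wm_def gm.S_def)
  note eq = this
  have "dK * gm.coord (cofm Tm) $ c = (\<Sum>i\<in>UNIV. \<Sum>j\<in>UNIV. gm.coeff_coord c i j * (dK * cofm Tm $ i $ j))"
    unfolding gm.coord_eq_sum by (simp add: sum_distrib_left mult.left_commute)
  also have "\<dots> = gm.coord (gm.Wm 3) $ c - pK * gm.coord (gm.Wm 2) $ c + bK * gm.coord (gm.Wm 1) $ c"
    unfolding gm.coord_eq_sum eq by (simp add: sum_3 algebra_simps)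
  finally show ?thesis
    unfolding gm.coord_Wm using exhaust_3[of c] by (auto simp: axis_def)
qed

text \<open>Up to the factor -1/(2 chi), these are the frame coordinates of the gradient
  \<open>chi.G\<close>.\<close>

lemma act_frame_op: "wa.act (frame_op c) 1
   = (2 * (svar ^ 2 + emb pK) * emb (axis 1 1 $ c) + 4 * svar * emb (gm.coord (cofm Tm) $ c) - 4 * emb (axis 2 1 $ c)) / chi.chi"
proof -
  define n where "n i j = emb (gm.coeff_coord c i j)" for i j
  have coord: "(\<Sum>i\<in>UNIV. \<Sum>j\<in>UNIV. n i j * map_matrix emb A $ i $ j) = emb (gm.coord A $ c)" for A
    by (simp add: gm.coord_eq_sum sum_3 n_def map_matrix_def emb_simps)
  have cof: "cofm (map_matrix emb Tm) = map_matrix emb (cofm Tm)"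
    by (simp add: cofm_def map_matrix_def vec_eq_iff emb_simps)
  have G: "chi.G $ i $ j = - 4 * (svar^2 + emb pK) * map_matrix emb (gm.Wm 1) $ i $ j - 8 * svar * map_matrix emb (cofm Tm) $ i $ j
      + 8 * map_matrix emb (gm.Wm 2) $ i $ j" for i j
    by (simp add: chi.G_def cof chi_invariants gm.Wm_def map_matrix_hom[OF ring_hom_emb])
  have A: "(\<Sum>i\<in>UNIV. \<Sum>j\<in>UNIV. n i j * chi.G $ i $ j) = - 4 * (svar^2 + emb pK) * emb (gm.coord (gm.Wm 1) $ c)
     - 8 * svar * emb (gm.coord (cofm Tm) $ c) + 8 * emb (gm.coord (gm.Wm 2) $ c)"
    unfolding coord[symmetric] G by (simp add: sum_3 algebra_simps)
  have B: "wa.act (frame_op c) 1 = - (\<Sum>i\<in>UNIV. \<Sum>j\<in>UNIV. n i j * chi.G $ i $ j) / (2 * chi.chi)"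
    by (simp add: frame_op_def wa.act_sum wa.act_mult wa.act_coeff act_dd_one n_def sum_divide_distrib sum_negf)
  show ?thesis
    unfolding B A gm.coord_Wm using chi_nonzero by (simp add: field_simps)
qed

text \<open>The operators send 1 to 1 and to three fractions that span the same space as 1/chi,
  s/chi, s^2/chi; these are independent modulo the image of \<open>nabla_s\<close>.\<close>

lemma basis_independent:
  assumes "(\<Sum>n<4. rweyl_coeff (c n) * basis_op n) \<in> rot_ideal"
  shows "\<forall>n<4. c n = 0"
proof -
  define e where "e a = gm.coord (cofm Tm) $ a" for a
  define b1 where "b1 = 4 * (c 1 * e 1 + c 2 * e 2 + c 3 * e 3)"
  have "wa.act (\<Sum>n<4. rweyl_coeff (c n) * basis_op n) 1 = emb (c 0)
     + (emb (c 1) * (2 * (svar ^ 2 + emb pK) + 4 * svar * emb (e 1)) + emb (c 2) * (4 * svar * emb (e 2) - 4) + emb (c 3) * (4 * svar * emb (e 3))) / chi.chi"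
    by (simp add: sum_lessThan_4 basis_op_def wa.act_add wa.act_mult wa.act_coeff wa.act_one act_frame_op axis_def
        emb_simps e_def)
      (simp add: chi_nonzero field_simps)
  also have "\<dots> = emb (c 0) + Fract [: 2 * pK * c 1 - 4 * c 2, b1, 2 * c 1 :] 1 / chi.chi"
    by (simp add: Fract_pCons emb_simps b1_def power2_eq_square algebra_simps flip: Zero_fract_def)
  finally have "wa.act (\<Sum>n<4. rweyl_coeff (c n) * basis_op n) 1 = emb (c 0) + Fract [: 2 * pK * c 1 - 4 * c 2, b1, 2 * c 1 :] 1 / chi.chi" .
  moreover have "wa.act (\<Sum>n<4. rweyl_coeff (c n) * basis_op n) 1 \<in> nabla_s ` chi_local"
    using assms rot_ideal_subset_exact_ops by (auto simp: exact_ops_def)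
  ultimately obtain h where "h \<in> chi_local" "nabla_s h = emb (c 0) + Fract [: 2 * pK * c 1 - 4 * c 2, b1, 2 * c 1 :] 1 / chi.chi"
    by auto
  from nabla_s_image_independent[OF this] have *: "c 0 = 0" "c 1 = 0" "c 2 = 0" "b1 = 0"
    by auto
  \<comment> \<open>As \<open>c 1\<close> and \<open>c 2\<close> vanish, \<open>b1 = 0\<close> says
    that \<open>c 3 * e 3\<close> is zero.\<close>
  have "dK * e 3 = 1" unfolding e_def coord_cofm by simp
  then have "c 3 = 0" using * by (auto simp: b1_def)
  then show ?thesis using * by (auto simp: less_Suc_eq numeral_eq_Suc One_nat_def)
qed

theorem proposition3p5:
  shows "holonomic_rank (left_ideal_gen weyl_algebra
     ({gen_d} \<union> {gen_g i j | i j. 1 \<le> i \<and> i \<le> j \<and> j \<le> 3}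
       \<union> {gen_P i j | i j. 1 \<le> i \<and> i < j \<and> j \<le> 3})) = 4"
proof -
  have "holonomic_rank (left_ideal_gen weyl_algebra generators) = enat 4"
    by (rule holonomic_rank_eqI[where b = basis_op]; fold rot_ideal_def)
      (use ri.basis_span_UNIV in \<open>auto simp: ri.basis_span_def dest: basis_independent\<close>)
  then show ?thesis by (simp add: generators_def numeral_eq_enat)
qed

end
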